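(* For every $n\in\mathbb N$, as an abelian group $H(\widetilde T)$ has rank $$\operatorname{rk} H(\widetilde T)=\binom{2n}{n}.$$ Moreover, $H(\widetilde T)$ is a free abelian group.
   Context: $B^n$ is the set of crossingless matchings of the $2n$ points $\{1,\dots,2n\}$ on a line: partitions of the points into $n$ pairs (arcs) which can be drawn as $n$ pairwise disjoint half-circles on one side of the line (arcs may be nested). For $a\in B^n$ let $T_a\subset (S^1)^{2n}$ be the set of $(x_1,\dots,x_{2n})$ with $x_i=x_j$ whenever $i,j$ are joined by an arc of $a$, and let $\widetilde T:=\bigcup_{a\in B^n}T_a\subset (S^1)^{2n}$ with the subspace topology. $H(X)=\bigoplus_kH^k(X)$ is the integral singular cohomology ring. *)

theory Defs
  imports "HOL-Homology.Homology" "HOL-Analysis.Analysis" "HOL-Library.Disjoint_Sets"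
    "HOL-Library.Extended_Nat"
begin

text \<open>Cochains are homomorphisms out of the library's group of singular chains; they are kept
  extensional on the set of chains so that the group operations determine them uniquely.\<close>

definition cochain_group :: "nat \<Rightarrow> 'a topology \<Rightarrow> ('a chain \<Rightarrow> int) monoid" where
  "cochain_group p X =
     \<lparr>carrier = hom (chain_group p X) integer_group \<inter> extensional (carrier (chain_group p X)),
      monoid.mult = (\<lambda>f g. \<lambda>c\<in>carrier (chain_group p X). f c + g c),
      one = (\<lambda>c\<in>carrier (chain_group p X). 0)\<rparr>"

definition coboundary :: "nat \<Rightarrow> 'a topology \<Rightarrow> ('a chain \<Rightarrow> int) \<Rightarrow> ('a chain \<Rightarrow> int)" where
  "coboundary p X f =
     (\<lambda>c\<in>carrier (chain_group (Suc p) X). f (chain_boundary (Suc p) c))"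

definition singular_cocycles :: "nat \<Rightarrow> 'a topology \<Rightarrow> ('a chain \<Rightarrow> int) set" where
  "singular_cocycles p X =
     kernel (cochain_group p X) (cochain_group (Suc p) X) (coboundary p X)"

definition singular_coboundaries :: "nat \<Rightarrow> 'a topology \<Rightarrow> ('a chain \<Rightarrow> int) set" where
  "singular_coboundaries p X =
     (case p of 0 \<Rightarrow> {\<one>\<^bsub>cochain_group 0 X\<^esub>}
              | Suc q \<Rightarrow> coboundary q X ` carrier (cochain_group q X))"

definition cohomology_group :: "nat \<Rightarrow> 'a topology \<Rightarrow> ('a chain \<Rightarrow> int) set monoid" where
  "cohomology_group p X =
     (cochain_group p X)\<lparr>carrier := singular_cocycles p X\<rparr> Mod singular_coboundaries p X"

definition total_cohomology :: "'a topology \<Rightarrow> (nat \<Rightarrow> ('a chain \<Rightarrow> int) set) monoid" where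
  "total_cohomology X = sum_group UNIV (\<lambda>p. cohomology_group p X)"

lemma comm_group_cochain_group: "comm_group (cochain_group p X)"
proof (rule comm_groupI)
  fix f assume f: "f \<in> carrier (cochain_group p X)"
  define g where "g = (\<lambda>c\<in>carrier (chain_group p X). - f c)"
  have "g \<in> carrier (cochain_group p X)"
    using f by (auto simp: g_def cochain_group_def hom_def integer_group_def singular_chain_add)
  moreover have "g \<otimes>\<^bsub>cochain_group p X\<^esub> f = \<one>\<^bsub>cochain_group p X\<^esub>"
    by (auto simp: g_def cochain_group_def fun_eq_iff)
  ultimately show "\<exists>y\<in>carrier (cochain_group p X).
      y \<otimes>\<^bsub>cochain_group p X\<^esub> f = \<one>\<^bsub>cochain_group p X\<^esub>" by blast
next
  fix f assume f: "f \<in> carrier (cochain_group p X)"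
  then show "\<one>\<^bsub>cochain_group p X\<^esub> \<otimes>\<^bsub>cochain_group p X\<^esub> f = f"
    by (auto simp: cochain_group_def fun_eq_iff extensional_def)
qed (auto simp: cochain_group_def hom_def integer_group_def singular_chain_add fun_eq_iff)

lemma coboundary_in_cochain_group:
  assumes "f \<in> carrier (cochain_group p X)"
  shows "coboundary p X f \<in> carrier (cochain_group (Suc p) X)"
  using assms
  by (auto simp: cochain_group_def coboundary_def hom_def integer_group_def Pi_iff
      singular_chain_add chain_boundary_add singular_chain_boundary_alt)

lemma coboundary_hom:
  "coboundary p X \<in> hom (cochain_group p X) (cochain_group (Suc p) X)"
proof (rule homI)
  fix f assume "f \<in> carrier (cochain_group p X)"
  then show "coboundary p X f \<in> carrier (cochain_group (Suc p) X)"
    by (rule coboundary_in_cochain_group)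
next
  fix f g
  show "coboundary p X (f \<otimes>\<^bsub>cochain_group p X\<^esub> g) =
        coboundary p X f \<otimes>\<^bsub>cochain_group (Suc p) X\<^esub> coboundary p X g"
    by (auto simp: cochain_group_def coboundary_def fun_eq_iff singular_chain_boundary_alt)
qed

lemma coboundary_coboundary:
  assumes "f \<in> carrier (cochain_group p X)"
  shows "coboundary (Suc p) X (coboundary p X f) = \<one>\<^bsub>cochain_group (Suc (Suc p)) X\<^esub>"
proof -
  have "f \<in> hom (chain_group p X) integer_group"
    using assms by (simp add: cochain_group_def)
  then have "f (0 + 0) = f 0 + f 0"
    by (metis (no_types, lifting) hom_mult carrier_chain_group mem_Collect_eq mult_chain_group
        singular_chain_0 mult_integer_group)
  then have "f 0 = 0" by simp
  then show ?thesis
    by (auto simp: cochain_group_def coboundary_def fun_eq_iff singular_chain_boundary_alt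
        chain_boundary_boundary_alt)
qed

lemma coboundary_group_hom:
  "group_hom (cochain_group p X) (cochain_group (Suc p) X) (coboundary p X)"
  by (simp add: group_hom_def group_hom_axioms_def comm_group_cochain_group coboundary_hom
      comm_group.axioms(2))

lemma subgroup_singular_cocycles: "subgroup (singular_cocycles p X) (cochain_group p X)"
  unfolding singular_cocycles_def by (rule group_hom.subgroup_kernel [OF coboundary_group_hom])

lemma subgroup_singular_coboundaries:
  "subgroup (singular_coboundaries p X) (cochain_group p X)"
proof (cases p)
  case 0
  then show ?thesis
    by (simp add: singular_coboundaries_def group.triv_subgroup comm_group_cochain_group
        comm_group.axioms(2))
next
  case (Suc q)
  then show ?thesis
    using group_hom.img_is_subgroup [OF coboundary_group_hom]
    by (simp add: singular_coboundaries_def)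
qed

lemma singular_coboundaries_subset_cocycles:
  "singular_coboundaries p X \<subseteq> singular_cocycles p X"
proof (cases p)
  case 0
  then show ?thesis
    using subgroup.one_closed [OF subgroup_singular_cocycles]
    by (simp add: singular_coboundaries_def)
next
  case (Suc q)
  then show ?thesis
    by (auto simp: singular_coboundaries_def singular_cocycles_def kernel_def
        coboundary_in_cochain_group coboundary_coboundary)
qed

lemma comm_group_cohomology_group: "comm_group (cohomology_group p X)"
proof -
  interpret C: comm_group "cochain_group p X" by (rule comm_group_cochain_group)
  let ?Z = "(cochain_group p X)\<lparr>carrier := singular_cocycles p X\<rparr>"
  have Z: "comm_group ?Z"
  proof (rule group.group_comm_groupI)
    show "group ?Z"
      by (rule C.subgroup_imp_group [OF subgroup_singular_cocycles])
  qed (use subgroup.subset [OF subgroup_singular_cocycles] in \<open>auto intro: C.m_comm\<close>)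
  have "subgroup (singular_coboundaries p X) ?Z"
    using C.subgroup_incl subgroup_singular_cocycles subgroup_singular_coboundaries
      singular_coboundaries_subset_cocycles by blast
  then show ?thesis
    unfolding cohomology_group_def by (rule comm_group.abelian_FactGroup [OF Z])
qed

lemma comm_group_total_cohomology: "comm_group (total_cohomology X)"
proof (rule group.group_comm_groupI)
  show "group (total_cohomology X)"
    by (simp add: total_cohomology_def comm_group_cohomology_group comm_group.axioms(2))
next
  fix x y assume "x \<in> carrier (total_cohomology X)" "y \<in> carrier (total_cohomology X)"
  then have "x p \<otimes>\<^bsub>cohomology_group p X\<^esub> y p = y p \<otimes>\<^bsub>cohomology_group p X\<^esub> x p" for p
    by (intro comm_monoid.m_comm comm_group.axioms(1) comm_group_cohomology_group)
      (auto simp: total_cohomology_def carrier_sum_group comm_group_cohomology_group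
        comm_group.axioms(2) PiE_iff)
  then show "x \<otimes>\<^bsub>total_cohomology X\<^esub> y = y \<otimes>\<^bsub>total_cohomology X\<^esub> x"
    by (simp add: total_cohomology_def)
qed

text \<open>Taking the basis inside the element type of the group is no restriction: a basis of a free
  abelian group can always be taken to be a subset of its carrier.\<close>

definition is_free_abelian :: "'a monoid \<Rightarrow> bool" where
  "is_free_abelian G \<longleftrightarrow> comm_group G \<and> (\<exists>S::'a set. G \<cong> free_Abelian_group S)"

definition int_independent :: "'a monoid \<Rightarrow> 'a set \<Rightarrow> bool" where
  "int_independent G B \<longleftrightarrow> finite B \<and> B \<subseteq> carrier G \<and>
     (\<forall>c::'a \<Rightarrow> int. finprod G (\<lambda>b. b [^]\<^bsub>G\<^esub> c b) B = \<one>\<^bsub>G\<^esub> \<longrightarrow> (\<forall>b\<in>B. c b = 0))"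

text \<open>The supremum is \<open>\<infinity>\<close> exactly when there are arbitrarily large finite independent sets, so a
  finite value \<open>enat r\<close> says that \<open>r\<close> is the maximal size of an independent set.\<close>

definition abelian_rank :: "'a monoid \<Rightarrow> enat" where
  "abelian_rank G = (SUP B\<in>{B. int_independent G B}. enat (card B))"

text \<open>Meaningful for two-element sets \<open>A\<close>: the closed half-circle with end points \<open>A\<close> on the real
  line, drawn in the upper half-plane.\<close>

definition half_circle :: "nat set \<Rightarrow> complex set" where
  "half_circle A =
     {z. 0 \<le> Im z \<and>
         dist z (of_real ((real (Min A) + real (Max A)) / 2)) = (real (Max A) - real (Min A)) / 2}"

definition crossingless_matchings :: "nat \<Rightarrow> nat set set set" where
  "crossingless_matchings n =
     {a. partition_on {1..2 * n} a \<and> (\<forall>A\<in>a. card A = 2) \<and> disjoint_family_on half_circle a}"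

definition circle_power :: "nat \<Rightarrow> (nat \<Rightarrow> complex) topology" where
  "circle_power m = product_topology (\<lambda>_. top_of_set (sphere 0 1)) {1..m}"

definition matching_torus :: "nat \<Rightarrow> nat set set \<Rightarrow> (nat \<Rightarrow> complex) set" where
  "matching_torus n a =
     {x \<in> topspace (circle_power (2 * n)). \<forall>A\<in>a. \<forall>i\<in>A. \<forall>j\<in>A. x i = x j}"

definition T_tilde :: "nat \<Rightarrow> (nat \<Rightarrow> complex) topology" where
  "T_tilde n =
     subtopology (circle_power (2 * n)) (\<Union>a\<in>crossingless_matchings n. matching_torus n a)"

end

theory Submission
  imports Defs
begin

text \<open>A word of \<open>2n\<close> points of the circle lies in the space if and only if it is reduced to the empty word by
  repeatedly cancelling equal neighbours, that is, by a stack machine that pops the top letter if it equals the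
  letter read and pushes the letter read otherwise. Writing each pushed letter as a multiple of the top letter (of
  \<open>1\<close> if the stack is empty) and recording the positions \<open>J\<close> at which the factor differs from
  \<open>1\<close> cuts the space into cells. The closure of a cell is a torus \<open>(S\<^sup>1)\<^sup>J\<close>, and the points with some coordinate
  equal to \<open>1\<close> lie in lexicographically smaller cells. As the homology of a torus maps onto its homology
  relative to this fat wedge, which is infinite cyclic and concentrated in degree \<open>card J\<close>, attaching the tori one
  after the other only adds free summands. The sets \<open>J\<close> that occur are those for which a walk reflected at
  \<open>0\<close> returns to \<open>0\<close>; there are \<open>2n choose n\<close> of them. Cohomology follows by dualizing, the homology being free.\<close>

section \<open>Relative homeomorphisms and products with a circle\<close>

text \<open>The cells do not form a CW structure: for \<open>n = 2\<close> the words
  \<open>aaaa\<close> with \<open>a\<close> different from 1 lie on the torus of {1,2}, at points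
  with second factor 1, yet in the cell of {1,3}, which has the same dimension. A factor 1 may cause
  a cancellation, after which later positions can enter the set of pushes as well as leave it; the
  first such position is certain to leave, and everything before it is unchanged. Hence the earliest
  position dominates the order of the cells, and tori are attached by relative homology instead of a
  cellular chain complex. The cell maps use a formal stack that pushes at every position of
  \<open>J\<close>, even for the factor 1: its length is then constant, and the map is continuous
  and injective up to the boundary. That the homology of a torus covers the relative one is proved
  as a property of pairs that survives the product with a circle, by suspension. The binomial
  coefficient arises because reflected walks, having two upward choices at 0, are counted like
  simple walks on the integers seen through their absolute value.\<close>

abbreviation homology_iso ::
  "int \<Rightarrow> 'a topology \<Rightarrow> 'a set \<Rightarrow> 'b topology \<Rightarrow> 'b set \<Rightarrow> ('a \<Rightarrow> 'b) \<Rightarrow> bool" where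
  "homology_iso p X S Y T f \<equiv>
    hom_induced p X S Y T f \<in> iso (relative_homology_group p X S) (relative_homology_group p Y T)"

text \<open>Two-out-of-three for a commuting square with two opposite isomorphisms; the equivalence
  form allows transfer in either direction.\<close>

lemma iso_square:
  assumes a: "a \<in> iso A B" and c: "c \<in> iso C D"
    and f: "f \<in> hom A C" and g: "g \<in> hom B D"
    and eq: "\<And>x. x \<in> carrier A \<Longrightarrow> g (a x) = c (f x)"
  shows "f \<in> iso A C \<longleftrightarrow> g \<in> iso B D"
proof -
  have a': "bij_betw a (carrier A) (carrier B)" and c': "bij_betw c (carrier C) (carrier D)"
    using a c by (auto simp: iso_def)
  have "bij_betw f (carrier A) (carrier C) \<longleftrightarrow> bij_betw (c \<circ> f) (carrier A) (carrier D)"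
    using f by (intro bij_betw_comp_iff2 [OF c']) (auto simp: hom_def)
  also have "\<dots> \<longleftrightarrow> bij_betw (g \<circ> a) (carrier A) (carrier D)"
    by (rule bij_betw_cong) (simp add: eq)
  also have "\<dots> \<longleftrightarrow> bij_betw g (carrier B) (carrier D)"
    by (rule bij_betw_comp_iff [OF a', symmetric])
  finally show ?thesis
    using f g by (simp add: iso_def)
qed

lemma surj_square:
  assumes a: "a \<in> iso A B" and c: "c \<in> iso C D"
    and f: "f \<in> hom A C" and g: "g \<in> hom B D"
    and eq: "\<And>x. x \<in> carrier A \<Longrightarrow> g (a x) = c (f x)"
  shows "f ` carrier A = carrier C \<longleftrightarrow> g ` carrier B = carrier D"
proof -
  have a': "a ` carrier A = carrier B" and c': "c ` carrier C = carrier D" "inj_on c (carrier C)"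
    using a c by (auto simp: iso_def bij_betw_def)
  have "g ` carrier B = c ` (f ` carrier A)"
    using eq unfolding a' [symmetric] image_image by (intro image_cong) auto
  moreover have "f ` carrier A \<subseteq> carrier C"
    using f by (auto simp: hom_def)
  ultimately show ?thesis
    using c' by (metis inj_on_image_eq_iff subset_refl)
qed

section \<open>Deformations of pairs and relative homeomorphisms\<close>

lemma homotopic_with_pairI:
  assumes h: "continuous_map (prod_topology (top_of_set {0..1::real}) X) Y h"
    and 0: "\<And>x. x \<in> topspace X \<Longrightarrow> h (0, x) = f x"
    and 1: "\<And>x. x \<in> topspace X \<Longrightarrow> h (1, x) = g x"
    and S: "S \<subseteq> topspace X" "\<And>t x. \<lbrakk>t \<in> {0..1}; x \<in> S\<rbrakk> \<Longrightarrow> h (t, x) \<in> T"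
  shows "homotopic_with (\<lambda>h. h \<in> S \<rightarrow> T) X Y f g"
proof (subst homotopic_with)
  show "(h \<in> S \<rightarrow> T) = (k \<in> S \<rightarrow> T)" if "\<And>x. x \<in> topspace X \<Longrightarrow> h x = k x" for h k
    using that S(1) by (auto simp: Pi_iff subset_iff)
  show "\<exists>h. continuous_map (prod_topology (top_of_set {0..1::real}) X) Y h \<and>
      (\<forall>x\<in>topspace X. h (0, x) = f x) \<and> (\<forall>x\<in>topspace X. h (1, x) = g x) \<and>
      (\<forall>t\<in>{0..1}. (\<lambda>x. h (t, x)) \<in> S \<rightarrow> T)"
    using assms by (intro exI [of _ h]) auto
qed

text \<open>The end map of the deformation carries the pair \<open>(X, S)\<close> into
  \<open>(X, L)\<close> and is a homotopy inverse of the identity. Points of \<open>L\<close> may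
  move inside \<open>L\<close>, as happens on boundaries that contain \<open>B\<close> times an
  interval or a circle.\<close>

lemma deformation_relative_homology_iso:
  assumes h: "continuous_map (prod_topology (top_of_set {0..1::real}) X) X h"
    and 0: "\<And>x. x \<in> topspace X \<Longrightarrow> h (0, x) = x"
    and LS: "L \<subseteq> S" "S \<subseteq> topspace X"
    and hL: "\<And>t x. \<lbrakk>t \<in> {0..1}; x \<in> L\<rbrakk> \<Longrightarrow> h (t, x) \<in> L"
    and hS: "\<And>t x. \<lbrakk>t \<in> {0..1}; x \<in> S\<rbrakk> \<Longrightarrow> h (t, x) \<in> S"
    and h1: "\<And>x. x \<in> S \<Longrightarrow> h (1, x) \<in> L"
  shows "homology_iso p X L X S id"
proof (rule homotopy_equivalence_relative_homology_group_isomorphism [where g = "\<lambda>x. h (1, x)"])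
  have "continuous_map X (prod_topology (top_of_set {0..1::real}) X) (\<lambda>x. (1, x))"
    by (intro continuous_map_pairedI) auto
  then show h1': "continuous_map X X (\<lambda>x. h (1, x))"
    using continuous_map_compose [OF _ h] by (simp add: o_def)
  show "homotopic_with (\<lambda>h. h \<in> L \<rightarrow> L) X X ((\<lambda>x. h (1, x)) \<circ> id) id"
    by (rule homotopic_with_symD, rule homotopic_with_pairI [OF h]) (use assms in auto)
  show "homotopic_with (\<lambda>h. h \<in> S \<rightarrow> S) X X (id \<circ> (\<lambda>x. h (1, x))) id"
    by (rule homotopic_with_symD, rule homotopic_with_pairI [OF h]) (use assms in auto)
qed (use assms in auto)

lemma trivial_relative_homology_deformation:
  assumes h: "continuous_map (prod_topology (top_of_set {0..1::real}) X) X h"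
    and 0: "\<And>x. x \<in> topspace X \<Longrightarrow> h (0, x) = x"
    and L: "L \<subseteq> topspace X"
    and hL: "\<And>t x. \<lbrakk>t \<in> {0..1}; x \<in> L\<rbrakk> \<Longrightarrow> h (t, x) \<in> L"
    and h1: "\<And>x. x \<in> topspace X \<Longrightarrow> h (1, x) \<in> L"
  shows "trivial_group (relative_homology_group p X L)"
proof -
  have "homology_iso p X L X (topspace X) id"
  proof (rule deformation_relative_homology_iso [OF h 0 L])
    show "h (t, x) \<in> topspace X" if "t \<in> {0..1}" "x \<in> topspace X" for t x
      using h that by (auto simp: continuous_map_def)
  qed (use hL h1 in auto)
  then have "relative_homology_group p X (topspace X) \<cong> relative_homology_group p X L"
    by (metis group.iso_sym group_relative_homology_group is_isoI)
  then show ?thesis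
    by (meson isomorphic_group_triviality1 group_relative_homology_group trivial_relative_homology_group_topspace)
qed

text \<open>\<open>L\<close> and \<open>Y\<close> are thickened to \<open>S\<close> and
  \<open>S'\<close>, then \<open>V\<close> and its preimage are excised. On what is left
  \<open>\<phi>\<close> is a continuous bijection, and a closed map because it comes from a compact
  space and goes to a Hausdorff space. The excised \<open>V\<close> is kept apart from
  \<open>Y\<close>: it must be closed and interior to \<open>S'\<close>, which \<open>Y\<close> need
  not be.\<close>

lemma relative_homology_iso_compact:
  assumes Q: "compact_space Q" and Z: "Hausdorff_space Z" and \<phi>: "continuous_map Q Z \<phi>"
    and V: "closedin Z V" "V \<subseteq> Z interior_of S'" "S' \<subseteq> topspace Z"
    and inj: "inj_on \<phi> {q \<in> topspace Q. \<phi> q \<notin> V}"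
    and surj: "topspace Z - V \<subseteq> \<phi> ` topspace Q"
    and S: "S = {q \<in> topspace Q. \<phi> q \<in> S'}"
    and LY: "\<phi> \<in> L \<rightarrow> Y" "L \<subseteq> S" "Y \<subseteq> S'"
    and isoQ: "homology_iso p Q L Q S id"
    and isoZ: "homology_iso p Z Y Z S' id"
  shows "homology_iso p Q L Z Y \<phi>"
proof -
  define U where "U = {q \<in> topspace Q. \<phi> q \<in> V}"
  have closed: "closedin Q U"
    unfolding U_def by (rule closedin_continuous_map_preimage [OF \<phi> V(1)])
  have "openin Q {q \<in> topspace Q. \<phi> q \<in> Z interior_of S'}"
    by (rule openin_continuous_map_preimage [OF \<phi>]) auto
  moreover have "{q \<in> topspace Q. \<phi> q \<in> Z interior_of S'} \<subseteq> S"
    using S interior_of_subset by fastforce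
  moreover have "U \<subseteq> {q \<in> topspace Q. \<phi> q \<in> Z interior_of S'}"
    using V by (auto simp: U_def)
  ultimately have US: "U \<subseteq> Q interior_of S"
    by (meson interior_of_maximal subset_trans)
  have \<phi>t: "\<phi> q \<in> topspace Z" if "q \<in> topspace Q" for q
    using that \<phi> by (auto simp: continuous_map_def)
  let ?Q = "subtopology Q (topspace Q - U)" and ?Z = "subtopology Z (topspace Z - V)"
  have homeo: "homeomorphic_map ?Q ?Z \<phi>"
  proof (rule bijective_closed_imp_homeomorphic_map)
    show "continuous_map ?Q ?Z \<phi>"
      using \<phi> by (auto simp: continuous_map_in_subtopology U_def \<phi>t intro: continuous_map_from_subtopology)
    show "closed_map ?Q ?Z \<phi>"
      by (rule closed_map_restriction [OF continuous_imp_closed_map [OF \<phi> Q Z]]) (auto simp: U_def \<phi>t)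
    show "\<phi> ` topspace ?Q = topspace ?Z"
      using surj by (auto simp: U_def \<phi>t image_iff subset_iff)
    show "inj_on \<phi> (topspace ?Q)"
      by (rule inj_on_subset [OF inj]) (auto simp: U_def)
  qed
  have im: "\<phi> ` (S - U) = S' - V"
    using surj V(3) by (auto simp: U_def S image_iff subset_iff)
  have iso1: "homology_iso p ?Q (S - U) ?Z (S' - V) \<phi>"
    by (rule homeomorphic_map_relative_homology_iso [OF homeo _ im]) (auto simp: S)
  have exQ: "homology_iso p ?Q (S - U) Q S id"
    using homology_excision_axiom [of Q U S "topspace Q" p] US closed by (auto simp: S closure_of_closedin)
  have exZ: "homology_iso p ?Z (S' - V) Z S' id"
    using homology_excision_axiom [of Z V S' "topspace Z" p] V by (auto simp: closure_of_closedin)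
  have cont: "continuous_map ?Q ?Z \<phi>" "continuous_map ?Q Q id" "continuous_map ?Z Z id"
    using homeo by (auto simp: homeomorphic_imp_continuous_map intro: continuous_map_from_subtopology)
  have SS: "\<phi> \<in> S \<rightarrow> S'" by (auto simp: S)
  have iso2: "homology_iso p Q S Z S' \<phi>"
  proof (subst iso_square [OF exQ exZ, symmetric])
    show "hom_induced p Q S Z S' \<phi> (hom_induced p ?Q (S - U) Q S id x) =
          hom_induced p ?Z (S' - V) Z S' id (hom_induced p ?Q (S - U) ?Z (S' - V) \<phi> x)" for x
      using im cont \<phi> SS by (subst (1 2) hom_induced_compose') auto
  qed (use iso1 in \<open>auto simp: hom_induced_hom\<close>)
  show ?thesis
  proof (subst iso_square [OF isoQ isoZ])
    show "hom_induced p Q S Z S' \<phi> (hom_induced p Q L Q S id x) =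
          hom_induced p Z Y Z S' id (hom_induced p Q L Z Y \<phi> x)" for x
      using \<phi> SS LY by (subst (1 2) hom_induced_compose') auto
  qed (use iso2 in \<open>auto simp: hom_induced_hom\<close>)
qed

section \<open>Relative suspension on a cylinder\<close>

definition cylinder :: "'a topology \<Rightarrow> ('a \<times> real) topology" where
  "cylinder X = prod_topology X (top_of_set {0..1})"

definition cylinder_boundary :: "'a topology \<Rightarrow> 'a set \<Rightarrow> ('a \<times> real) set" where
  "cylinder_boundary X B = topspace X \<times> {0, 1} \<union> B \<times> {0..1}"

definition cylinder_base :: "'a topology \<Rightarrow> 'a set \<Rightarrow> ('a \<times> real) set" where
  "cylinder_base X B = topspace X \<times> {0} \<union> B \<times> {0..1}"

lemma topspace_cylinder [simp]: "topspace (cylinder X) = topspace X \<times> {0..1}"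
  by (simp add: cylinder_def)

lemma continuous_map_into_cylinder:
  assumes f: "continuous_map Y X f" and g: "continuous_map Y euclideanreal g"
    and "\<And>y. y \<in> topspace Y \<Longrightarrow> g y \<in> {0..1}"
  shows "continuous_map Y (cylinder X) (\<lambda>y. (f y, g y))"
  using assms unfolding cylinder_def
  by (auto simp: continuous_map_paired continuous_map_in_subtopology)

lemma cylinder_projections:
  "continuous_map (cylinder X) X fst" "continuous_map (cylinder X) euclideanreal snd"
  unfolding cylinder_def
  by (auto simp: continuous_map_fst intro: continuous_map_into_fulltopology continuous_map_snd)

lemma homotopy_projections:
  "continuous_map (prod_topology (top_of_set {0..1::real}) X) euclideanreal fst"
  "continuous_map (prod_topology (top_of_set {0..1::real}) X) X snd"
  by (auto simp: continuous_map_snd intro: continuous_map_into_fulltopology continuous_map_fst)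

lemma trivial_relative_homology_cylinder_base:
  assumes "B \<subseteq> topspace X"
  shows "trivial_group (relative_homology_group p (cylinder X) (cylinder_base X B))"
proof (rule trivial_relative_homology_deformation)
  let ?h = "\<lambda>z::real \<times> 'a \<times> real. (fst (snd z), (1 - fst z) * snd (snd z))"
  show "continuous_map (prod_topology (top_of_set {0..1}) (cylinder X)) (cylinder X) ?h"
    using continuous_map_compose [OF homotopy_projections(2) cylinder_projections(1)]
      continuous_map_compose [OF homotopy_projections(2) cylinder_projections(2)]
      homotopy_projections(1)
    by (intro continuous_map_into_cylinder continuous_intros) (auto simp: o_def mult_le_one)
qed (use assms in \<open>auto simp: cylinder_base_def mult_le_one\<close>)

text \<open>In the exact sequence of the triple cylinder, boundary, base, the groups of the cylinder
  modulo its base vanish on both sides of the connecting homomorphism.\<close>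

lemma cylinder_boundary_relboundary_iso:
  assumes B: "B \<subseteq> topspace X"
  shows "hom_relboundary p (cylinder X) (cylinder_boundary X B) (cylinder_base X B)
    \<in> iso (relative_homology_group p (cylinder X) (cylinder_boundary X B))
          (relative_homology_group (p - 1) (subtopology (cylinder X) (cylinder_boundary X B)) (cylinder_base X B))"
    (is "hom_relboundary p ?W ?E ?L \<in> _")
proof -
  have LE: "?L \<subseteq> ?E"
    using B by (auto simp: cylinder_base_def cylinder_boundary_def)
  show ?thesis
  proof (rule very_short_exact_sequence)
    show "exact_seq ([relative_homology_group (p - 1) ?W ?L, relative_homology_group (p - 1) (subtopology ?W ?E) ?L,
        relative_homology_group p ?W ?E, relative_homology_group p ?W ?L],
      [hom_induced (p - 1) (subtopology ?W ?E) ?L ?W ?L id, hom_relboundary p ?W ?E ?L, hom_induced p ?W ?L ?W ?E id])"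
      using homology_exactness_triple_1 [OF LE, of p ?W] homology_exactness_triple_2 [OF LE, of p ?W]
      by (metis exact_seq_cons_iff)
  qed (use B in \<open>auto simp: trivial_relative_homology_cylinder_base\<close>)
qed

text \<open>The lower half of the boundary lies in the base and can be excised; the rest,
  \<open>X\<close> times 1 together with a half-open collar over \<open>B\<close>, deforms onto the
  top copy of \<open>(X, B)\<close>.\<close>

lemma cylinder_top_iso:
  assumes B: "B \<subseteq> topspace X"
  shows "homology_iso p X B (subtopology (cylinder X) (cylinder_boundary X B)) (cylinder_base X B) (\<lambda>x. (x, 1))"
    (is "hom_induced p X B ?E ?L ?i \<in> _")
proof -
  define U where "U = {z \<in> topspace ?E. snd z \<le> 1/2}"
  let ?E' = "subtopology ?E (topspace ?E - U)"
  have tE: "topspace ?E = cylinder_boundary X B"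
    using B by (auto simp: cylinder_boundary_def)
  have tE': "topspace ?E' = topspace X \<times> {1} \<union> B \<times> {1/2<..1}"
    using B by (auto simp: tE U_def cylinder_boundary_def)
  have LU: "?L - U = B \<times> {1/2<..1}"
    using B by (auto simp: tE U_def cylinder_boundary_def cylinder_base_def)
  have LE: "?L \<subseteq> topspace ?E"
    using B by (auto simp: tE cylinder_base_def cylinder_boundary_def)
  have fstE: "continuous_map ?E X fst" and sndE: "continuous_map ?E euclideanreal snd"
    by (auto intro: continuous_map_from_subtopology cylinder_projections)
  have fstE': "continuous_map ?E' X fst" and sndE': "continuous_map ?E' euclideanreal snd"
    by (auto intro: continuous_map_from_subtopology fstE sndE)
  have into: "continuous_map Y ?E' (\<lambda>y. (f y, g y))"
    if "continuous_map Y X f" "continuous_map Y euclideanreal g"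
      "\<And>y. y \<in> topspace Y \<Longrightarrow> (f y, g y) \<in> topspace X \<times> {1} \<union> B \<times> {1/2<..1}"
    for Y :: "'b topology" and f g
  proof -
    have sub: "topspace X \<times> {1} \<union> B \<times> {1/2<..1} \<subseteq> topspace X \<times> {0..1::real}"
      "topspace X \<times> {1} \<union> B \<times> {1/2<..1} \<subseteq> cylinder_boundary X B"
      using B by (auto simp: cylinder_boundary_def)
    have "continuous_map Y (cylinder X) (\<lambda>y. (f y, g y))"
    proof (rule continuous_map_into_cylinder [OF that(1,2)])
      show "g y \<in> {0..1}" if "y \<in> topspace Y" for y
        using \<open>\<And>y. y \<in> topspace Y \<Longrightarrow> (f y, g y) \<in> topspace X \<times> {1} \<union> B \<times> {1/2<..1}\<close> [OF that] by auto
    qed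
    moreover have "(f y, g y) \<in> topspace ?E' \<inter> cylinder_boundary X B" if "y \<in> topspace Y" for y
      unfolding tE' using \<open>\<And>y. y \<in> topspace Y \<Longrightarrow> (f y, g y) \<in> topspace X \<times> {1} \<union> B \<times> {1/2<..1}\<close> [OF that] sub(2)
      by blast
    ultimately show ?thesis
      by (simp add: continuous_map_in_subtopology image_subset_iff Pi_iff)
  qed
  have i: "continuous_map X ?E' ?i"
    by (rule into) auto
  have 1: "homology_iso p X B ?E' (?L - U) ?i"
  proof (rule homotopy_equivalence_relative_homology_group_isomorphism [OF i _ fstE'])
    let ?h = "\<lambda>z::real \<times> 'a \<times> real. (fst (snd z), (1 - fst z) * snd (snd z) + fst z)"
    show "homotopic_with (\<lambda>k. k \<in> (?L - U) \<rightarrow> (?L - U)) ?E' ?E' (?i \<circ> fst) id"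
    proof (rule homotopic_with_symD, rule homotopic_with_pairI [where h = ?h])
      have *: "1/2 < (1 - t) * s + t" "(1 - t) * s + t \<le> 1" if "0 \<le> t" "t \<le> 1" "1/2 < s" "s \<le> 1" for s t :: real
      proof -
        have "0 \<le> t * (1 - s)" "0 \<le> (1 - t) * (1 - s)"
          using that by auto
        then show "1/2 < (1 - t) * s + t" "(1 - t) * s + t \<le> 1"
          using that by (auto simp: algebra_simps)
      qed
      show "continuous_map (prod_topology (top_of_set {0..1::real}) ?E') ?E' ?h"
      proof (rule into)
        show "continuous_map (prod_topology (top_of_set {0..1::real}) ?E') X (\<lambda>z. fst (snd z))"
          using continuous_map_compose [OF homotopy_projections(2) fstE'] by (simp add: o_def)
        show "continuous_map (prod_topology (top_of_set {0..1::real}) ?E') euclideanreal (\<lambda>z. (1 - fst z) * snd (snd z) + fst z)"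
          using continuous_map_compose [OF homotopy_projections(2) sndE']
          by (intro continuous_intros homotopy_projections) (simp add: o_def)
      qed (use * in \<open>auto simp: tE' simp del: topspace_subtopology\<close>)
      show "?L - U \<subseteq> topspace ?E'"
        using LU tE' B by auto
      show "?h (t, x) \<in> ?L - U" if "t \<in> {0..1}" "x \<in> ?L - U" for t x
        using that * by (auto simp: LU)
    qed auto
  qed (auto simp: LU o_def intro!: homotopic_with_equal)
  have 2: "homology_iso p ?E' (?L - U) ?E ?L id"
  proof -
    have "closedin ?E {z \<in> topspace ?E. snd z \<in> {..1/2}}"
      by (rule closedin_continuous_map_preimage [OF sndE]) auto
    then have "?E closure_of U = U"
      by (simp add: U_def closure_of_closedin)
    \<comment> \<open>Below the top level the boundary is contained in the base, which gives an open
      set between \<open>U\<close> and the base.\<close>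
    moreover have "openin ?E {z \<in> topspace ?E. snd z \<in> {..<1}}"
      by (rule openin_continuous_map_preimage [OF sndE]) auto
    then have "U \<subseteq> ?E interior_of ?L"
      unfolding U_def tE
      by (intro subset_trans [OF _ interior_of_maximal]) (auto simp: cylinder_base_def cylinder_boundary_def)
    ultimately show ?thesis
      using homology_excision_axiom [of ?E U ?L "topspace ?E" p, unfolded subtopology_topspace, OF _ LE] by metis
  qed
  have "continuous_map ?E' ?E id" "?i \<in> B \<rightarrow> ?L - U" "id \<in> ?L - U \<rightarrow> ?L"
    using LU by (auto simp: continuous_map_from_subtopology)
  from hom_induced_compose [OF i this(2,1,3)]
  have "hom_induced p X B ?E ?L ?i = hom_induced p ?E' (?L - U) ?E ?L id \<circ> hom_induced p X B ?E' (?L - U) ?i"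
    by (simp only: id_comp)
  then show ?thesis
    using Group.iso_set_trans [OF 1 2] by simp
qed

section \<open>From the cylinder to the product with a circle\<close>

definition circle :: "complex topology" where
  "circle = top_of_set (sphere 0 1)"

definition circle_product_boundary :: "'a topology \<Rightarrow> 'a set \<Rightarrow> ('a \<times> complex) set" where
  "circle_product_boundary X B = topspace X \<times> {1} \<union> B \<times> sphere 0 1"

lemma topspace_circle [simp]: "topspace circle = sphere 0 1"
  by (simp add: circle_def)

lemma Hausdorff_space_circle: "Hausdorff_space circle"
  by (simp add: circle_def Hausdorff_space_subtopology)

lemma compact_space_circle: "compact_space circle"
  by (simp add: circle_def compact_space_subtopology)

lemma continuous_map_into_circle_product:
  assumes f: "continuous_map Y X f" and g: "continuous_map Y euclidean g"
    and "\<And>y. y \<in> topspace Y \<Longrightarrow> norm (g y) = 1"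
  shows "continuous_map Y (prod_topology X circle) (\<lambda>y. (f y, g y))"
  using assms unfolding circle_def
  by (auto simp: continuous_map_paired continuous_map_in_subtopology)

lemma circle_product_projections:
  "continuous_map (prod_topology X circle) X fst" "continuous_map (prod_topology X circle) euclidean snd"
  unfolding circle_def
  by (auto simp: continuous_map_fst intro: continuous_map_into_fulltopology continuous_map_snd)

text \<open>The neighbourhood \<open>S\<close> is written through the circle coordinate so that it
  is the preimage of the neighbourhood used in the circle product.\<close>

lemma cylinder_boundary_collapse_iso:
  assumes B: "B \<subseteq> topspace X"
  defines "S \<equiv> {z \<in> topspace (cylinder X). Re (cis (2 * pi * snd z)) > 0 \<or> fst z \<in> B}"
  shows "homology_iso p (cylinder X) (cylinder_boundary X B) (cylinder X) S id"
proof -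
  \<comment> \<open>The line of slope 2 through (1/2, 1/2), clamped to the unit interval: the
    quarters next to the ends, where the cosine of \<open>2 * pi * t\<close> is positive, collapse
    to 0 and to 1.\<close>
  define g where "g t = max 0 (min 1 (2 * t - 1/2))" for t :: real
  have S: "S = topspace X \<times> ({0..<1/4} \<union> {3/4<..1}) \<union> B \<times> {0..1}"
  proof -
    have "cos (2 * pi * t) > 0 \<longleftrightarrow> t < 1/4 \<or> t > 3/4" if "0 \<le> t" "t \<le> 1" for t :: real
    proof -
      consider "t < 1/4" | "1/4 \<le> t" "t \<le> 3/4" | "3/4 < t" by linarith
      then show ?thesis
      proof cases
        case 1
        then have "2 * pi * t < pi / 2" "0 \<le> 2 * pi * t"
          using that by (auto simp: field_simps)
        then have "cos (2 * pi * t) > 0"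
          using pi_gt_zero by (intro cos_gt_zero_pi) linarith+
        with 1 show ?thesis by simp
      next
        case 2
        then have "0 \<le> cos (2 * pi * t - pi)"
          by (intro cos_ge_zero) (auto simp: field_simps)
        with 2 show ?thesis by simp
      next
        case 3
        then have "- (pi / 2) < 2 * pi * t - 2 * pi" "2 * pi * t - 2 * pi \<le> 0"
          using that by (auto simp: field_simps)
        then have "cos (2 * pi * t - 2 * pi) > 0"
          using pi_gt_zero by (intro cos_gt_zero_pi) linarith+
        with 3 show ?thesis by (simp add: cos_diff)
      qed
    qed
    then show ?thesis
      using B by (auto simp: S_def)
  qed
  let ?h = "\<lambda>z::real \<times> 'a \<times> real. (fst (snd z), (1 - fst z) * snd (snd z) + fst z * g (snd (snd z)))"
  have conv: "(1 - t) * a + t * b \<in> A" if "convex A" "a \<in> A" "b \<in> A" "t \<in> {0..1}" for t a b :: real and A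
    using convexD_alt [OF that(1-3), of t] that(4) by (simp add: algebra_simps)
  have g01: "g t \<in> {0..1}" for t by (auto simp: g_def)
  \<comment> \<open>Each of the listed sets is convex and mapped into itself by \<open>g\<close>,
    hence preserved by the straight-line homotopy.\<close>
  have eval: "(1 - t) * a + t * g a \<in> A"
    if "t \<in> {0..1}" "a \<in> A" "A \<in> {{0}, {1}, {0..<1/4}, {3/4<..1}, {0..1}}" for t a A
    using that by (intro conv) (auto simp: g_def)
  show ?thesis
  proof (rule deformation_relative_homology_iso)
    show "continuous_map (prod_topology (top_of_set {0..1::real}) (cylinder X)) (cylinder X) ?h"
    proof (rule continuous_map_into_cylinder)
      have sn: "continuous_map (prod_topology (top_of_set {0..1::real}) (cylinder X)) euclideanreal (\<lambda>z. snd (snd z))"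
        using continuous_map_compose [OF homotopy_projections(2) cylinder_projections(2)] by (simp add: o_def)
      then show "continuous_map (prod_topology (top_of_set {0..1::real}) (cylinder X)) euclideanreal
          (\<lambda>z. (1 - fst z) * snd (snd z) + fst z * g (snd (snd z)))"
        unfolding g_def by (intro continuous_intros continuous_map_real_max continuous_map_real_min homotopy_projections) auto
      show "continuous_map (prod_topology (top_of_set {0..1::real}) (cylinder X)) X (\<lambda>z. fst (snd z))"
        using continuous_map_compose [OF homotopy_projections(2) cylinder_projections(1)] by (simp add: o_def)
      show "(1 - fst z) * snd (snd z) + fst z * g (snd (snd z)) \<in> {0..1}"
        if "z \<in> topspace (prod_topology (top_of_set {0..1::real}) (cylinder X))" for z
        using that by (intro eval) auto
    qed
    show "?h (t, x) \<in> cylinder_boundary X B" if "t \<in> {0..1}" "x \<in> cylinder_boundary X B" for t x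
      using that eval [of t "snd x" "{0}"] eval [of t "snd x" "{1}"] eval [of t "snd x" "{0..1}"]
      by (auto simp: cylinder_boundary_def simp del: atLeastAtMost_iff singleton_iff)
    show "?h (t, x) \<in> S" if "t \<in> {0..1}" "x \<in> S" for t x
    proof -
      consider "snd x \<in> {0..<1/4}" "fst x \<in> topspace X" | "snd x \<in> {3/4<..1}" "fst x \<in> topspace X"
        | "snd x \<in> {0..1}" "fst x \<in> B"
        using \<open>x \<in> S\<close> unfolding S by auto
      then show ?thesis
      proof cases
        case 1
        with eval [OF \<open>t \<in> {0..1}\<close> 1(1)] show ?thesis unfolding S by simp
      next
        case 2
        with eval [OF \<open>t \<in> {0..1}\<close> 2(1)] show ?thesis unfolding S by simp
      next
        case 3
        with eval [OF \<open>t \<in> {0..1}\<close> 3(1)] show ?thesis unfolding S by simp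
      qed
    qed
    show "?h (1, x) \<in> cylinder_boundary X B" if "x \<in> S" for x
      using that unfolding S cylinder_boundary_def by (auto simp: g_def)
  qed (use B in \<open>auto simp: S cylinder_boundary_def\<close>)
qed

lemma circle_product_boundary_collapse_iso:
  assumes B: "B \<subseteq> topspace X"
  defines "S \<equiv> {z \<in> topspace (prod_topology X circle). Re (snd z) > 0 \<or> fst z \<in> B}"
  shows "homology_iso p (prod_topology X circle) (circle_product_boundary X B) (prod_topology X circle) S id"
proof -
  \<comment> \<open>On the left half of the circle the angle measured from -1 is doubled. At the two
    points with real part 0 the value of \<open>- z\<^sup>2\<close> is 1, so the branches fit
    together.\<close>
  define g where "g z = (if Re z \<ge> 0 then 1 else - z\<^sup>2)" for z :: complex
  define f where "f t z = (1 - of_real t) * z + of_real t * g z" for t :: real and z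
  have norm_g: "norm (g z) = 1" if "norm z = 1" for z
    using that by (simp add: g_def norm_power)
  have g_cont: "continuous_on (sphere 0 1) g"
  proof -
    have "continuous_on ({z. Re z \<ge> 0} \<inter> sphere 0 1 \<union> {z. Re z \<le> 0} \<inter> sphere 0 1) (\<lambda>z. if Re z \<ge> 0 then 1 else - z\<^sup>2)"
    proof (rule continuous_on_If)
      show "1 = - z\<^sup>2" if "z \<in> {z. Re z \<le> 0} \<inter> sphere 0 1" "Re z \<ge> 0" for z
      proof -
        have "Re z = 0" "(Re z)\<^sup>2 + (Im z)\<^sup>2 = 1"
          using that by (auto simp: cmod_def)
        then show ?thesis
          by (auto simp: complex_eq_iff power2_eq_square)
      qed
    qed (auto intro!: continuous_intros closed_Collect_le closed_Int)
    moreover have "{z. Re z \<ge> 0} \<inter> sphere 0 1 \<union> {z. Re z \<le> 0} \<inter> sphere 0 1 = (sphere 0 1 :: complex set)"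
      by auto
    ultimately show ?thesis
      by (simp add: g_def [abs_def])
  qed
  \<comment> \<open>A vanishing convex combination of two unit vectors forces \<open>t = 1/2\<close>
    and \<open>g z = - z\<close>. The two branches of \<open>g\<close> then yield -1 and 1 for
    \<open>z\<close>, each lying in the domain of the other branch; so the straight line can be
    normalized.\<close>
  have f0: "f t z \<noteq> 0" if z: "norm z = 1" and t: "t \<in> {0..1}" for t z
  proof
    assume "f t z = 0"
    then have eq: "of_real t * g z = - ((1 - of_real t) * z)"
      unfolding f_def by (metis add.commute add_eq_0_iff)
    have "norm (of_real t * g z) = t"
      using t norm_g [OF z] by (simp add: norm_mult)
    moreover have "norm (- ((1 - of_real t) * z)) = \<bar>1 - t\<bar>"
      by (metis norm_minus_cancel norm_mult norm_of_real of_real_1 of_real_diff z mult_1_right)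
    ultimately have "t = 1 - t"
      using t eq by auto
    then have "t = 1/2" by simp
    with eq have gz: "g z = - z"
      by simp
    show False
    proof (cases "Re z \<ge> 0")
      case True
      with gz have "z = -1" by (simp add: g_def) (metis minus_equation_iff)
      with True show False by simp
    next
      case False
      with gz z have "z = 1" by (auto simp: g_def power2_eq_square)
      with False show False by simp
    qed
  qed
  let ?W = "prod_topology X circle"
  let ?h = "\<lambda>z. (fst (snd z), sgn (f (fst z) (snd (snd z))))"
  have re: "Re (f t z) > 0" if "Re z > 0" "t \<in> {0..1}" for t z
  proof -
    have "Re (f t z) = (1 - t) * Re z + t"
      using that by (simp add: f_def g_def)
    also have "\<dots> > 0"
      using that by (cases "t = 1") (auto intro!: add_pos_nonneg)
    finally show ?thesis .
  qed
  have f1: "f t 1 = 1" for t by (simp add: f_def g_def)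
  show ?thesis
  proof (rule deformation_relative_homology_iso)
    show "continuous_map (prod_topology (top_of_set {0..1::real}) ?W) ?W ?h"
    proof (rule continuous_map_into_circle_product)
      let ?P = "prod_topology (top_of_set {0..1::real}) ?W"
      show "continuous_map ?P X (\<lambda>z. fst (snd z))"
        using continuous_map_compose [OF homotopy_projections(2) circle_product_projections(1)] by (simp add: o_def)
      have "continuous_map ?P circle (\<lambda>z. snd (snd z))"
        using continuous_map_compose [OF homotopy_projections(2) continuous_map_snd] by (simp add: o_def)
      then have 1: "continuous_map ?P (top_of_set ({0..1} \<times> sphere 0 1)) (\<lambda>z. (fst z, snd (snd z)))"
        by (simp add: continuous_map_pairedI continuous_map_fst circle_def flip: prod_topology_subtopology_eu)
      have "continuous_on ({0..1} \<times> sphere 0 1) (\<lambda>z. sgn (f (fst z) (snd z)))"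
        unfolding f_def
        by (intro continuous_intros continuous_on_compose2 [OF g_cont] continuous_on_sgn)
           (use f0 in \<open>auto simp: f_def\<close>)
      then have "continuous_map (top_of_set ({0..1} \<times> sphere 0 1)) euclidean (\<lambda>z. sgn (f (fst z) (snd z)))"
        by simp
      from continuous_map_compose [OF 1 this]
      show "continuous_map ?P euclidean (\<lambda>z. sgn (f (fst z) (snd (snd z))))"
        by (simp add: o_def)
      show "norm (sgn (f (fst z) (snd (snd z)))) = 1" if "z \<in> topspace ?P" for z
        using that f0 by (auto simp: norm_sgn)
    qed
    show "?h (0, x) = x" if "x \<in> topspace ?W" for x
      using that by (cases x) (auto simp: f_def sgn_div_norm)
    show "?h (t, x) \<in> circle_product_boundary X B" if "t \<in> {0..1}" "x \<in> circle_product_boundary X B" for t x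
      using that f0 by (auto simp: circle_product_boundary_def f1 norm_sgn)
    show "?h (t, x) \<in> S" if "t \<in> {0..1}" "x \<in> S" for t x
      using that f0 re by (auto simp: S_def norm_sgn sgn_div_norm intro!: mult_pos_pos)
    show "?h (1, x) \<in> circle_product_boundary X B" if "x \<in> S" for x
      using that norm_g by (auto simp: S_def circle_product_boundary_def f_def g_def norm_sgn)
  qed (use B in \<open>auto simp: S_def circle_product_boundary_def\<close>)
qed

lemma continuous_map_cylinder_to_circle:
  "continuous_map (cylinder X) (prod_topology X circle) (\<lambda>z. (fst z, cis (2 * pi * snd z)))"
proof (rule continuous_map_into_circle_product [OF cylinder_projections(1)])
  have "continuous_map euclideanreal euclidean (\<lambda>t. cis (2 * pi * t))"
    by (auto intro!: continuous_intros)
  from continuous_map_compose [OF cylinder_projections(2) this]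
  show "continuous_map (cylinder X) euclidean (\<lambda>y. cis (2 * pi * snd y))"
    by (simp add: o_def)
qed auto

text \<open>Only the seam \<open>X\<close> times 1 is excised: it is closed and interior to the
  neighbourhood for every \<open>B\<close>, whereas \<open>B\<close> times the circle may be
  neither. Away from the seam the exponential map is injective, also over \<open>B\<close>.\<close>

lemma cylinder_circle_iso:
  assumes X: "compact_space X" "Hausdorff_space X" and B: "B \<subseteq> topspace X"
  shows "homology_iso p (cylinder X) (cylinder_boundary X B) (prod_topology X circle) (circle_product_boundary X B) (\<lambda>z. (fst z, cis (2 * pi * snd z)))"
proof -
  let ?W = "prod_topology X circle"
  let ?S = "{z \<in> topspace ?W. Re (snd z) > 0 \<or> fst z \<in> B}"
  let ?e = "\<lambda>z. (fst z, cis (2 * pi * snd z))"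
  have sndW: "continuous_map ?W euclidean snd" by (rule circle_product_projections)
  have a1: "compact_space (cylinder X)"
    using X by (simp add: cylinder_def compact_space_prod_topology compact_space_subtopology)
  have a2: "Hausdorff_space ?W"
    using X by (simp add: Hausdorff_space_prod_topology Hausdorff_space_circle)
  have a3: "continuous_map (cylinder X) ?W ?e"
    by (rule continuous_map_cylinder_to_circle)
  have "closedin ?W {z \<in> topspace ?W. snd z \<in> {1}}"
    by (rule closedin_continuous_map_preimage [OF sndW]) auto
  moreover have "{z \<in> topspace ?W. snd z \<in> {1}} = topspace X \<times> {1}" by auto
  ultimately have a4: "closedin ?W (topspace X \<times> {1})" by simp
  have "openin ?W {z \<in> topspace ?W. snd z \<in> {z. Re z > 0}}"
    by (rule openin_continuous_map_preimage [OF sndW]) (auto simp: open_halfspace_Re_gt)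
  then have a5: "topspace X \<times> {1} \<subseteq> ?W interior_of ?S"
    by (intro subset_trans [OF _ interior_of_maximal]) auto
  have a6: "inj_on ?e {q \<in> topspace (cylinder X). ?e q \<notin> topspace X \<times> {1}}"
  proof -
    have "s = t" if "s \<in> {0..1}" "t \<in> {0..1}" "cis (2 * pi * s) = cis (2 * pi * t)" "cis (2 * pi * s) \<noteq> 1" for s t
    proof -
      have "s \<noteq> 1" "t \<noteq> 1" using that by auto
      then have "Arg2pi (cis (2 * pi * s)) = 2 * pi * s" "Arg2pi (cis (2 * pi * t)) = 2 * pi * t"
        using that by (auto intro!: Arg2pi_unique [of 1] simp: cis_conv_exp)
      then have "2 * pi * s = 2 * pi * t"
        using that(3) by metis
      then show ?thesis by simp
    qed
    then show ?thesis
      by (auto simp: inj_on_def)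
  qed
  have a7: "topspace ?W - topspace X \<times> {1} \<subseteq> ?e ` topspace (cylinder X)"
  proof
    fix w assume "w \<in> topspace ?W - topspace X \<times> {1}"
    then have xz: "fst w \<in> topspace X" "norm (snd w) = 1"
      by auto
    define z where "z = snd w"
    have "z = cis (2 * pi * (Arg2pi z / (2 * pi)))"
      using Arg2pi_eq [of z] xz by (simp add: cis_conv_exp mult.commute z_def)
    moreover have "Arg2pi z / (2 * pi) \<in> {0..1}"
      using Arg2pi [of z] by (auto simp: field_simps)
    ultimately show "w \<in> ?e ` topspace (cylinder X)"
      using xz by (intro image_eqI [of _ _ "(fst w, Arg2pi z / (2 * pi))"]) (auto simp: z_def prod_eq_iff)
  qed
  have eS: "{q \<in> topspace (cylinder X). ?e q \<in> ?S} = {z \<in> topspace (cylinder X). Re (cis (2 * pi * snd z)) > 0 \<or> fst z \<in> B}"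
    by auto
  have a8: "?e \<in> cylinder_boundary X B \<rightarrow> circle_product_boundary X B"
    using B by (auto simp: cylinder_boundary_def circle_product_boundary_def)
  have a9: "homology_iso p (cylinder X) (cylinder_boundary X B) (cylinder X) {q \<in> topspace (cylinder X). ?e q \<in> ?S} id"
    unfolding eS by (rule cylinder_boundary_collapse_iso [OF B])
  have a10: "homology_iso p ?W (circle_product_boundary X B) ?W ?S id"
    by (rule circle_product_boundary_collapse_iso [OF B])
  have a12: "?S \<subseteq> topspace ?W" "cylinder_boundary X B \<subseteq> {q \<in> topspace (cylinder X). ?e q \<in> ?S}"
    "circle_product_boundary X B \<subseteq> ?S"
    using B by (auto simp: cylinder_boundary_def circle_product_boundary_def)
  show ?thesis
    by (rule relative_homology_iso_compact [OF a1 a2 a3 a4 a5 a12(1) a6 a7 refl a8 a12(2,3) a9 a10])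
qed

section \<open>Attaching a torus along its fat wedge\<close>

definition int_functions :: "'i set \<Rightarrow> ('i \<Rightarrow> int) monoid" where
  "int_functions I = \<lparr>carrier = {v. \<forall>i. i \<notin> I \<longrightarrow> v i = 0}, monoid.mult = (\<lambda>u v i. u i + v i), one = (\<lambda>_. 0)\<rparr>"

lemma carrier_int_functions [simp]: "v \<in> carrier (int_functions I) \<longleftrightarrow> (\<forall>i. i \<notin> I \<longrightarrow> v i = 0)"
  and mult_int_functions [simp]: "u \<otimes>\<^bsub>int_functions I\<^esub> v = (\<lambda>i. u i + v i)"
  and one_int_functions [simp]: "\<one>\<^bsub>int_functions I\<^esub> = (\<lambda>_. 0)"
  by (auto simp: int_functions_def)

lemma comm_group_int_functions: "comm_group (int_functions I)"
proof (rule comm_groupI)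
  fix u assume "u \<in> carrier (int_functions I)"
  then show "\<exists>v\<in>carrier (int_functions I). v \<otimes>\<^bsub>int_functions I\<^esub> u = \<one>\<^bsub>int_functions I\<^esub>"
    by (intro bexI [of _ "\<lambda>i. - u i"]) auto
qed (auto simp: algebra_simps)

lemma group_int_functions [simp]: "group (int_functions I)"
  by (rule comm_group.axioms(2) [OF comm_group_int_functions])

definition free_of_rank :: "('a, 'b) monoid_scheme \<Rightarrow> nat \<Rightarrow> bool" where
  "free_of_rank G r \<longleftrightarrow> (\<exists>\<kappa>. \<kappa> \<in> iso G (int_functions {..<r}))"

lemma free_of_rank_iso: "\<lbrakk>h \<in> iso G H; free_of_rank H r\<rbrakk> \<Longrightarrow> free_of_rank G r"
  unfolding free_of_rank_def by (meson Group.iso_set_trans)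

lemma free_of_rank_iso': "\<lbrakk>h \<in> iso G H; group G; free_of_rank G r\<rbrakk> \<Longrightarrow> free_of_rank H r"
  by (meson free_of_rank_iso group.iso_set_sym)

lemma free_of_rank_trivial:
  assumes "trivial_group G"
  shows "free_of_rank G 0"
  unfolding free_of_rank_def
proof
  have G: "group G" and car: "carrier G = {\<one>\<^bsub>G\<^esub>}"
    using assms by (auto simp: trivial_group_def)
  show "(\<lambda>_ _. 0) \<in> iso G (int_functions {..<0::nat})"
    using car by (auto simp: iso_def hom_def bij_betw_def)
qed

lemma free_of_rank_integer_group: "free_of_rank integer_group 1"
  unfolding free_of_rank_def
proof
  show "(\<lambda>k i. if i = 0 then k else 0) \<in> iso integer_group (int_functions {..<1::nat})"
  proof (rule isoI)
    show "bij_betw (\<lambda>k i. if i = 0 then k else 0) (carrier integer_group) (carrier (int_functions {..<1::nat}))"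
      by (rule bij_betwI [where g = "\<lambda>v. v 0"]) (auto simp: fun_eq_iff)
  qed (auto simp: hom_def)
qed

text \<open>As \<open>\<mu>\<close> takes the value 1 at \<open>c\<close>, the group
  \<open>B\<close> is the direct sum of the kernel of \<open>\<mu>\<close>, a copy of
  \<open>A\<close>, and the infinite cyclic group generated by \<open>c\<close>. The new coordinate
  gets the index \<open>r\<close>.\<close>

lemma free_of_rank_Suc:
  assumes A: "group A" and B: "comm_group B"
    and f: "f \<in> hom A B" "inj_on f (carrier A)"
    and \<mu>: "\<mu> \<in> hom B integer_group" and c: "c \<in> carrier B" "\<mu> c = 1"
    and ker: "kernel B integer_group \<mu> = f ` carrier A"
    and r: "free_of_rank A r"
  shows "free_of_rank B (Suc r)"
proof -
  interpret B: comm_group B by (rule B)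
  interpret \<mu>: group_hom B integer_group \<mu>
    using \<mu> by (simp add: group_hom_def group_hom_axioms_def)
  interpret f: group_hom A B f
    using A f by (simp add: group_hom_def group_hom_axioms_def)
  obtain \<alpha> where \<alpha>: "\<alpha> \<in> iso (int_functions {..<r}) A"
    using r A group.iso_set_sym unfolding free_of_rank_def by metis
  interpret \<alpha>: group_hom "int_functions {..<r}" A \<alpha>
    using A \<alpha> by (simp add: group_hom_def group_hom_axioms_def iso_def)
  have \<alpha>_im: "\<alpha> ` carrier (int_functions {..<r}) = carrier A"
    using \<alpha> by (simp add: iso_def bij_betw_def)
  define low where "low v = v(r := 0)" for v :: "nat \<Rightarrow> int"
  have low: "low v \<in> carrier (int_functions {..<r})" if "v \<in> carrier (int_functions {..<Suc r})" for v
    using that by (auto simp: low_def)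
  define h where "h v = f (\<alpha> (low v)) \<otimes>\<^bsub>B\<^esub> c [^]\<^bsub>B\<^esub> v r" for v :: "nat \<Rightarrow> int"
  have \<mu>f: "\<mu> (f a) = 0" if "a \<in> carrier A" for a
    using that ker by (auto simp: kernel_def)
  have \<mu>h: "\<mu> (h v) = v r" if "v \<in> carrier (int_functions {..<Suc r})" for v
    using c \<mu>f low [OF that] by (simp add: h_def \<mu>.hom_int_pow del: carrier_int_functions)
  have hom: "h \<in> hom (int_functions {..<Suc r}) B"
  proof (rule homI)
    fix u v assume uv: "u \<in> carrier (int_functions {..<Suc r})" "v \<in> carrier (int_functions {..<Suc r})"
    show "h u \<in> carrier B"
      using low [OF uv(1)] c by (simp add: h_def del: carrier_int_functions)
    have "low (u \<otimes>\<^bsub>int_functions {..<Suc r}\<^esub> v) = low u \<otimes>\<^bsub>int_functions {..<r}\<^esub> low v"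
      by (auto simp: low_def)
    then show "h (u \<otimes>\<^bsub>int_functions {..<Suc r}\<^esub> v) = h u \<otimes>\<^bsub>B\<^esub> h v"
      using low [OF uv(1)] low [OF uv(2)] c
      by (simp add: h_def B.int_pow_mult B.m_ac del: carrier_int_functions mult_int_functions)
         (simp add: B.int_pow_mult B.m_ac)
  qed
  have "h \<in> iso (int_functions {..<Suc r}) B"
  proof (rule isoI [OF hom], rule bij_betw_imageI)
    show "inj_on h (carrier (int_functions {..<Suc r}))"
    proof (rule inj_onI)
      fix u v assume uv: "u \<in> carrier (int_functions {..<Suc r})" "v \<in> carrier (int_functions {..<Suc r})" "h u = h v"
      then have eq: "u r = v r"
        using \<mu>h by metis
      then have "f (\<alpha> (low u)) = f (\<alpha> (low v))"
        using uv(3) low [OF uv(1)] low [OF uv(2)] c by (simp add: h_def del: carrier_int_functions)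
      then have "low u = low v"
        using f(2) \<alpha> low [OF uv(1)] low [OF uv(2)] by (auto simp: inj_on_def iso_def bij_betw_def simp del: carrier_int_functions)
      with eq show "u = v"
        by (metis fun_upd_triv fun_upd_upd low_def)
    qed
    show "h ` carrier (int_functions {..<Suc r}) = carrier B"
    proof
      show "h ` carrier (int_functions {..<Suc r}) \<subseteq> carrier B"
        using hom by (auto simp: hom_def)
      show "carrier B \<subseteq> h ` carrier (int_functions {..<Suc r})"
      proof
        fix b assume b: "b \<in> carrier B"
        \<comment> \<open>Removing \<open>\<mu> b\<close> copies of \<open>c\<close> projects
          \<open>b\<close> into the kernel.\<close>
        let ?b = "b \<otimes>\<^bsub>B\<^esub> c [^]\<^bsub>B\<^esub> (- \<mu> b)"
        have "?b \<in> kernel B integer_group \<mu>"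
          using b c by (simp add: kernel_def \<mu>.hom_int_pow)
        then obtain a where a: "a \<in> carrier A" "?b = f a"
          unfolding ker by auto
        then obtain v where v: "v \<in> carrier (int_functions {..<r})" "\<alpha> v = a"
          unfolding \<alpha>_im [symmetric] by blast
        have "low (v(r := \<mu> b)) = v"
          using v by (auto simp: low_def fun_eq_iff)
        then have "h (v(r := \<mu> b)) = ?b \<otimes>\<^bsub>B\<^esub> c [^]\<^bsub>B\<^esub> \<mu> b"
          using a v by (simp add: h_def)
        also have "\<dots> = b"
          using b c by (simp add: B.m_assoc B.int_pow_neg)
        finally have "b = h (v(r := \<mu> b))" ..
        moreover have "v(r := \<mu> b) \<in> carrier (int_functions {..<Suc r})"
          using v by auto
        ultimately show "b \<in> h ` carrier (int_functions {..<Suc r})"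
          by blast
      qed
    qed
  qed
  then show ?thesis
    unfolding free_of_rank_def
    using group.iso_set_sym [OF group_int_functions] by blast
qed

text \<open>A quotient of rank 0 or 1 is what a relative group concentrated in one degree provides.
  In the first case \<open>f\<close> is an isomorphism; in the second a preimage of a generator
  splits the sequence.\<close>

lemma free_of_rank_extension:
  assumes A: "group A" and B: "comm_group B" and C: "group C"
    and f: "f \<in> hom A B" "inj_on f (carrier A)"
    and g: "g \<in> hom B C" "g ` carrier B = carrier C"
    and ker: "kernel B C g = f ` carrier A"
    and r: "free_of_rank A r" and s: "free_of_rank C (if P then 1 else 0)"
  shows "free_of_rank B (if P then Suc r else r)"
proof (cases P)
  case False
  obtain \<gamma> where \<gamma>: "\<gamma> \<in> iso C (int_functions {..<0::nat})"
    using s False by (auto simp: free_of_rank_def)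
  have "\<gamma> x = (\<lambda>_. 0)" if "x \<in> carrier C" for x
    using \<gamma> that by (auto simp: iso_def hom_def Pi_iff fun_eq_iff)
  then have C1: "x = \<one>\<^bsub>C\<^esub>" if "x \<in> carrier C" for x
    using \<gamma> that group.is_monoid [OF C] by (simp add: iso_def bij_betw_def inj_on_def monoid.one_closed)
  then have "kernel B C g = carrier B"
    using g(1) by (auto simp: kernel_def hom_def)
  then have "f \<in> iso A B"
    using f ker by (auto simp: iso_def bij_betw_def)
  then show ?thesis
    using free_of_rank_iso' A r False by auto
next
  case True
  obtain \<gamma> where \<gamma>: "\<gamma> \<in> iso C (int_functions {..<1::nat})"
    using s True by (auto simp: free_of_rank_def)
  interpret \<gamma>: group_hom C "int_functions {..<1::nat}" \<gamma>
    using C \<gamma> by (simp add: group_hom_def group_hom_axioms_def iso_def)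
  have g': "g b \<in> carrier C" if "b \<in> carrier B" for b
    using g that by (auto simp: hom_def)
  have out: "\<gamma> x i = 0" if "x \<in> carrier C" "i \<noteq> 0" for x i
    using \<gamma>.hom_closed [OF that(1)] that(2) by auto
  have "\<gamma> ` carrier C = carrier (int_functions {..<1::nat})"
    using \<gamma> by (simp add: iso_def bij_betw_def)
  moreover have "(\<lambda>i. if i = 0 then 1 else 0) \<in> carrier (int_functions {..<1::nat})"
    by auto
  ultimately have "(\<lambda>i. if i = 0 then 1 else 0) \<in> \<gamma> ` carrier C"
    by simp
  then obtain x where x: "x \<in> carrier C" "\<gamma> x = (\<lambda>i. if i = 0 then 1 else 0)"
    by auto
  from x(1) obtain c where c: "c \<in> carrier B" "g c = x"
    unfolding g(2) [symmetric] by blast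
  have "free_of_rank B (Suc r)"
  proof (rule free_of_rank_Suc [OF A B f _ c(1) _ _ r])
    show "(\<lambda>b. \<gamma> (g b) 0) \<in> hom B integer_group"
      using g' hom_mult [OF g(1)] by (auto simp: hom_def \<gamma>.hom_mult)
    show "\<gamma> (g c) 0 = 1"
      using c x by simp
    have "\<gamma> y 0 = 0 \<longleftrightarrow> y = \<one>\<^bsub>C\<^esub>" if "y \<in> carrier C" for y
    proof
      assume "\<gamma> y 0 = 0"
      then have "\<gamma> y = \<gamma> \<one>\<^bsub>C\<^esub>"
        using out [OF that] by (metis \<gamma>.hom_one ext one_int_functions)
      then show "y = \<one>\<^bsub>C\<^esub>"
        using \<gamma> that by (simp add: iso_def bij_betw_def inj_on_def)
    qed simp
    then show "kernel B integer_group (\<lambda>b. \<gamma> (g b) 0) = f ` carrier A"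
      unfolding ker [symmetric] using g' by (auto simp: kernel_def)
  qed
  then show ?thesis
    using True by simp
qed

section \<open>Pairs with the relative homology of a cell\<close>

definition cell_like :: "'a topology \<Rightarrow> 'a set \<Rightarrow> nat \<Rightarrow> bool" where
  "cell_like X B k \<longleftrightarrow>
    (\<forall>p. hom_induced p X {} X B id ` carrier (homology_group p X) = carrier (relative_homology_group p X B) \<and>
         free_of_rank (relative_homology_group p X B) (if p = int k then 1 else 0))"

lemma cell_like_homeomorphic_map:
  assumes f: "homeomorphic_map X Y f" and B: "B \<subseteq> topspace X" and cell: "cell_like X B k"
  shows "cell_like Y (f ` B) k"
  unfolding cell_like_def
proof (intro allI conjI)
  fix p
  have cont: "continuous_map X Y f" by (rule homeomorphic_imp_continuous_map [OF f])
  have 1: "homology_iso p X {} Y {} f"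
    by (rule homeomorphic_map_homology_iso [OF f])
  have 2: "homology_iso p X B Y (f ` B) f"
    by (rule homeomorphic_map_relative_homology_iso [OF f B refl])
  show "free_of_rank (relative_homology_group p Y (f ` B)) (if p = int k then 1 else 0)"
    using free_of_rank_iso' [OF 2] cell by (auto simp: cell_like_def)
  have "hom_induced p Y {} Y (f ` B) id (hom_induced p X {} Y {} f x) =
        hom_induced p X B Y (f ` B) f (hom_induced p X {} X B id x)" for x
    using cont by (subst (1 2) hom_induced_compose') auto
  then show "hom_induced p Y {} Y (f ` B) id ` carrier (homology_group p Y) = carrier (relative_homology_group p Y (f ` B))"
    using surj_square [OF 1 2 hom_induced_hom hom_induced_hom, of id id] cell by (simp add: cell_like_def)
qed

text \<open>For surjectivity, the map into the homology relative to the boundary factors through the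
  homology relative to \<open>X\<close> times 1, the boundary for empty \<open>B\<close>. The first
  factor is onto because \<open>X\<close> times 1 is a retract. The second corresponds, under
  suspension isomorphisms natural in \<open>B\<close>, to the map from the homology of
  \<open>X\<close> to that of \<open>(X, B)\<close> one degree lower.\<close>

lemma cell_like_circle_product:
  assumes X: "compact_space X" "Hausdorff_space X" and B: "B \<subseteq> topspace X" and cell: "cell_like X B k"
  shows "cell_like (prod_topology X circle) (circle_product_boundary X B) (Suc k)"
  unfolding cell_like_def
proof (intro allI conjI)
  fix p
  let ?W = "prod_topology X circle" and ?e = "\<lambda>z. (fst z, cis (2 * pi * snd z))" and ?i = "\<lambda>x. (x, 1::real)"
  let ?F = "circle_product_boundary X" and ?D = "cylinder_boundary X" and ?L = "cylinder_base X"
  let ?E = "\<lambda>B. subtopology (cylinder X) (?D B)"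
  have sub: "?F {} \<subseteq> ?F B" "?D {} \<subseteq> ?D B" "?L {} \<subseteq> ?L B"
    "\<And>B. ?i \<in> B \<rightarrow> ?L B" "?i \<in> topspace X \<rightarrow> ?D B"
    by (auto simp: circle_product_boundary_def cylinder_boundary_def cylinder_base_def)
  have LD: "?L B' \<subseteq> ?D B'" if "B' \<subseteq> topspace X" for B'
    using that by (auto simp: cylinder_boundary_def cylinder_base_def)
  have e_cont: "continuous_map (cylinder X) ?W ?e"
    by (rule continuous_map_cylinder_to_circle)
  have eF: "?e \<in> ?D B' \<rightarrow> ?F B'" if "B' \<subseteq> topspace X" for B'
    using that by (auto simp: cylinder_boundary_def circle_product_boundary_def)
  have i_cont: "continuous_map X (?E B') ?i" if "B' \<subseteq> topspace X" for B'
    by (auto simp: continuous_map_in_subtopology cylinder_boundary_def intro!: continuous_map_into_cylinder)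
  have E_cont: "continuous_map (?E {}) (?E B) id"
    using sub(2) by (auto simp: continuous_map_in_subtopology continuous_map_from_subtopology)
  note e_iso = cylinder_circle_iso [OF X, of _ p]
    and d_iso = cylinder_boundary_relboundary_iso [of _ X p]
    and i_iso = cylinder_top_iso [of _ X "p - 1"]
  \<comment> \<open>Surjectivity in degree \<open>p - 1\<close> is now transported through the
    inclusion of the top, the connecting homomorphism and the exponential map, each time by a square
    comparing the empty set with \<open>B\<close>.\<close>
  have "hom_induced (p - 1) (?E {}) (?L {}) (?E B) (?L B) id (hom_induced (p - 1) X {} (?E {}) (?L {}) ?i x)
        = hom_induced (p - 1) X B (?E B) (?L B) ?i (hom_induced (p - 1) X {} X B id x)" for x
    using E_cont i_cont [of "{}"] i_cont [OF B] sub by (subst (1 2) hom_induced_compose') (auto simp: o_def)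
  from surj_square [where f = "hom_induced (p - 1) X {} X B id" and g = "hom_induced (p - 1) (?E {}) (?L {}) (?E B) (?L B) id", OF i_iso [OF empty_subsetI] i_iso [OF B] hom_induced_hom hom_induced_hom this]
  have onto3: "hom_induced (p - 1) (?E {}) (?L {}) (?E B) (?L B) id ` carrier (relative_homology_group (p - 1) (?E {}) (?L {}))
      = carrier (relative_homology_group (p - 1) (?E B) (?L B))"
    using cell by (simp add: cell_like_def)
  have "id \<in> ?D {} \<rightarrow> ?D B" "id \<in> ?L {} \<rightarrow> ?L B"
    using sub by auto
  from naturality_hom_induced_relboundary [OF continuous_map_id this]
  have "hom_induced (p - 1) (?E {}) (?L {}) (?E B) (?L B) id (hom_relboundary p (cylinder X) (?D {}) (?L {}) x)
       = hom_relboundary p (cylinder X) (?D B) (?L B) (hom_induced p (cylinder X) (?D {}) (cylinder X) (?D B) id x)" for x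
    by (metis comp_apply)
  from surj_square [where f = "hom_induced p (cylinder X) (?D {}) (cylinder X) (?D B) id"
      and g = "hom_induced (p - 1) (?E {}) (?L {}) (?E B) (?L B) id", OF d_iso [OF empty_subsetI] d_iso [OF B] hom_induced_hom hom_induced_hom this]
  have onto2: "hom_induced p (cylinder X) (?D {}) (cylinder X) (?D B) id ` carrier (relative_homology_group p (cylinder X) (?D {}))
      = carrier (relative_homology_group p (cylinder X) (?D B))"
    using onto3 by blast
  have "hom_induced p ?W (?F {}) ?W (?F B) id (hom_induced p (cylinder X) (?D {}) ?W (?F {}) ?e x)
       = hom_induced p (cylinder X) (?D B) ?W (?F B) ?e (hom_induced p (cylinder X) (?D {}) (cylinder X) (?D B) id x)" for x
    using e_cont eF [OF B] eF [of "{}"] sub by (subst (1 2) hom_induced_compose') (auto simp: o_def)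
  from surj_square [where f = "hom_induced p (cylinder X) (?D {}) (cylinder X) (?D B) id"
      and g = "hom_induced p ?W (?F {}) ?W (?F B) id", OF e_iso [OF empty_subsetI] e_iso [OF B] hom_induced_hom hom_induced_hom this]
  have onto1: "hom_induced p ?W (?F {}) ?W (?F B) id ` carrier (relative_homology_group p ?W (?F {}))
      = carrier (relative_homology_group p ?W (?F B))"
    using onto2 by blast
  have "?F {} retract_of_space ?W"
    unfolding retract_of_space_def
  proof (intro conjI exI [of _ "\<lambda>z. (fst z, 1)"])
    show "continuous_map ?W (subtopology ?W (?F {})) (\<lambda>z. (fst z, 1))"
      by (auto simp: continuous_map_in_subtopology circle_product_boundary_def circle_product_projections
          intro!: continuous_map_into_circle_product)
  qed (auto simp: circle_product_boundary_def)
  then have "hom_induced p ?W {} ?W (?F {}) id ` carrier (homology_group p ?W) = carrier (relative_homology_group p ?W (?F {}))"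
    by (intro epi_hom_induced_relativization) simp
  moreover have "hom_induced p ?W {} ?W (?F B) id = hom_induced p ?W (?F {}) ?W (?F B) id \<circ> hom_induced p ?W {} ?W (?F {}) id"
    using sub(1) by (subst hom_induced_compose [symmetric]) auto
  ultimately show "hom_induced p ?W {} ?W (?F B) id ` carrier (homology_group p ?W) = carrier (relative_homology_group p ?W (?F B))"
    by (simp only: onto1 flip: image_comp)
  have "free_of_rank (relative_homology_group (p - 1) X B) (if p = int (Suc k) then 1 else 0)"
  proof -
    have "p - 1 = int k \<longleftrightarrow> p = int (Suc k)" by auto
    then show ?thesis using cell unfolding cell_like_def by metis
  qed
  then have "free_of_rank (relative_homology_group (p - 1) (?E B) (?L B)) (if p = int (Suc k) then 1 else 0)"
    using free_of_rank_iso' [OF i_iso [OF B]] by simp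
  then show "free_of_rank (relative_homology_group p ?W (?F B)) (if p = int (Suc k) then 1 else 0)"
    using free_of_rank_iso [OF d_iso [OF B]] free_of_rank_iso' [OF e_iso [OF B]] by simp
qed

section \<open>Cubes, their collars and attaching maps\<close>

definition cube :: "'i set \<Rightarrow> ('i \<Rightarrow> real) topology" where
  "cube J = product_topology (\<lambda>_. top_of_set {-1..1}) J"

definition cube_boundary :: "'i set \<Rightarrow> ('i \<Rightarrow> real) set" where
  "cube_boundary J = {v \<in> topspace (cube J). \<exists>i\<in>J. \<bar>v i\<bar> = 1}"

lemma topspace_cube: "topspace (cube J) = J \<rightarrow>\<^sub>E {-1..1}"
  by (simp add: cube_def)

lemma compact_space_cube: "compact_space (cube J)"
  by (simp add: cube_def compact_space_product_topology compact_space_subtopology)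

lemma continuous_map_cube_component:
  "i \<in> J \<Longrightarrow> continuous_map (cube J) euclideanreal (\<lambda>v. v i)"
  unfolding cube_def
  by (rule continuous_map_into_fulltopology [of _ _ "{-1..1}"])
     (use continuous_map_product_projection [of i J "\<lambda>_. top_of_set {-1..1::real}"] in simp)

lemma continuous_map_into_cube:
  assumes "\<And>i. i \<in> J \<Longrightarrow> continuous_map Y euclideanreal (\<lambda>y. f y i)"
    and "\<And>y. y \<in> topspace Y \<Longrightarrow> f y \<in> J \<rightarrow>\<^sub>E {-1..1}"
  shows "continuous_map Y (cube J) f"
  unfolding cube_def continuous_map_componentwise
  using assms by (force simp: continuous_map_in_subtopology PiE_iff)

lemma continuous_map_Max:
  fixes f :: "'i \<Rightarrow> 'a \<Rightarrow> real"
  assumes "finite J" "continuous_map Y euclideanreal c" "\<And>i. i \<in> J \<Longrightarrow> continuous_map Y euclideanreal (f i)"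
  shows "continuous_map Y euclideanreal (\<lambda>y. Max (insert (c y) ((\<lambda>i. f i y) ` J)))"
  using assms(1,3)
proof (induction J rule: finite_induct)
  case empty
  then show ?case using assms(2) by simp
next
  case (insert j J)
  have "Max (insert (c y) ((\<lambda>i. f i y) ` insert j J)) = max (f j y) (Max (insert (c y) ((\<lambda>i. f i y) ` J)))" for y
    unfolding image_insert insert_commute [of "c y"] using insert.hyps by (subst Max_insert) auto
  then show ?case
    using insert by (simp add: continuous_map_real_max)
qed

text \<open>The collar of the boundary is pushed outwards along rays from the centre of the cube; this
  deformation fixes the boundary pointwise and hence descends to any space obtained by gluing the cube along
  its boundary.\<close>

lemma cube_collar:
  assumes J: "finite J"
  obtains S h where
    "openin (cube J) S" "cube_boundary J \<subseteq> S"
    "continuous_map (prod_topology (top_of_set {0..1::real}) (cube J)) (cube J) h"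
    "\<And>v. v \<in> topspace (cube J) \<Longrightarrow> h (0, v) = v"
    "\<And>t v. \<lbrakk>t \<in> {0..1}; v \<in> cube_boundary J\<rbrakk> \<Longrightarrow> h (t, v) = v"
    "\<And>t v. \<lbrakk>t \<in> {0..1}; v \<in> S\<rbrakk> \<Longrightarrow> h (t, v) \<in> S"
    "\<And>v. v \<in> S \<Longrightarrow> h (1, v) \<in> cube_boundary J"
proof
  define S where "S = (\<Union>i\<in>J. {v \<in> topspace (cube J). v i \<in> {x. 1/2 < \<bar>x\<bar>}})"
  \<comment> \<open>The radial factor is the sup norm cut off from below at
    \<open>1 - t / 2\<close>. It is 1 at time 0 and always 1 on the boundary; at time 1 it equals
    the norm as soon as that exceeds 1/2, so that the division lands on the boundary.\<close>
  define M where "M t v = Max (insert (1 - t / 2) ((\<lambda>i. \<bar>v i\<bar>) ` J))" for t and v :: "'a \<Rightarrow> real"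
  let ?h = "\<lambda>z. \<lambda>i\<in>J. snd z i / M (fst z) (snd z)"
  let ?P = "prod_topology (top_of_set {0..1::real}) (cube J)"
  have M: "1 - t / 2 \<le> M t v" "i \<in> J \<Longrightarrow> \<bar>v i\<bar> \<le> M t v" for t v i
    using J by (auto simp: M_def)
  have M1: "M t v \<le> 1" if "t \<in> {0..1}" "v \<in> topspace (cube J)" for t v
    using that J by (auto simp: M_def topspace_cube PiE_iff abs_le_iff Ball_def)
  have Mpos: "0 < M t v" if "t \<in> {0..1}" for t v
    using M(1) [of t v] that by auto
  have h_in: "?h (t, v) \<in> topspace (cube J)" if "t \<in> {0..1}" for t v
  proof -
    have "v i / M t v \<in> {-1..1}" if "i \<in> J" for i
    proof -
      have "\<bar>v i / M t v\<bar> \<le> 1"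
        using M(2) [OF that, of v t] Mpos [OF \<open>t \<in> {0..1}\<close>, of v] by simp
      then show ?thesis
        unfolding abs_le_iff by simp
    qed
    then show ?thesis
      by (simp add: topspace_cube)
  qed
  show "openin (cube J) S"
    unfolding S_def
  proof (rule openin_Union, safe)
    fix i assume "i \<in> J"
    moreover have "open {x::real. 1/2 < \<bar>x\<bar>}"
      by (intro open_Collect_less continuous_intros)
    ultimately show "openin (cube J) {v \<in> topspace (cube J). v i \<in> {x. 1/2 < \<bar>x\<bar>}}"
      by (intro openin_continuous_map_preimage [OF continuous_map_cube_component]) auto
  qed
  show "cube_boundary J \<subseteq> S"
    by (auto simp: cube_boundary_def S_def)
  show "continuous_map ?P (cube J) ?h"
  proof (rule continuous_map_into_cube)
    fix i assume i: "i \<in> J"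
    have comp: "continuous_map ?P euclideanreal (\<lambda>z. snd z j)" if "j \<in> J" for j
      using continuous_map_compose [OF homotopy_projections(2) continuous_map_cube_component [OF that]]
      by (simp add: o_def)
    have "continuous_map ?P euclideanreal (\<lambda>z. M (fst z) (snd z))"
      unfolding M_def using J comp
      by (intro continuous_map_Max continuous_intros homotopy_projections) auto
    then have "continuous_map ?P euclideanreal (\<lambda>z. snd z i / M (fst z) (snd z))"
      using Mpos by (intro continuous_map_real_divide comp i) (auto simp: less_imp_neq [THEN not_sym])
    then show "continuous_map ?P euclideanreal (\<lambda>z. ?h z i)"
      using i by simp
  next
    fix z assume "z \<in> topspace ?P"
    then show "?h z \<in> J \<rightarrow>\<^sub>E {- 1..1}"
      using h_in [of "fst z" "snd z"] by (auto simp: topspace_cube mem_Times_iff)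
  qed
  have id: "?h (t, v) = v" if "M t v = 1" "v \<in> topspace (cube J)" for t v
    using that by (auto simp: topspace_cube PiE_iff extensional_def fun_eq_iff)
  show "?h (0, v) = v" if "v \<in> topspace (cube J)" for v
    using M(1) [of 0 v] M1 [of 0 v] that by (intro id) auto
  show "?h (t, v) = v" if "t \<in> {0..1}" "v \<in> cube_boundary J" for t v
    using M(2) [of _ v t] M1 [of t v] that by (intro id) (force simp: cube_boundary_def)+
  show "?h (t, v) \<in> S" if t: "t \<in> {0..1}" and v: "v \<in> S" for t v
  proof -
    obtain i where i: "i \<in> J" "1/2 < \<bar>v i\<bar>" "v \<in> topspace (cube J)"
      using v by (auto simp: S_def)
    have "1/2 < \<bar>v i / M t v\<bar>"
      using i M1 [OF t i(3)] Mpos [OF t, of v] by (simp add: field_simps)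
    then show ?thesis
      using i(1) h_in [OF t, of v] by (auto simp: S_def)
  qed
  show "?h (1, v) \<in> cube_boundary J" if v: "v \<in> S" for v
  proof -
    obtain i where i: "i \<in> J" "1/2 < \<bar>v i\<bar>"
      using v by (auto simp: S_def)
    have "M 1 v \<in> insert (1 - 1 / 2) ((\<lambda>i. \<bar>v i\<bar>) ` J)"
      unfolding M_def using J by (intro Max_in) auto
    with M(2) [OF i(1), of v 1] i(2) obtain j where "j \<in> J" "M 1 v = \<bar>v j\<bar>"
      by auto
    moreover have "0 < M 1 v" by (rule Mpos) simp
    ultimately have "\<exists>i\<in>J. \<bar>?h (1, v) i\<bar> = 1"
      by (intro bexI [of _ j]) auto
    moreover have "?h (1, v) \<in> topspace (cube J)"
      by (rule h_in) simp
    ultimately show ?thesis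
      unfolding cube_boundary_def by (intro CollectI conjI)
  qed
qed

text \<open>A neighbourhood of \<open>Y\<close> and its deformation are pushed forward from the
  collar of the cube. Compactness takes the place of a quotient topology: \<open>\<phi>\<close> and
  its product with the interval are closed maps, which yields both the openness of the neighbourhood
  and the continuity of the deformation.\<close>

lemma cube_attachment_iso:
  assumes J: "finite J" and Z: "Hausdorff_space Z" and \<phi>: "continuous_map (cube J) Z \<phi>"
    and Y: "closedin Z Y" and ZY: "topspace Z = Y \<union> \<phi> ` topspace (cube J)"
    and YL: "\<And>v. v \<in> topspace (cube J) \<Longrightarrow> \<phi> v \<in> Y \<longleftrightarrow> v \<in> cube_boundary J"
    and inj: "inj_on \<phi> (topspace (cube J) - cube_boundary J)"
  shows "homology_iso p (cube J) (cube_boundary J) Z Y \<phi>"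
proof -
  let ?Q = "cube J" and ?L = "cube_boundary J"
  obtain S h where S: "openin ?Q S" "?L \<subseteq> S"
    and h: "continuous_map (prod_topology (top_of_set {0..1::real}) ?Q) ?Q h"
    and h0: "\<And>v. v \<in> topspace ?Q \<Longrightarrow> h (0, v) = v"
    and hL: "\<And>t v. \<lbrakk>t \<in> {0..1}; v \<in> ?L\<rbrakk> \<Longrightarrow> h (t, v) = v"
    and hS: "\<And>t v. \<lbrakk>t \<in> {0..1}; v \<in> S\<rbrakk> \<Longrightarrow> h (t, v) \<in> S"
    and h1: "\<And>v. v \<in> S \<Longrightarrow> h (1, v) \<in> ?L"
    using cube_collar [OF J] by metis
  have SQ: "S \<subseteq> topspace ?Q" and LQ: "?L \<subseteq> topspace ?Q"
    using openin_subset [OF S(1)] by (auto simp: cube_boundary_def)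
  have hQ: "h (t, v) \<in> topspace ?Q" if "t \<in> {0..1}" "v \<in> topspace ?Q" for t v
    using h that by (auto simp: continuous_map_def)
  define S' where "S' = Y \<union> \<phi> ` S"
  have YZ: "Y \<subseteq> topspace Z" using ZY by auto
  have eq: "v = w" if "v \<in> topspace ?Q" "w \<in> topspace ?Q" "\<phi> v = \<phi> w" "v \<notin> ?L" for v w
    using that YL inj by (metis DiffI inj_onD)
  have pre: "S = {v \<in> topspace ?Q. \<phi> v \<in> S'}"
  proof
    show "{v \<in> topspace ?Q. \<phi> v \<in> S'} \<subseteq> S"
      using YL S(2) SQ eq by (auto simp: S'_def) (metis subset_iff)
  qed (use SQ in \<open>auto simp: S'_def\<close>)
  have closed_map: "closedin Z (\<phi> ` K)" if "closedin ?Q K" for K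
    using continuous_imp_closed_map [OF \<phi> compact_space_cube Z] that by (simp add: closed_map_def)
  have S'_open: "openin Z S'"
  proof -
    have "topspace Z - \<phi> ` (topspace ?Q - S) = S'"
    proof
      show "topspace Z - \<phi> ` (topspace ?Q - S) \<subseteq> S'"
        using ZY by (auto simp: S'_def)
      have "\<phi> v \<notin> S'" if "v \<in> topspace ?Q" "v \<notin> S" for v
        using that pre by auto
      then show "S' \<subseteq> topspace Z - \<phi> ` (topspace ?Q - S)"
        using ZY SQ by (auto simp: S'_def) (metis image_eqI)
    qed
    moreover have "closedin Z (\<phi> ` (topspace ?Q - S))"
      by (intro closed_map closedin_diff S) simp
    ultimately show ?thesis
      by (metis openin_diff openin_topspace)
  qed
  have isoQ: "homology_iso p ?Q ?L ?Q S id"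
    using hL hS h1 h0 S(2) SQ by (intro deformation_relative_homology_iso [OF h]) auto
  \<comment> \<open>Off \<open>Y\<close> the chosen preimage is unique, since \<open>\<phi>\<close>
    is injective on the open cube and sends the boundary into \<open>Y\<close>.\<close>
  define G where "G z = (if snd z \<in> Y then snd z
      else \<phi> (h (fst z, SOME v. v \<in> topspace ?Q \<and> \<phi> v = snd z)))" for z :: "real \<times> 'b"
  have G\<phi>: "G (t, \<phi> v) = \<phi> (h (t, v))" if "t \<in> {0..1}" "v \<in> topspace ?Q" for t v
  proof (cases "\<phi> v \<in> Y")
    case True
    then show ?thesis
      using that YL hL by (simp add: G_def)
  next
    case False
    then have "(SOME w. w \<in> topspace ?Q \<and> \<phi> w = \<phi> v) = v"
      using that YL eq by (intro some_equality) metis+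
    then show ?thesis
      using False by (simp add: G_def)
  qed
  have GY: "G (t, y) = y" if "y \<in> Y" for t y
    using that by (simp add: G_def)
  have G: "continuous_map (prod_topology (top_of_set {0..1::real}) Z) Z G"
    unfolding continuous_map_closedin
  proof (intro conjI allI impI)
    let ?I = "top_of_set {0..1::real}"
    have \<phi>h: "continuous_map (prod_topology ?I ?Q) Z (\<phi> \<circ> h)"
      by (rule continuous_map_compose [OF h \<phi>])
    have id\<phi>: "continuous_map (prod_topology ?I ?Q) (prod_topology ?I Z) (\<lambda>z. (fst z, \<phi> (snd z)))"
      using continuous_map_compose [OF continuous_map_snd \<phi>]
      by (auto simp: o_def continuous_map_fst intro!: continuous_map_pairedI)
    show "G \<in> topspace (prod_topology ?I Z) \<rightarrow> topspace Z"
    proof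
      fix z assume z: "z \<in> topspace (prod_topology ?I Z)"
      show "G z \<in> topspace Z"
      proof (cases "snd z \<in> Y")
        case True
        then show ?thesis using z by (auto simp: G_def)
      next
        case False
        moreover have "snd z \<in> topspace Z" using z by auto
        ultimately have "snd z \<in> \<phi> ` topspace ?Q"
          unfolding ZY by blast
        then obtain v where "v \<in> topspace ?Q" "snd z = \<phi> v"
          by blast
        then have v: "v \<in> topspace ?Q" "z = (fst z, \<phi> v)" "fst z \<in> {0..1}"
          using z by (auto simp: prod_eq_iff)
        show ?thesis
          by (subst v(2)) (use G\<phi> [OF v(3,1)] hQ [OF v(3,1)] ZY in auto)
      qed
    qed
    fix K assume K: "closedin Z K"
    \<comment> \<open>Continuity is tested on closed sets: the preimage of \<open>K\<close> consists
      of the resting points of \<open>Y\<close> in \<open>K\<close> and the image of a closed set of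
      the compact product of interval and cube.\<close>
    have "{z \<in> topspace (prod_topology ?I Z). G z \<in> K}
      = {0..1} \<times> (Y \<inter> K) \<union> (\<lambda>z. (fst z, \<phi> (snd z))) ` {z \<in> topspace (prod_topology ?I ?Q). (\<phi> \<circ> h) z \<in> K}"
    proof (intro equalityI subsetI)
      fix z assume z: "z \<in> {z \<in> topspace (prod_topology ?I Z). G z \<in> K}"
      show "z \<in> {0..1} \<times> (Y \<inter> K) \<union> (\<lambda>z. (fst z, \<phi> (snd z))) ` {z \<in> topspace (prod_topology ?I ?Q). (\<phi> \<circ> h) z \<in> K}"
      proof (cases "snd z \<in> Y")
        case True
        with z show ?thesis by (auto simp: GY)
      next
        case False
        with z ZY obtain v where v: "v \<in> topspace ?Q" "snd z = \<phi> v"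
          by auto
        then have "z = (fst (fst z, v), \<phi> (snd (fst z, v)))" by (simp add: prod_eq_iff)
        moreover have "(fst z, v) \<in> {z \<in> topspace (prod_topology ?I ?Q). (\<phi> \<circ> h) z \<in> K}"
          using v z G\<phi> [of "fst z" v] by (auto simp flip: v(2))
        ultimately show ?thesis by blast
      qed
    next
      fix z assume "z \<in> {0..1} \<times> (Y \<inter> K) \<union> (\<lambda>z. (fst z, \<phi> (snd z))) ` {z \<in> topspace (prod_topology ?I ?Q). (\<phi> \<circ> h) z \<in> K}"
      then show "z \<in> {z \<in> topspace (prod_topology ?I Z). G z \<in> K}"
        using ZY YZ by (auto simp: GY G\<phi>)
    qed
    moreover have "closedin (prod_topology ?I Z) ({0..1} \<times> (Y \<inter> K))"
      using Y K by (simp add: closedin_prod_Times_iff closedin_Int)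
    moreover have "closedin (prod_topology ?I Z)
        ((\<lambda>z. (fst z, \<phi> (snd z))) ` {z \<in> topspace (prod_topology ?I ?Q). (\<phi> \<circ> h) z \<in> K})"
    proof -
      have "compact_space (prod_topology ?I ?Q)" "Hausdorff_space (prod_topology ?I Z)"
        using Z by (auto simp: compact_space_prod_topology compact_space_cube compact_space_subtopology
            Hausdorff_space_prod_topology Hausdorff_space_subtopology)
      then have "closed_map (prod_topology ?I ?Q) (prod_topology ?I Z) (\<lambda>z. (fst z, \<phi> (snd z)))"
        by (rule continuous_imp_closed_map [OF id\<phi>])
      then show ?thesis
        using closedin_continuous_map_preimage [OF \<phi>h K] by (simp add: closed_map_def)
    qed
    ultimately show "closedin (prod_topology ?I Z) {z \<in> topspace (prod_topology ?I Z). G z \<in> K}"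
      by (simp add: closedin_Un)
  qed
  have isoZ: "homology_iso p Z Y Z S' id"
  proof (rule deformation_relative_homology_iso [OF G])
    show "G (0, z) = z" if "z \<in> topspace Z" for z
      using that ZY GY G\<phi> h0 by auto
    show "Y \<subseteq> S'" "S' \<subseteq> topspace Z"
      using ZY SQ by (auto simp: S'_def)
    show "G (t, z) \<in> S'" if "t \<in> {0..1}" "z \<in> S'" for t z
      using that GY G\<phi> SQ hS by (auto simp: S'_def subset_iff)
    show "G (1, z) \<in> Y" if "z \<in> S'" for z
      using that GY G\<phi> SQ h1 YL LQ by (auto simp: S'_def subset_iff)
  qed (simp add: GY)
  show ?thesis
  proof (rule relative_homology_iso_compact [OF compact_space_cube Z \<phi> Y _ _ _ _ pre _ S(2) _ isoQ isoZ])
    show "Y \<subseteq> Z interior_of S'"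
      using S'_open by (simp add: interior_of_openin S'_def)
    show "inj_on \<phi> {q \<in> topspace ?Q. \<phi> q \<notin> Y}"
      using YL by (intro inj_on_subset [OF inj]) auto
  qed (use ZY SQ YL LQ in \<open>auto simp: S'_def\<close>)
qed

section \<open>Tori, fat wedges and the rank added by an attachment\<close>

definition torus :: "'i set \<Rightarrow> ('i \<Rightarrow> complex) topology" where
  "torus J = product_topology (\<lambda>_. circle) J"

definition fat_wedge :: "'i set \<Rightarrow> ('i \<Rightarrow> complex) set" where
  "fat_wedge J = {u \<in> topspace (torus J). \<exists>i\<in>J. u i = 1}"

lemma topspace_torus: "topspace (torus J) = J \<rightarrow>\<^sub>E sphere 0 1"
  by (simp add: torus_def)

lemma compact_space_torus: "compact_space (torus J)"
  by (simp add: torus_def compact_space_product_topology compact_space_circle)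

lemma Hausdorff_space_torus: "Hausdorff_space (torus J)"
  by (simp add: torus_def Hausdorff_space_product_topology Hausdorff_space_circle)

lemma continuous_map_torus_component:
  "i \<in> J \<Longrightarrow> continuous_map (torus J) euclidean (\<lambda>u. u i)"
  unfolding torus_def circle_def
  by (rule continuous_map_into_fulltopology [of _ _ "sphere 0 1"])
     (use continuous_map_product_projection [of i J "\<lambda>_. top_of_set (sphere 0 1 :: complex set)"] in simp)

lemma continuous_map_into_torus:
  assumes "\<And>i. i \<in> J \<Longrightarrow> continuous_map Y euclidean (\<lambda>y. f y i)"
    and "\<And>y. y \<in> topspace Y \<Longrightarrow> f y \<in> J \<rightarrow>\<^sub>E sphere 0 1"
  shows "continuous_map Y (torus J) f"
  unfolding torus_def circle_def continuous_map_componentwise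
  using assms by (force simp: continuous_map_in_subtopology PiE_iff)

lemma homeomorphic_map_torus_insert:
  assumes "j \<notin> J"
  shows "homeomorphic_map (prod_topology (torus J) circle) (torus (insert j J)) (\<lambda>(u, z). u(j := z))"
  unfolding homeomorphic_map_maps
proof (intro exI [of _ "\<lambda>u. (restrict u J, u j)"], unfold homeomorphic_maps_def, intro conjI ballI)
  let ?W = "prod_topology (torus J) circle"
  show "continuous_map ?W (torus (insert j J)) (\<lambda>(u, z). u(j := z))"
  proof (rule continuous_map_into_torus)
    show "continuous_map ?W euclidean (\<lambda>y. (case y of (u, z) \<Rightarrow> u(j := z)) i)" if "i \<in> insert j J" for i
    proof (cases "i = j")
      case True
      then show ?thesis
        using circle_product_projections(2) by (simp add: case_prod_unfold)
    next
      case False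
      then have "continuous_map (torus J) euclidean (\<lambda>u. u i)"
        using that by (intro continuous_map_torus_component) auto
      from continuous_map_compose [OF circle_product_projections(1) this] show ?thesis
        using False by (simp add: case_prod_unfold o_def)
    qed
  qed (auto simp: topspace_torus PiE_iff extensional_def)
  show "continuous_map (torus (insert j J)) ?W (\<lambda>u. (restrict u J, u j))"
    by (intro continuous_map_into_circle_product continuous_map_into_torus)
       (auto simp: topspace_torus PiE_iff intro!: continuous_map_torus_component)
qed (use assms in \<open>auto simp: topspace_torus PiE_iff extensional_def fun_eq_iff\<close>)

text \<open>A new coordinate multiplies the torus by a circle, and the larger fat wedge is the
  boundary of the product: either the new coordinate is 1 or the old ones lie in the fat wedge. The
  induction starts with a point and an empty fat wedge.\<close>

lemma cell_like_torus:
  assumes "finite J"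
  shows "cell_like (torus J) (fat_wedge J) (card J)"
  using assms
proof (induction J rule: finite_induct)
  case empty
  have top: "topspace (torus {} :: ('a \<Rightarrow> complex) topology) = {\<lambda>_. undefined}"
    by (simp add: topspace_torus)
  have "free_of_rank (homology_group p (torus {} :: ('a \<Rightarrow> complex) topology)) (if p = 0 then 1 else 0)" for p
  proof (cases "p = 0")
    case True
    have "path_connected_space (torus {} :: ('a \<Rightarrow> complex) topology)"
      unfolding path_connected_space_def top by (auto intro!: exI [of _ "\<lambda>_ _. undefined"] simp: pathin_def top)
    then have "homology_group 0 (torus {} :: ('a \<Rightarrow> complex) topology) \<cong> integer_group"
      using isomorphic_integer_zeroth_homology_group top
      by (metis group.iso_sym group_integer_group group_relative_homology_group insert_not_empty null_topspace_iff_trivial)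
    then show ?thesis
      using True free_of_rank_integer_group free_of_rank_iso by (auto simp: is_iso_def)
  next
    case False
    then show ?thesis
      using free_of_rank_trivial [OF homology_dimension_axiom [OF top False]] by simp
  qed
  then show ?case
    by (auto simp: cell_like_def fat_wedge_def hom_induced_id)
next
  case (insert j J)
  have sub: "fat_wedge J \<subseteq> topspace (torus J)"
    by (auto simp: fat_wedge_def)
  have im: "(\<lambda>(u, z). u(j := z)) ` circle_product_boundary (torus J) (fat_wedge J) = fat_wedge (insert j J)"
  proof (intro equalityI subsetI)
    fix w assume "w \<in> fat_wedge (insert j J)"
    then have w: "w \<in> insert j J \<rightarrow>\<^sub>E sphere 0 1" "w j = 1 \<or> (\<exists>i\<in>J. w i = 1)"
      by (auto simp: fat_wedge_def topspace_torus)
    have "w = (restrict w J)(j := w j)"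
      using w(1) by (auto simp: PiE_iff extensional_def fun_eq_iff)
    moreover have "(restrict w J, w j) \<in> circle_product_boundary (torus J) (fat_wedge J)"
      using w by (auto simp: circle_product_boundary_def fat_wedge_def topspace_torus PiE_iff)
    ultimately show "w \<in> (\<lambda>(u, z). u(j := z)) ` circle_product_boundary (torus J) (fat_wedge J)"
      by (intro image_eqI [of _ _ "(restrict w J, w j)"]) auto
  next
    fix w assume "w \<in> (\<lambda>(u, z). u(j := z)) ` circle_product_boundary (torus J) (fat_wedge J)"
    then show "w \<in> fat_wedge (insert j J)"
      using insert.hyps(2)
      by (auto simp: circle_product_boundary_def fat_wedge_def topspace_torus PiE_iff extensional_def)
  qed
  have sub': "circle_product_boundary (torus J) (fat_wedge J) \<subseteq> topspace (prod_topology (torus J) circle)"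
    using sub by (auto simp: circle_product_boundary_def)
  from cell_like_homeomorphic_map [OF homeomorphic_map_torus_insert [OF insert.hyps(2)] sub'
      cell_like_circle_product [OF compact_space_torus Hausdorff_space_torus sub insert.IH]]
  show ?case
    unfolding im using insert.hyps by simp
qed

text \<open>The characteristic map of the top cell. The angle runs from 0 to \<open>2 * pi\<close>,
  so exactly the two end values of a coordinate are sent to the base point 1.\<close>

definition cube_to_torus :: "'i set \<Rightarrow> ('i \<Rightarrow> real) \<Rightarrow> 'i \<Rightarrow> complex" where
  "cube_to_torus J v = (\<lambda>i\<in>J. cis (pi * (v i + 1)))"

lemma cis_eq_1_cube: "x \<in> {-1..1} \<Longrightarrow> cis (pi * (x + 1)) = 1 \<longleftrightarrow> \<bar>x\<bar> = 1"
proof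
  assume x: "x \<in> {-1..1}" and "cis (pi * (x + 1)) = 1"
  then have "cos (pi * (x + 1)) = 1"
    by (simp add: complex_eq_iff)
  then obtain n :: int where "pi * (x + 1) = of_int n * 2 * pi"
    using cos_one_2pi_int by blast
  then have "pi * (x + 1) = pi * (2 * of_int n)"
    by simp
  then have n: "x + 1 = 2 * of_int n"
    by (subst (asm) mult_cancel_left) simp
  then have "n = 0 \<or> n = 1"
    using x by auto
  then show "\<bar>x\<bar> = 1"
    using n by auto
qed (auto simp: abs_if complex_eq_iff split: if_splits)

lemma cis_inj_cube:
  assumes "x \<in> {-1<..<1}" "y \<in> {-1<..<1}" "cis (pi * (x + 1)) = cis (pi * (y + 1))"
  shows "x = y"
proof -
  have "x + 1 < 2" "y + 1 < 2" using assms by auto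
  then have "pi * (x + 1) < 2 * pi" "pi * (y + 1) < 2 * pi"
    by (metis mult.commute mult_less_cancel_left_pos pi_gt_zero)+
  then have "Arg2pi (cis (pi * (x + 1))) = pi * (x + 1)" "Arg2pi (cis (pi * (y + 1))) = pi * (y + 1)"
    using assms by (auto intro!: Arg2pi_unique [of 1] simp: cis_conv_exp)
  then have "pi * (x + 1) = pi * (y + 1)"
    using assms(3) by metis
  then show ?thesis by simp
qed

lemma cube_to_torus:
  shows continuous_map_cube_to_torus: "continuous_map (cube J) (torus J) (cube_to_torus J)"
    and cube_to_torus_surj: "cube_to_torus J ` topspace (cube J) = topspace (torus J)"
    and cube_to_torus_boundary: "v \<in> topspace (cube J) \<Longrightarrow> cube_to_torus J v \<in> fat_wedge J \<longleftrightarrow> v \<in> cube_boundary J"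
    and inj_on_cube_to_torus: "inj_on (cube_to_torus J) (topspace (cube J) - cube_boundary J)"
proof -
  have comp: "continuous_map (cube J) euclidean (\<lambda>v. cis (pi * (v i + 1)))" if "i \<in> J" for i
  proof -
    have "continuous_map euclideanreal euclidean (\<lambda>t. cis (pi * (t + 1)))"
      by (auto intro!: continuous_intros)
    from continuous_map_compose [OF continuous_map_cube_component [OF that] this] show ?thesis
      by (simp add: o_def)
  qed
  show cont: "continuous_map (cube J) (torus J) (cube_to_torus J)"
    by (rule continuous_map_into_torus) (auto simp: cube_to_torus_def intro: comp)
  show "cube_to_torus J ` topspace (cube J) = topspace (torus J)"
  proof
    show "cube_to_torus J ` topspace (cube J) \<subseteq> topspace (torus J)"
      using cont by (simp add: continuous_map_def image_subset_iff_funcset)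
    show "topspace (torus J) \<subseteq> cube_to_torus J ` topspace (cube J)"
    proof
      fix u assume "u \<in> topspace (torus J)"
      then have u: "u \<in> extensional J" "\<And>i. i \<in> J \<Longrightarrow> norm (u i) = 1"
        by (auto simp: topspace_torus PiE_iff)
      define v where "v = (\<lambda>i\<in>J. Arg2pi (u i) / pi - 1)"
      have "u = cube_to_torus J v"
      proof
        fix i show "u i = cube_to_torus J v i"
        proof (cases "i \<in> J")
          case True
          then have "u i = exp (\<i> * of_real (Arg2pi (u i)))"
            using Arg2pi_eq [of "u i"] u(2) by simp
          then show ?thesis
            using True by (simp add: cube_to_torus_def v_def cis_conv_exp)
        qed (use u in \<open>auto simp: cube_to_torus_def extensional_def\<close>)
      qed
      moreover have "v \<in> topspace (cube J)"
        using Arg2pi_ge_0 Arg2pi_lt_2pi by (auto simp: topspace_cube v_def field_simps less_imp_le)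
      ultimately show "u \<in> cube_to_torus J ` topspace (cube J)"
        by blast
    qed
  qed
  show "cube_to_torus J v \<in> fat_wedge J \<longleftrightarrow> v \<in> cube_boundary J" if "v \<in> topspace (cube J)" for v
  proof -
    have "v i \<in> {-1..1}" if "i \<in> J" for i
      using that \<open>v \<in> topspace (cube J)\<close> by (auto simp: topspace_cube PiE_iff)
    then have "(\<exists>i\<in>J. cube_to_torus J v i = 1) \<longleftrightarrow> (\<exists>i\<in>J. \<bar>v i\<bar> = 1)"
      by (simp add: cube_to_torus_def cis_eq_1_cube)
    moreover have "cube_to_torus J v \<in> topspace (torus J)"
      using that cont by (auto simp: continuous_map_def)
    ultimately show ?thesis
      using that by (simp add: fat_wedge_def cube_boundary_def)
  qed
  show "inj_on (cube_to_torus J) (topspace (cube J) - cube_boundary J)"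
  proof (rule inj_onI)
    fix v w assume v: "v \<in> topspace (cube J) - cube_boundary J" and w: "w \<in> topspace (cube J) - cube_boundary J"
      and eq: "cube_to_torus J v = cube_to_torus J w"
    have *: "x i \<in> {-1<..<1}" if "x \<in> topspace (cube J) - cube_boundary J" "i \<in> J" for x i
    proof -
      have "x i \<in> {-1..1}" "\<bar>x i\<bar> \<noteq> 1"
        using that by (auto simp: topspace_cube cube_boundary_def)
      then show ?thesis by auto
    qed
    show "v = w"
    proof
      fix i show "v i = w i"
      proof (cases "i \<in> J")
        case True
        then have "cis (pi * (v i + 1)) = cis (pi * (w i + 1))"
          using fun_cong [OF eq, of i] by (simp add: cube_to_torus_def)
        then show ?thesis
          using cis_inj_cube * v w True by blast
      next
        case False
        then show ?thesis
          using v w by (auto simp: topspace_cube PiE_iff extensional_def)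
      qed
    qed
  qed
qed

text \<open>The cube is a common source: its maps to the torus modulo the fat wedge and to
  \<open>Z\<close> modulo \<open>Y\<close> are both relative homeomorphisms. So the torus pair and
  \<open>(Z, Y)\<close> have the same relative homology, and absolute classes of the torus provide
  lifts of the relative classes to \<open>Z\<close>. The long exact sequence of
  \<open>(Z, Y)\<close> thus breaks into short exact ones.\<close>

lemma torus_attachment_rank:
  assumes J: "finite J" and Z: "Hausdorff_space Z" and \<phi>: "continuous_map (torus J) Z \<phi>"
    and inj: "inj_on \<phi> (topspace (torus J))"
    and Y: "closedin Z Y" and ZY: "topspace Z = Y \<union> \<phi> ` topspace (torus J)"
    and YL: "\<And>u. u \<in> topspace (torus J) \<Longrightarrow> \<phi> u \<in> Y \<longleftrightarrow> u \<in> fat_wedge J"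
    and r: "free_of_rank (homology_group p (subtopology Z Y)) r"
  shows "free_of_rank (homology_group p Z) (if p = int (card J) then Suc r else r)"
proof -
  let ?T = "torus J" and ?D = "fat_wedge J" and ?c = "cube_to_torus J"
  have DT: "?D \<subseteq> topspace ?T" by (auto simp: fat_wedge_def)
  have cT: "?c v \<in> topspace ?T" if "v \<in> topspace (cube J)" for v
    using that cube_to_torus_surj by blast
  have closedD: "closedin ?T ?D"
  proof -
    have "closedin ?T {u \<in> topspace ?T. \<phi> u \<in> Y}"
      by (rule closedin_continuous_map_preimage [OF \<phi> Y])
    moreover have "{u \<in> topspace ?T. \<phi> u \<in> Y} = ?D"
      using YL DT by auto
    ultimately show ?thesis by simp
  qed
  have iso: "homology_iso q ?T ?D Z Y \<phi>" for q
  proof -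
    have c: "homology_iso q (cube J) (cube_boundary J) ?T ?D ?c"
      using DT by (intro cube_attachment_iso [OF J Hausdorff_space_torus continuous_map_cube_to_torus closedD])
        (auto simp: cube_to_torus_surj cube_to_torus_boundary inj_on_cube_to_torus)
    have \<phi>c: "homology_iso q (cube J) (cube_boundary J) Z Y (\<phi> \<circ> ?c)"
    proof (rule cube_attachment_iso [OF J Z continuous_map_compose [OF continuous_map_cube_to_torus \<phi>] Y])
      show "topspace Z = Y \<union> (\<phi> \<circ> ?c) ` topspace (cube J)"
        by (simp only: ZY cube_to_torus_surj flip: image_comp)
      show "inj_on (\<phi> \<circ> ?c) (topspace (cube J) - cube_boundary J)"
        using cT by (intro comp_inj_on inj_on_cube_to_torus inj_on_subset [OF inj]) auto
    qed (use YL cT cube_to_torus_boundary in auto)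
    have "?c \<in> topspace (cube J) \<inter> cube_boundary J \<rightarrow> ?D"
      using cube_to_torus_boundary by blast
    then have comp: "hom_induced q (cube J) (cube_boundary J) Z Y (\<phi> \<circ> ?c) x
        = hom_induced q ?T ?D Z Y \<phi> (hom_induced q (cube J) (cube_boundary J) ?T ?D ?c x)" for x
      using YL DT
      by (subst hom_induced_compose' [OF continuous_map_cube_to_torus _ \<phi>])
         (auto simp: cube_boundary_def Pi_iff)
    have "id \<in> iso (relative_homology_group q Z Y) (relative_homology_group q Z Y)"
      by (simp add: iso_def hom_def)
    from iso_square [OF c this hom_induced_hom hom_induced_hom] comp \<phi>c show ?thesis
      by (metis id_apply)
  qed
  have cell: "cell_like ?T ?D (card J)"
    by (rule cell_like_torus [OF J])
  have free: "free_of_rank (relative_homology_group q Z Y) (if q = int (card J) then 1 else 0)" for q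
    using free_of_rank_iso' [OF iso] cell by (simp add: cell_like_def)
  have onto: "hom_induced q Z {} Z Y id ` carrier (homology_group q Z) = carrier (relative_homology_group q Z Y)" for q
  proof
    show "hom_induced q Z {} Z Y id ` carrier (homology_group q Z) \<subseteq> carrier (relative_homology_group q Z Y)"
      by (auto simp: hom_induced_carrier)
    show "carrier (relative_homology_group q Z Y) \<subseteq> hom_induced q Z {} Z Y id ` carrier (homology_group q Z)"
    proof
      fix z assume "z \<in> carrier (relative_homology_group q Z Y)"
      moreover have "hom_induced q ?T ?D Z Y \<phi> ` carrier (relative_homology_group q ?T ?D) = carrier (relative_homology_group q Z Y)"
        using iso [of q] by (simp add: iso_def bij_betw_def)
      ultimately obtain t where "t \<in> carrier (relative_homology_group q ?T ?D)" "z = hom_induced q ?T ?D Z Y \<phi> t"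
        by blast
      then obtain s where "z = hom_induced q ?T ?D Z Y \<phi> (hom_induced q ?T {} ?T ?D id s)"
        using cell unfolding cell_like_def by (metis imageE)
      also have "\<dots> = hom_induced q Z {} Z Y id (hom_induced q ?T {} Z {} \<phi> s)"
        using \<phi> YL DT by (subst (1 2) hom_induced_compose') auto
      finally show "z \<in> hom_induced q Z {} Z Y id ` carrier (homology_group q Z)"
        by (simp add: hom_induced_carrier)
    qed
  qed
  show ?thesis
  proof (rule free_of_rank_extension)
    show "hom_induced p (subtopology Z Y) {} Z {} id \<in> hom (homology_group p (subtopology Z Y)) (homology_group p Z)"
      "hom_induced p Z {} Z Y id \<in> hom (homology_group p Z) (relative_homology_group p Z Y)"
      by (rule hom_induced_hom)+
    show "kernel (homology_group p Z) (relative_homology_group p Z Y) (hom_induced p Z {} Z Y id)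
      = hom_induced p (subtopology Z Y) {} Z {} id ` carrier (homology_group p (subtopology Z Y))"
      using homology_exactness_axiom_3 [of p Z Y] by simp
    \<comment> \<open>Injectivity in degree \<open>p\<close> comes from surjectivity one degree
      higher, where the connecting homomorphism starts.\<close>
    define q where "q = p + 1"
    have ex: "exact_seq ([homology_group (q - 1) Z, homology_group (q - 1) (subtopology Z Y),
        relative_homology_group q Z Y, homology_group q Z],
      [hom_induced (q - 1) (subtopology Z Y) {} Z {} id, hom_boundary q Z Y, hom_induced q Z {} Z Y id])"
      using homology_exactness_axiom_1 homology_exactness_axiom_2 by (metis exact_seq_cons_iff)
    then have "inj_on (hom_induced (q - 1) (subtopology Z Y) {} Z {} id) (carrier (homology_group (q - 1) (subtopology Z Y)))"
      using onto [of q] exact_seq_epi_eq_triviality [OF ex] exact_seq_mon_eq_triviality [OF ex] by blast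
    then show "inj_on (hom_induced p (subtopology Z Y) {} Z {} id) (carrier (homology_group p (subtopology Z Y)))"
      by (simp add: q_def)
  qed (use r free onto in auto)
qed

section \<open>Crossingless matchings and stack words\<close>

text \<open>With the head of the list as top, the stack is the reduced word, written backwards, of
  the letters read so far in the free product of groups of order two, one for each letter.\<close>

definition step :: "'a list \<Rightarrow> 'a \<Rightarrow> 'a list" where
  "step s y = (if s \<noteq> [] \<and> hd s = y then tl s else y # s)"

primrec stack :: "(nat \<Rightarrow> 'a) \<Rightarrow> nat \<Rightarrow> 'a list" where
  "stack x 0 = []"
| "stack x (Suc k) = step (stack x k) (x (Suc k))"

definition reduced :: "'a list \<Rightarrow> bool" where
  "reduced s \<longleftrightarrow> successively (\<noteq>) s"

lemma reduced_step: "reduced s \<Longrightarrow> reduced (step s y)"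
  by (cases s) (auto simp: reduced_def step_def successively_Cons)

lemma reduced_stack: "reduced (stack x k)"
  by (induction k) (simp_all add: reduced_step, simp add: reduced_def)

text \<open>Letters act as involutions: on a reduced stack a popped \<open>y\<close> uncovers a
  different letter, so reading \<open>y\<close> again pushes it back.\<close>

lemma step_step: "reduced s \<Longrightarrow> step (step s y) y = s"
  by (cases s; cases "tl s") (auto simp: reduced_def step_def)

section \<open>Half-circles in terms of the order of their end points\<close>

definition noncrossing :: "nat set set \<Rightarrow> bool" where
  "noncrossing a \<longleftrightarrow> (\<forall>i j k l. {i, j} \<in> a \<longrightarrow> {k, l} \<in> a \<longrightarrow> \<not> (i < k \<and> k < j \<and> j < l))"

text \<open>By Thales, the product form describes the circle with diameter from \<open>i\<close> to
  \<open>j\<close>; it allows comparing two half-circles without centres and radii.\<close>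

lemma half_circle_iff:
  assumes "i < j"
  shows "z \<in> half_circle {i, j} \<longleftrightarrow> 0 \<le> Im z \<and> (Re z - real i) * (Re z - real j) + (Im z)\<^sup>2 = 0"
proof -
  let ?c = "(real i + real j) / 2" and ?r = "(real j - real i) / 2"
  have "Min {i, j} = i" "Max {i, j} = j"
    using assms by auto
  then have "z \<in> half_circle {i, j} \<longleftrightarrow> 0 \<le> Im z \<and> norm (z - of_real ?c) = ?r"
    by (simp add: half_circle_def dist_norm)
  also have "norm (z - of_real ?c) = ?r \<longleftrightarrow> (norm (z - of_real ?c))\<^sup>2 = ?r\<^sup>2"
    using assms by (intro power2_eq_iff_nonneg [symmetric]) auto
  also have "\<dots> \<longleftrightarrow> (Re z - ?c)\<^sup>2 + (Im z)\<^sup>2 = ?r\<^sup>2"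
    unfolding cmod_power2 by simp
  also have "\<dots> \<longleftrightarrow> (Re z - real i) * (Re z - real j) + (Im z)\<^sup>2 = 0"
  proof -
    have "(Re z - ?c)\<^sup>2 - ?r\<^sup>2 = (Re z - real i) * (Re z - real j)"
      by (simp add: power2_eq_square field_simps)
    then show ?thesis by linarith
  qed
  finally show ?thesis .
qed

lemma half_circles_crossing:
  assumes "i < k" "k < j" "j < l"
  shows "half_circle {i, j} \<inter> half_circle {k, l} \<noteq> {}"
proof -
  define I J K L where "I = real i" and "J = real j" and "K = real k" and "L = real l"
  define D where "D = K + L - I - J"
  \<comment> \<open>The abscissa of the radical axis of the two circles, where
    \<open>(x - I) * (x - J)\<close> and \<open>(x - K) * (x - L)\<close> agree.\<close>
  define x where "x = (K * L - I * J) / D"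
  have lt: "I < K" "K < J" "J < L"
    using assms by (auto simp: I_def J_def K_def L_def)
  then have D: "D > 0" by (simp add: D_def)
  have x: "x * D = K * L - I * J"
    using D by (simp add: x_def)
  have eq1: "(x - I) * D = (K - I) * (L - I)" "(J - x) * D = (J - K) * (L - J)"
    using x by (auto simp: left_diff_distrib) (auto simp: D_def algebra_simps)
  have "(x - I) * D > 0" "(J - x) * D > 0"
    unfolding eq1 using lt by auto
  then have pos: "x - I > 0" "J - x > 0"
    using D by (auto simp: zero_less_mult_iff)
  define y where "y = sqrt ((x - I) * (J - x))"
  have y: "y \<ge> 0" "y\<^sup>2 = (x - I) * (J - x)"
    using pos by (auto simp: y_def)
  have "(x - I) * (x - J) = (x - K) * (x - L)"
    using x by (simp add: D_def algebra_simps)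
  then have "(x - I) * (x - J) + y\<^sup>2 = 0" "(x - K) * (x - L) + y\<^sup>2 = 0"
    using y(2) by (simp_all add: algebra_simps)
  then have "Complex x y \<in> half_circle {i, j} \<inter> half_circle {k, l}"
    using assms y(1) by (simp add: half_circle_iff I_def J_def K_def L_def)
  then show ?thesis by blast
qed

lemma half_circle_real_part:
  assumes "i < j" "z \<in> half_circle {i, j}"
  shows "real i \<le> Re z" "Re z \<le> real j"
proof -
  have "(Re z - real i) * (Re z - real j) \<le> 0"
    using assms half_circle_iff [OF assms(1)] by (metis add_nonneg_eq_0_iff linorder_linear order_eq_refl zero_le_power2)
  then show "real i \<le> Re z" "Re z \<le> real j"
    using assms(1) by (auto simp: mult_le_0_iff)
qed

text \<open>Over a common abscissa the outer half-circle is strictly higher, as the squared height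
  is the product of the distances to the two end points.\<close>

lemma half_circles_nested_disjoint:
  assumes "i < k" "k < l" "l < j"
  shows "half_circle {i, j} \<inter> half_circle {k, l} = {}"
proof (rule ccontr)
  assume "half_circle {i, j} \<inter> half_circle {k, l} \<noteq> {}"
  then obtain z where z: "z \<in> half_circle {i, j}" "z \<in> half_circle {k, l}" by blast
  have "real k \<le> Re z" "Re z \<le> real l"
    using half_circle_real_part [OF assms(2) z(2)] by auto
  then have "(Re z - real k) * (real l - Re z) < (Re z - real i) * (real j - Re z)"
    using assms by (intro mult_strict_mono') auto
  moreover have "(Re z - real i) * (Re z - real j) = (Re z - real k) * (Re z - real l)"
    using z assms half_circle_iff [of i j z] half_circle_iff [of k l z] by auto
  ultimately show False
    by (simp add: algebra_simps)
qed

lemma crossingless_matchings_eq: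
  "crossingless_matchings n = {a. partition_on {1..2 * n} a \<and> (\<forall>A\<in>a. card A = 2) \<and> noncrossing a}"
proof -
  have "disjoint_family_on half_circle a \<longleftrightarrow> noncrossing a"
    if a: "partition_on {1..2 * n} a" "\<forall>A\<in>a. card A = 2" for a
  proof
    assume disj: "disjoint_family_on half_circle a"
    show "noncrossing a"
      unfolding noncrossing_def
    proof (intro allI impI notI)
      fix i j k l assume *: "{i, j} \<in> a" "{k, l} \<in> a" "i < k \<and> k < j \<and> j < l"
      then have "{i, j} \<noteq> {k, l}" by (auto simp: doubleton_eq_iff)
      then show False
        using disj * half_circles_crossing [of i k j l] by (auto simp: disjoint_family_on_def)
    qed
  next
    assume nc: "noncrossing a"
    show "disjoint_family_on half_circle a"
      unfolding disjoint_family_on_def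
    proof (intro ballI impI)
      have *: "half_circle {i, j} \<inter> half_circle {k, l} = {}"
        if "{i, j} \<in> a" "{k, l} \<in> a" "i < j" "k < l" "i < k" "{i, j} \<inter> {k, l} = {}" for i j k l
      proof (cases "j < k")
        case True
        then show ?thesis
          using half_circle_real_part [OF \<open>i < j\<close>] half_circle_real_part [OF \<open>k < l\<close>] by force
      next
        case False
        then have "l < j"
          using that nc unfolding noncrossing_def by (metis Int_iff empty_iff insertI1 insert_commute linorder_neqE_nat)
        then show ?thesis
          using half_circles_nested_disjoint that by blast
      qed
      fix A B assume AB: "A \<in> a" "B \<in> a" "A \<noteq> B"
      then have "A \<inter> B = {}"
        using a(1) by (auto simp: partition_on_def disjoint_def)
      moreover obtain i j where "A = {i, j}" "i < j"
        using a(2) AB(1) by (metis card_2_iff insert_commute linorder_neqE_nat)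
      moreover obtain k l where "B = {k, l}" "k < l"
        using a(2) AB(2) by (metis card_2_iff insert_commute linorder_neqE_nat)
      ultimately show "half_circle A \<inter> half_circle B = {}"
        using * [of i j k l] * [of k l i j] AB by (metis Int_commute disjoint_iff insertI1 linorder_neqE_nat)
    qed
  qed
  then show ?thesis
    by (auto simp: crossingless_matchings_def)
qed

text \<open>The arc of the first position of the block divides the rest into the positions under it
  and those after it. As arcs do not cross, both parts are again unions of arcs and by induction
  leave the stack alone; the two ends of the arc carry the same letter and cancel.\<close>

lemma stack_matched_interval:
  assumes a: "partition_on {1..N} a" "\<forall>A\<in>a. card A = 2" "noncrossing a"
    and x: "\<forall>A\<in>a. \<forall>i\<in>A. \<forall>j\<in>A. x i = x j"
    and lh: "l \<le> h" "h \<le> N"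
    and closed: "\<And>A. \<lbrakk>A \<in> a; A \<inter> {l<..h} \<noteq> {}\<rbrakk> \<Longrightarrow> A \<subseteq> {l<..h}"
  shows "stack x h = stack x l"
  using lh closed
proof (induction "h - l" arbitrary: l h rule: less_induct)
  case less
  show ?case
  proof (cases "l = h")
    case False
    then have "l < h" using less.prems by simp
    then have "Suc l \<in> \<Union>a"
      using a(1) less.prems by (auto simp: partition_on_def)
    then obtain A where A: "A \<in> a" "Suc l \<in> A" by blast
    then obtain j where Aj: "A = {Suc l, j}" "j \<noteq> Suc l"
      using a(2) by (metis card_2_iff doubleton_eq_iff insertE singletonD)
    have "A \<subseteq> {l<..h}"
    proof (rule less.prems(3) [OF A(1)])
      have "Suc l \<in> A \<inter> {l<..h}"
        using A(2) \<open>l < h\<close> by auto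
      then show "A \<inter> {l<..h} \<noteq> {}" by blast
    qed
    then have j: "Suc l < j" "j \<le> h"
      using Aj by auto
    have other: "B = A \<or> (Suc l \<notin> B \<and> j \<notin> B)" if "B \<in> a" for B
    proof (cases "B = A")
      case False
      then have "B \<inter> A = {}"
        using a(1) A(1) that by (auto simp: partition_on_def dest: disjointD)
      then show ?thesis using Aj(1) by blast
    qed simp
    have pair: "\<exists>c d. B = {c, d} \<and> c < d" if "B \<in> a" for B
      using a(2) that by (metis card_2_iff insert_commute linorder_neqE_nat)
    have cross: False if "{c, d} \<in> a" "Suc l < c" "c < j" "j < d" for c d
      using a(3) A(1) Aj that unfolding noncrossing_def by blast
    have 1: "stack x (j - 1) = stack x (Suc l)"
    proof (rule less.hyps)
      fix B assume B: "B \<in> a" "B \<inter> {Suc l<..j - 1} \<noteq> {}"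
      obtain c d where cd: "B = {c, d}" "c < d" using pair [OF B(1)] by blast
      have "B \<noteq> A" using B(2) Aj j by auto
      then have no: "Suc l \<notin> B" "j \<notin> B" using other B(1) by auto
      obtain e where e: "e \<in> B" "e \<in> {Suc l<..j - 1}"
        using B(2) by blast
      have "e \<in> B \<inter> {l<..h}"
        using j e by auto
      then have "B \<inter> {l<..h} \<noteq> {}"
        by blast
      then have "B \<subseteq> {l<..h}"
        using less.prems(3) B(1) by blast
      then have "Suc l < c" "d \<le> h" "c \<noteq> j" "d \<noteq> j"
        using cd no by (auto simp: Suc_lessI)
      moreover from this have "\<not> (c < j \<and> j < d)"
        using cross [of c d] B(1) cd(1) by blast
      ultimately show "B \<subseteq> {Suc l<..j - 1}"
        using e cd j by auto
    qed (use j less.prems in auto)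
    have 2: "stack x h = stack x j"
    proof (rule less.hyps)
      fix B assume B: "B \<in> a" "B \<inter> {j<..h} \<noteq> {}"
      obtain c d where cd: "B = {c, d}" "c < d" using pair [OF B(1)] by blast
      have "B \<noteq> A" using B(2) Aj j by auto
      then have no: "Suc l \<notin> B" "j \<notin> B" using other B(1) by auto
      obtain e where e: "e \<in> B" "e \<in> {j<..h}"
        using B(2) by blast
      have "e \<in> B \<inter> {l<..h}"
        using j e by auto
      then have "B \<inter> {l<..h} \<noteq> {}"
        by blast
      then have "B \<subseteq> {l<..h}"
        using less.prems(3) B(1) by blast
      then have "Suc l < c" "d \<le> h" "c \<noteq> j" "d \<noteq> j"
        using cd no by (auto simp: Suc_lessI)
      moreover from this have "\<not> (c < j \<and> j < d)"
        using cross [of c d] B(1) cd(1) by blast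
      ultimately show "B \<subseteq> {j<..h}"
        using e cd j by auto
    qed (use j less.prems in auto)
    have "x (Suc l) = x j"
      using x [rule_format, OF A(1,2), of j] Aj by simp
    moreover obtain j' where j': "j = Suc j'"
      using j by (cases j) auto
    ultimately have "stack x j = step (step (stack x l) (x (Suc l))) (x (Suc l))"
      using 1 by simp
    then show ?thesis
      using 2 by (simp add: step_step reduced_stack)
  qed simp
qed

text \<open>The machine is run on positions instead of letters, so that every pop yields an arc. The
  last clause of the invariant, that no arc passes over a position still on the stack, is what
  excludes a crossing when that position is matched later.\<close>

lemma stack_eq_Nil_matching:
  assumes "stack x N = []"
  obtains a where "partition_on {1..N} a" "\<forall>A\<in>a. card A = 2" "noncrossing a" "\<forall>A\<in>a. \<forall>i\<in>A. \<forall>j\<in>A. x i = x j"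
proof -
  have "\<exists>ps a. map x ps = stack x m \<and> sorted_wrt (>) ps \<and> set ps \<subseteq> {1..m}
      \<and> partition_on ({1..m} - set ps) a \<and> (\<forall>A\<in>a. card A = 2) \<and> noncrossing a
      \<and> (\<forall>A\<in>a. \<forall>i\<in>A. \<forall>j\<in>A. x i = x j)
      \<and> (\<forall>A\<in>a. \<forall>i\<in>A. \<forall>j\<in>A. \<forall>p\<in>set ps. \<not> (i < p \<and> p < j))" for m
  proof (induction m)
    case 0
    show ?case
      by (intro exI [of _ "[]"] exI [of _ "{}"]) (auto simp: partition_on_def noncrossing_def)
  next
    case (Suc m)
    then obtain ps a where IH: "map x ps = stack x m" "sorted_wrt (>) ps" "set ps \<subseteq> {1..m}"
      "partition_on ({1..m} - set ps) a" "\<forall>A\<in>a. card A = 2" "noncrossing a"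
      "\<forall>A\<in>a. \<forall>i\<in>A. \<forall>j\<in>A. x i = x j"
      "\<forall>A\<in>a. \<forall>i\<in>A. \<forall>j\<in>A. \<forall>p\<in>set ps. \<not> (i < p \<and> p < j)"
      by (elim exE conjE) (rule that)
    have le: "i \<le> m" "i \<notin> set ps" if "A \<in> a" "i \<in> A" for A i
      using IH(4) that by (auto simp: partition_on_def)
    show ?case
    proof (cases "ps \<noteq> [] \<and> x (hd ps) = x (Suc m)")
      case True
      then obtain p qs where ps: "ps = p # qs" "x p = x (Suc m)"
        by (cases ps) auto
      have p: "1 \<le> p" "p \<le> m" "p \<notin> set qs" "\<forall>q\<in>set qs. q < p"
        using IH(2,3) ps by auto
      show ?thesis
      proof (intro exI [of _ qs] exI [of _ "insert {p, Suc m} a"] conjI)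
        show "map x qs = stack x (Suc m)"
          using IH(1) ps by (auto simp: step_def simp flip: IH(1))
        show "partition_on ({1..Suc m} - set qs) (insert {p, Suc m} a)"
        proof -
          have U: "\<Union>a = {1..m} - set ps" "disjoint a" "{} \<notin> a"
            using IH(4) by (auto simp: partition_on_def)
          have "\<Union>(insert {p, Suc m} a) = {1..Suc m} - set qs"
            using U(1) ps p IH(3) by auto
          moreover have "disjoint (insert {p, Suc m} a)"
            using U(2) le ps by (force simp: disjoint_def)
          ultimately show ?thesis
            using U(3) by (auto simp: partition_on_def)
        qed
        show "\<forall>A\<in>insert {p, Suc m} a. card A = 2"
          using IH(5) p by auto
        show "noncrossing (insert {p, Suc m} a)"
          unfolding noncrossing_def
        proof (intro allI impI notI)
          fix i j k l
          assume ij: "{i, j} \<in> insert {p, Suc m} a" and kl: "{k, l} \<in> insert {p, Suc m} a"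
            and lt: "i < k \<and> k < j \<and> j < l"
          have "l \<le> Suc m"
            using kl le(1) [of "{k, l}" l] p by (auto simp: doubleton_eq_iff)
          then have "{i, j} \<noteq> {p, Suc m}"
            using lt p by (auto simp: doubleton_eq_iff)
          then have ij: "{i, j} \<in> a" using ij by simp
          show False
          proof (cases "{k, l} = {p, Suc m}")
            case True
            then have "k = p"
              using lt p \<open>l \<le> Suc m\<close> by (auto simp: doubleton_eq_iff)
            then show False
              using IH(8) ij lt ps by auto
          next
            case False
            then show False
              using kl ij lt IH(6) by (auto simp: noncrossing_def)
          qed
        qed
        show "\<forall>A\<in>insert {p, Suc m} a. \<forall>i\<in>A. \<forall>j\<in>A. x i = x j"
        proof -
          have "\<forall>i\<in>{p, Suc m}. \<forall>j\<in>{p, Suc m}. x i = x j"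
            using ps(2) by simp
          with IH(7) show ?thesis by blast
        qed
        show "\<forall>A\<in>insert {p, Suc m} a. \<forall>i\<in>A. \<forall>j\<in>A. \<forall>q\<in>set qs. \<not> (i < q \<and> q < j)"
          using IH(8) ps p by fastforce
      qed (use IH(2,3) ps in auto)
    next
      case False
      show ?thesis
      proof (intro exI [of _ "Suc m # ps"] exI [of _ a] conjI)
        show "map x (Suc m # ps) = stack x (Suc m)"
          using False by (cases ps) (auto simp: step_def simp flip: IH(1))
        have "{1..Suc m} - set (Suc m # ps) = {1..m} - set ps"
          by auto
        then show "partition_on ({1..Suc m} - set (Suc m # ps)) a"
          using IH(4) by simp
        show "\<forall>A\<in>a. \<forall>i\<in>A. \<forall>j\<in>A. \<forall>p\<in>set (Suc m # ps). \<not> (i < p \<and> p < j)"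
          using IH(8) le(1) by fastforce
        show "\<forall>A\<in>a. \<forall>i\<in>A. \<forall>j\<in>A. x i = x j"
          by (rule IH(7))
      qed (use IH(2,3,5,6) in auto)
    qed
  qed
  from this [of N] assms show ?thesis
    using that by auto
qed

section \<open>The space as the set of words with empty final stack\<close>

lemma circle_power_eq: "circle_power m = torus {1..m}"
  by (simp add: circle_power_def torus_def circle_def)

definition matched_words :: "nat \<Rightarrow> (nat \<Rightarrow> complex) set" where
  "matched_words N = {x \<in> topspace (torus {1..N}). stack x N = []}"

lemma T_tilde_eq: "T_tilde n = subtopology (torus {1..2 * n}) (matched_words (2 * n))"
proof -
  have "(\<Union>a\<in>crossingless_matchings n. matching_torus n a) = matched_words (2 * n)"
  proof (intro equalityI subsetI)
    fix x assume "x \<in> (\<Union>a\<in>crossingless_matchings n. matching_torus n a)"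
    then obtain a where a: "partition_on {1..2 * n} a" "\<forall>A\<in>a. card A = 2" "noncrossing a"
      and x: "x \<in> topspace (torus {1..2 * n})" "\<forall>A\<in>a. \<forall>i\<in>A. \<forall>j\<in>A. x i = x j"
      by (auto simp: crossingless_matchings_eq matching_torus_def circle_power_eq)
    have "A \<subseteq> {0<..2 * n}" if "A \<in> a" for A
      using Union_upper [OF that] a(1) by (auto simp: partition_on_def)
    then have "stack x (2 * n) = stack x 0"
      by (intro stack_matched_interval [OF a x(2)]) auto
    then show "x \<in> matched_words (2 * n)"
      using x by (simp add: matched_words_def)
  next
    fix x assume "x \<in> matched_words (2 * n)"
    then have x: "x \<in> topspace (torus {1..2 * n})" "stack x (2 * n) = []"
      by (auto simp: matched_words_def)
    obtain a where "partition_on {1..2 * n} a" "\<forall>A\<in>a. card A = 2" "noncrossing a" "\<forall>A\<in>a. \<forall>i\<in>A. \<forall>j\<in>A. x i = x j"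
      using stack_eq_Nil_matching [OF x(2)] .
    then show "x \<in> (\<Union>a\<in>crossingless_matchings n. matching_torus n a)"
      using x(1) by (auto simp: crossingless_matchings_eq matching_torus_def circle_power_eq)
  qed
  then show ?thesis
    by (simp add: T_tilde_def circle_power_eq)
qed

section \<open>The cells\<close>

definition top_letter :: "complex list \<Rightarrow> complex" where
  "top_letter s = (if s = [] then 1 else hd s)"

text \<open>A formal stack: at a position of \<open>J\<close> it pushes even if the factor is 1, so
  its length depends on \<open>J\<close> alone and it need not be reduced. Outside \<open>J\<close>
  the letter read equals the top, which is popped, or is the letter 1 read onto the empty
  stack.\<close>

primrec cell_stack :: "nat set \<Rightarrow> (nat \<Rightarrow> complex) \<Rightarrow> nat \<Rightarrow> complex list" where
  "cell_stack J u 0 = []"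
| "cell_stack J u (Suc k) =
    (if Suc k \<in> J then (top_letter (cell_stack J u k) * u (Suc k)) # cell_stack J u k
     else if cell_stack J u k = [] then [1] else tl (cell_stack J u k))"

definition cell_letter :: "nat set \<Rightarrow> (nat \<Rightarrow> complex) \<Rightarrow> nat \<Rightarrow> complex" where
  "cell_letter J u k = top_letter (cell_stack J u (k - 1)) * (if k \<in> J then u k else 1)"

definition cell_map :: "nat \<Rightarrow> nat set \<Rightarrow> (nat \<Rightarrow> complex) \<Rightarrow> nat \<Rightarrow> complex" where
  "cell_map N J u = (\<lambda>k\<in>{1..N}. cell_letter J u k)"

text \<open>At height 0 both choices lead upwards, as any letter read onto an empty stack is pushed;
  on the open cell \<open>J\<close> then records only whether that letter differs from 1.\<close>

primrec height :: "nat set \<Rightarrow> nat \<Rightarrow> nat" where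
  "height J 0 = 0"
| "height J (Suc k) = (if Suc k \<in> J \<or> height J k = 0 then Suc (height J k) else height J k - 1)"

definition cells :: "nat \<Rightarrow> nat set set" where
  "cells N = {J. J \<subseteq> {1..N} \<and> height J N = 0}"

lemma length_cell_stack: "length (cell_stack J u k) = height J k"
proof (induction k)
  case (Suc k)
  then show ?case
    by (cases "cell_stack J u k") auto
qed simp

lemma norm_cell_stack:
  assumes "\<And>k. k \<in> J \<Longrightarrow> norm (u k) = 1"
  shows "\<forall>y\<in>set (cell_stack J u k). norm y = 1"
proof (induction k)
  case (Suc k)
  then have "norm (top_letter (cell_stack J u k)) = 1"
    by (cases "cell_stack J u k") (auto simp: top_letter_def)
  then show ?case
    using Suc assms by (auto simp: norm_mult dest: list.set_sel(2) split: if_splits)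
qed simp

lemma norm_top_letter: "\<forall>y\<in>set s. norm y = 1 \<Longrightarrow> norm (top_letter s) = 1"
  by (cases s) (auto simp: top_letter_def)

lemma norm_stack:
  assumes "\<And>k. k \<in> {1..m} \<Longrightarrow> norm (x k) = 1"
  shows "\<forall>y\<in>set (stack x m). norm y = 1"
  using assms
proof (induction m)
  case (Suc m)
  then have "\<forall>y\<in>set (stack x m). norm y = 1" "norm (x (Suc m)) = 1"
    by auto
  then show ?case
    by (cases "stack x m") (auto simp: step_def)
qed simp

text \<open>The top of the stack is the head, so \<open>foldr\<close> feeds the letters to the
  machine from the bottom up.\<close>

definition normal_form :: "'a list \<Rightarrow> 'a list" where
  "normal_form s = foldr (\<lambda>y s. step s y) s []"

lemma normal_form_simps [simp]: "normal_form [] = []" "normal_form (y # s) = step (normal_form s) y"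
  by (simp_all add: normal_form_def)

lemma reduced_normal_form: "reduced (normal_form s)"
  by (induction s) (simp_all add: reduced_step, simp add: reduced_def)

lemma normal_form_reduced: "reduced s \<Longrightarrow> normal_form s = s"
proof (induction s)
  case (Cons y s)
  then show ?case
    by (cases s) (auto simp: reduced_def step_def)
qed simp

text \<open>Valid on the whole closed cell: where factors are 1, the actual stack is the free
  reduction of the formal one. A formal pop agrees with reading the top letter because letters are
  involutions.\<close>

lemma stack_eq_normal_form:
  assumes "\<And>k. k \<in> {1..m} \<Longrightarrow> x k = cell_letter J u k"
  shows "stack x m = normal_form (cell_stack J u m)"
  using assms
proof (induction m)
  case (Suc m)
  have IH: "stack x m = normal_form (cell_stack J u m)"
    using Suc by simp
  have x: "x (Suc m) = cell_letter J u (Suc m)"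
    using Suc.prems by simp
  show ?case
  proof (cases "Suc m \<in> J")
    case True
    then show ?thesis using IH x by (simp add: cell_letter_def)
  next
    case False
    show ?thesis
    proof (cases "cell_stack J u m")
      case Nil
      then show ?thesis using False IH x by (simp add: cell_letter_def top_letter_def)
    next
      case (Cons t s)
      then show ?thesis
        using False IH x by (simp add: cell_letter_def top_letter_def step_step reduced_normal_form)
    qed
  qed
qed simp

text \<open>A factor different from 1 makes the pushed letter differ from the nonzero one below it.
  Together with \<open>stack_eq_normal_form\<close> this identifies the formal stack with the actual
  one on the open cell.\<close>

lemma reduced_cell_stack:
  assumes u: "\<And>k. k \<in> J \<Longrightarrow> norm (u k) = 1" and u1: "\<And>k. \<lbrakk>k \<in> J; k \<le> m\<rbrakk> \<Longrightarrow> u k \<noteq> 1"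
  shows "reduced (cell_stack J u m)"
  using u1
proof (induction m)
  case (Suc m)
  then have IH: "reduced (cell_stack J u m)" by simp
  have norm: "\<forall>y\<in>set (cell_stack J u m). norm y = 1"
    using norm_cell_stack u by blast
  show ?case
  proof (cases "cell_stack J u m")
    case Nil
    then show ?thesis by (simp add: reduced_def)
  next
    case (Cons t s)
    then have "t \<noteq> 0" using norm by auto
    then have "Suc m \<in> J \<Longrightarrow> t * u (Suc m) \<noteq> t"
      using Suc.prems [of "Suc m"] by simp
    then show ?thesis
      using Cons IH by (auto simp: reduced_def top_letter_def successively_Cons)
  qed
qed (simp add: reduced_def)

lemma torus_norm: "\<lbrakk>u \<in> topspace (torus J); k \<in> J\<rbrakk> \<Longrightarrow> norm (u k) = 1"
  by (auto simp: topspace_torus PiE_iff)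

lemma cell_map_in_torus:
  assumes "u \<in> topspace (torus J)"
  shows "cell_map N J u \<in> topspace (torus {1..N})"
proof -
  have "norm (cell_letter J u k) = 1" for k
    using norm_top_letter [OF norm_cell_stack [OF torus_norm [OF assms]]] torus_norm [OF assms]
    by (simp add: cell_letter_def norm_mult)
  then show ?thesis
    by (simp add: topspace_torus cell_map_def)
qed

lemma cell_map_matched:
  assumes "u \<in> topspace (torus J)" "J \<in> cells N"
  shows "cell_map N J u \<in> matched_words N"
proof -
  have "length (cell_stack J u N) = 0"
    using assms by (simp add: length_cell_stack cells_def)
  moreover have "stack (cell_map N J u) N = normal_form (cell_stack J u N)"
    by (rule stack_eq_normal_form) (simp add: cell_map_def)
  ultimately show ?thesis
    using cell_map_in_torus [OF assms(1)] by (simp add: matched_words_def)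
qed

text \<open>Each factor is recovered by dividing the letter by the top of the formal stack, which
  has modulus 1 and is determined by earlier factors. The argument includes factors equal to 1, so
  the closed torus is embedded.\<close>

lemma inj_on_cell_map:
  assumes "J \<subseteq> {1..N}"
  shows "inj_on (cell_map N J) (topspace (torus J))"
proof (rule inj_onI)
  fix u v assume u: "u \<in> topspace (torus J)" and v: "v \<in> topspace (torus J)"
    and eq: "cell_map N J u = cell_map N J v"
  have letters: "cell_letter J u k = cell_letter J v k" if "k \<in> {1..N}" for k
    using fun_cong [OF eq, of k] that by (simp add: cell_map_def)
  have uv: "u (Suc k) = v (Suc k)" if "cell_stack J u k = cell_stack J v k" "Suc k \<in> J" for k
  proof -
    have "norm (top_letter (cell_stack J v k)) = 1"
      by (rule norm_top_letter [OF norm_cell_stack [OF torus_norm [OF v]]])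
    then have "top_letter (cell_stack J v k) \<noteq> 0" by auto
    then show ?thesis
      using letters [of "Suc k"] that assms by (auto simp: cell_letter_def)
  qed
  have stacks: "cell_stack J u k = cell_stack J v k" for k
    by (induction k) (auto simp: uv)
  show "u = v"
  proof
    fix k show "u k = v k"
    proof (cases "k \<in> J")
      case True
      then obtain k' where "k = Suc k'"
        using assms by (cases k) auto
      then show ?thesis using uv stacks True by blast
    next
      case False
      then show ?thesis
        using u v by (auto simp: topspace_torus PiE_iff extensional_def)
    qed
  qed
qed

section \<open>Continuity of the cell maps\<close>

lemma continuous_map_times:
  fixes f g :: "'a \<Rightarrow> 'b::real_normed_algebra"
  assumes "continuous_map X euclidean f" "continuous_map X euclidean g"
  shows "continuous_map X euclidean (\<lambda>x. f x * g x)"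
proof -
  have "continuous_map X euclidean (\<lambda>x. (f x, g x))"
    using continuous_map_pairedI [OF assms] by (simp add: euclidean_product_topology)
  moreover have "continuous_map euclidean euclidean (\<lambda>z::'b \<times> 'b. fst z * snd z)"
    by (auto intro!: continuous_intros)
  ultimately have "continuous_map X euclidean ((\<lambda>z. fst z * snd z) \<circ> (\<lambda>x. (f x, g x)))"
    by (rule continuous_map_compose)
  then show ?thesis by (simp add: o_def)
qed

text \<open>Emptiness of a stack is not a continuous condition; the constant length turns the case
  distinction in the top letter into a global one.\<close>

lemma continuous_map_top_letter:
  assumes len: "\<And>u. length (f u) = h" and f: "\<And>i. i < h \<Longrightarrow> continuous_map X euclidean (\<lambda>u. f u ! i)"
  shows "continuous_map X euclidean (\<lambda>u. top_letter (f u) :: complex)"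
proof (cases "h = 0")
  case True
  then have "f u = []" for u using len by simp
  then show ?thesis by (simp add: top_letter_def)
next
  case False
  then have "f u \<noteq> []" for u
    using len by (metis list.size(3))
  then show ?thesis
    using f [of 0] False by (simp add: top_letter_def hd_conv_nth)
qed

lemma continuous_map_cell_stack:
  assumes "i < height J k"
  shows "continuous_map (torus J) euclidean (\<lambda>u. cell_stack J u k ! i)"
  using assms
proof (induction k arbitrary: i)
  case (Suc k)
  have top: "continuous_map (torus J) euclidean (\<lambda>u. top_letter (cell_stack J u k))"
    using Suc.IH by (intro continuous_map_top_letter [where h = "height J k"]) (auto simp: length_cell_stack)
  have empty: "cell_stack J u k = [] \<longleftrightarrow> height J k = 0" for u
    by (metis length_0_conv length_cell_stack)
  show ?case
  proof (cases "Suc k \<in> J")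
    case True
    have "continuous_map (torus J) euclidean (\<lambda>u. top_letter (cell_stack J u k) * u (Suc k))"
      using top continuous_map_torus_component [OF True] by (intro continuous_map_times)
    then show ?thesis
      using True Suc by (cases i) auto
  next
    case False
    then show ?thesis
      using Suc.prems Suc.IH [of "Suc i"]
      by (cases "height J k = 0") (auto simp: empty nth_tl length_cell_stack)
  qed
qed simp

lemma continuous_map_cell_map: "continuous_map (torus J) (torus {1..N}) (cell_map N J)"
proof (rule continuous_map_into_torus)
  fix k assume k: "k \<in> {1..N}"
  have "continuous_map (torus J) euclidean (\<lambda>u. top_letter (cell_stack J u (k - 1)))"
    by (intro continuous_map_top_letter [where h = "height J (k - 1)"] continuous_map_cell_stack)
       (auto simp: length_cell_stack)
  then have "continuous_map (torus J) euclidean (\<lambda>u. cell_letter J u k)"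
    unfolding cell_letter_def
    using continuous_map_torus_component [of k J] by (cases "k \<in> J") (auto intro: continuous_map_times)
  then show "continuous_map (torus J) euclidean (\<lambda>u. cell_map N J u k)"
    using k by (simp add: cell_map_def)
next
  fix u assume "u \<in> topspace (torus J)"
  then show "cell_map N J u \<in> {1..N} \<rightarrow>\<^sub>E sphere 0 1"
    using cell_map_in_torus by (simp add: topspace_torus)
qed

section \<open>The cell containing a given word, and the boundary of a cell\<close>

definition push_set :: "nat \<Rightarrow> (nat \<Rightarrow> complex) \<Rightarrow> nat set" where
  "push_set N x = {k \<in> {1..N}. x k \<noteq> top_letter (stack x (k - 1))}"

text \<open>The quotients of the letters by the tops of the actual stack are factors different from
  1 at the pushing positions, and with these factors the formal stack retraces the actual
  one.\<close>

lemma push_set_cell: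
  assumes x: "x \<in> matched_words N"
  obtains u where "push_set N x \<in> cells N" "u \<in> topspace (torus (push_set N x))"
    "u \<notin> fat_wedge (push_set N x)" "cell_map N (push_set N x) u = x"
proof
  let ?J = "push_set N x"
  define u where "u = (\<lambda>k\<in>?J. x k / top_letter (stack x (k - 1)))"
  have xn: "norm (x k) = 1" if "k \<in> {1..N}" for k
    using x torus_norm [of x "{1..N}" k] that by (simp add: matched_words_def)
  have top: "norm (top_letter (stack x k)) = 1" if "k \<le> N" for k
    using that xn by (intro norm_top_letter norm_stack) auto
  show u: "u \<in> topspace (torus ?J)"
    using xn top by (auto simp: u_def topspace_torus norm_divide push_set_def)
  have "u k \<noteq> 1" if "k \<in> ?J" for k
    using that by (auto simp: u_def push_set_def)
  then show "u \<notin> fat_wedge ?J"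
    by (auto simp: fat_wedge_def)
  have letter: "x (Suc k) = top_letter (stack x k) * (if Suc k \<in> ?J then u (Suc k) else 1)" if "Suc k \<le> N" for k
  proof -
    have "top_letter (stack x k) \<noteq> 0"
      using top [of k] that by auto
    then show ?thesis
      using that by (auto simp: u_def push_set_def)
  qed
  have stacks: "cell_stack ?J u k = stack x k" if "k \<le> N" for k
    using that
  proof (induction k)
    case (Suc k)
    then have IH: "cell_stack ?J u k = stack x k" by simp
    show ?case
    proof (cases "Suc k \<in> ?J")
      case True
      then have "x (Suc k) \<noteq> top_letter (stack x k)"
        by (simp add: push_set_def)
      then show ?thesis
        using True IH letter [OF Suc.prems] by (auto simp: step_def top_letter_def split: if_splits)
    next
      case False
      then show ?thesis
        using IH letter [OF Suc.prems] by (auto simp: step_def top_letter_def split: if_splits)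
    qed
  qed simp
  show "cell_map N ?J u = x"
  proof
    fix k show "cell_map N ?J u k = x k"
    proof (cases "k \<in> {1..N}")
      case True
      then obtain k' where "k = Suc k'" "Suc k' \<le> N" by (cases k) auto
      then show ?thesis
        using letter [of k'] stacks [of k'] by (simp add: cell_map_def cell_letter_def)
    next
      case False
      then show ?thesis
        using x by (auto simp: matched_words_def cell_map_def topspace_torus PiE_iff extensional_def)
    qed
  qed
  have "height ?J N = length (stack x N)"
    using stacks [of N] length_cell_stack [of ?J u N] by simp
  then show "?J \<in> cells N"
    using x by (simp add: cells_def matched_words_def push_set_def subset_iff)
qed

text \<open>As long as no factor is 1, formal and actual stack agree and the pushes are those of
  \<open>J\<close>. At the first factor equal to 1 the letter equals the actual top, so that this
  position drops out; positions after it are left uncontrolled.\<close>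

lemma push_set_cell_map:
  assumes J: "J \<subseteq> {1..N}" and u: "u \<in> topspace (torus J)" and m: "m \<le> N"
    and u1: "\<And>k. \<lbrakk>k \<in> J; k \<le> m\<rbrakk> \<Longrightarrow> u k \<noteq> 1"
  shows "push_set N (cell_map N J u) \<inter> {..m} = J \<inter> {..m}"
    and "\<lbrakk>Suc m \<in> J; u (Suc m) = 1\<rbrakk> \<Longrightarrow> Suc m \<notin> push_set N (cell_map N J u)"
proof -
  let ?x = "cell_map N J u"
  have stacks: "stack ?x k = cell_stack J u k" if "k \<le> m" for k
  proof -
    have "stack ?x k = normal_form (cell_stack J u k)"
      using that m by (intro stack_eq_normal_form) (auto simp: cell_map_def)
    also have "\<dots> = cell_stack J u k"
      using that u1 by (intro normal_form_reduced reduced_cell_stack torus_norm [OF u]) auto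
    finally show ?thesis .
  qed
  have x: "?x k = top_letter (stack ?x (k - 1)) * (if k \<in> J then u k else 1)" if "k \<in> {1..N}" "k - 1 \<le> m" for k
  proof -
    have "?x k = cell_letter J u k"
      using that by (simp add: cell_map_def)
    then show ?thesis
      unfolding stacks [OF that(2)] by (simp only: cell_letter_def)
  qed
  have top: "top_letter (stack ?x k) \<noteq> 0" if "k \<le> m" for k
  proof -
    have "norm (top_letter (cell_stack J u k)) = 1"
      by (rule norm_top_letter [OF norm_cell_stack [OF torus_norm [OF u]]])
    then show ?thesis
      unfolding stacks [OF that] by auto
  qed
  show "push_set N ?x \<inter> {..m} = J \<inter> {..m}"
  proof (rule Set.set_eqI)
    fix k show "k \<in> push_set N ?x \<inter> {..m} \<longleftrightarrow> k \<in> J \<inter> {..m}"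
    proof (cases "k \<in> {1..N} \<and> k \<le> m")
      case True
      define t where "t = top_letter (stack ?x (k - 1))"
      have t: "t \<noteq> 0"
        unfolding t_def by (rule top) (use True in auto)
      have xt: "?x k = t * (if k \<in> J then u k else 1)"
        unfolding t_def by (rule x) (use True in auto)
      have "?x k \<noteq> t \<longleftrightarrow> k \<in> J"
        unfolding xt using t u1 [of k] True by simp
      moreover have "k \<in> push_set N ?x \<longleftrightarrow> ?x k \<noteq> t"
        using True unfolding t_def push_set_def by simp
      ultimately show ?thesis
        using True by simp
    next
      case False
      then show ?thesis
        using J by (auto simp: push_set_def)
    qed
  qed
  show "Suc m \<notin> push_set N ?x" if "Suc m \<in> J" "u (Suc m) = 1"
    using x [of "Suc m"] that by (auto simp: push_set_def)
qed

text \<open>The codes order the cells lexicographically, the first letter being the most significant one.\<close>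

definition cell_code :: "nat \<Rightarrow> nat set \<Rightarrow> nat" where
  "cell_code N J = (\<Sum>k\<in>J. 2 ^ (N - k))"

text \<open>The code is a binary number whose leading digit belongs to position 1; all digits after
  \<open>k\<close> together contribute less than \<open>2 ^ (N - k)\<close>.\<close>

lemma cell_code_less:
  assumes J: "J \<subseteq> {1..N}" "J' \<subseteq> {1..N}" and k: "k \<in> J" "k \<notin> J'"
    and eq: "J' \<inter> {..<k} = J \<inter> {..<k}"
  shows "cell_code N J' < cell_code N J"
proof -
  have fin: "finite J" "finite J'"
    using J finite_subset by auto
  have kN: "k \<le> N" using J k by auto
  have "J' = J' \<inter> {..<k} \<union> J' \<inter> {k<..}"
    using k(2) by (auto simp: not_less_iff_gr_or_eq)
  then have "cell_code N J' = (\<Sum>i\<in>J' \<inter> {..<k} \<union> J' \<inter> {k<..}. 2 ^ (N - i))"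
    unfolding cell_code_def by metis
  also have "\<dots> = (\<Sum>i\<in>J' \<inter> {..<k}. 2 ^ (N - i)) + (\<Sum>i\<in>J' \<inter> {k<..}. 2 ^ (N - i))"
  proof (rule sum.union_disjoint)
    show "J' \<inter> {..<k} \<inter> (J' \<inter> {k<..}) = {}" by auto
  qed (simp_all add: fin)
  also have "(\<Sum>i\<in>J' \<inter> {k<..}. 2 ^ (N - i)) \<le> (\<Sum>i\<in>{k<..N}. 2 ^ (N - i) :: nat)"
    using J by (intro sum_mono2) auto
  also have "(\<Sum>i\<in>{k<..N}. 2 ^ (N - i) :: nat) = (\<Sum>i<N - k. 2 ^ i)"
    by (rule sum.reindex_bij_witness [where i = "\<lambda>i. N - i" and j = "\<lambda>i. N - i"]) auto
  also have "\<dots> < 2 ^ (N - k)"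
    by (simp add: sum_power2 lessThan_atLeast0)
  finally have "cell_code N J' < (\<Sum>i\<in>J \<inter> {..<k}. 2 ^ (N - i)) + 2 ^ (N - k)"
    by (simp add: eq)
  also have "\<dots> = (\<Sum>i\<in>insert k (J \<inter> {..<k}). 2 ^ (N - i))"
    using fin by (subst sum.insert) auto
  also have "\<dots> \<le> cell_code N J"
    unfolding cell_code_def using fin k by (intro sum_mono2) auto
  finally show ?thesis .
qed

lemma inj_on_cell_code: "inj_on (cell_code N) {J. J \<subseteq> {1..N}}"
proof (rule inj_onI, rule ccontr)
  fix J J' assume J: "J \<in> {J. J \<subseteq> {1..N}}" "J' \<in> {J. J \<subseteq> {1..N}}" and eq: "cell_code N J = cell_code N J'" and "J \<noteq> J'"
  then have ex: "\<exists>k. (k \<in> J) \<noteq> (k \<in> J')" by auto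
  define k where "k = (LEAST k. (k \<in> J) \<noteq> (k \<in> J'))"
  have k: "(k \<in> J) \<noteq> (k \<in> J')"
    unfolding k_def by (rule LeastI_ex [OF ex])
  have "J' \<inter> {..<k} = J \<inter> {..<k}"
    using not_less_Least [of _ "\<lambda>k. (k \<in> J) \<noteq> (k \<in> J')"] unfolding k_def by blast
  then show False
    using cell_code_less [of J N J' k] cell_code_less [of J' N J k] J k eq by auto
qed

lemma cell_code_push_set:
  assumes J: "J \<subseteq> {1..N}" and u: "u \<in> topspace (torus J)"
  shows "u \<in> fat_wedge J \<Longrightarrow> cell_code N (push_set N (cell_map N J u)) < cell_code N J"
    and "u \<notin> fat_wedge J \<Longrightarrow> push_set N (cell_map N J u) = J"
proof -
  have sub: "push_set N x \<subseteq> {1..N}" for x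
    by (auto simp: push_set_def)
  show "push_set N (cell_map N J u) = J" if "u \<notin> fat_wedge J"
  proof -
    have "\<And>k. k \<in> J \<Longrightarrow> u k \<noteq> 1"
      using that u by (auto simp: fat_wedge_def)
    from push_set_cell_map(1) [OF J u order_refl this] show ?thesis
      using J sub by force
  qed
  show "cell_code N (push_set N (cell_map N J u)) < cell_code N J" if wedge: "u \<in> fat_wedge J"
  proof -
    have ex: "\<exists>k. k \<in> J \<and> u k = 1"
      using wedge by (auto simp: fat_wedge_def)
    \<comment> \<open>The first factor equal to 1 decides the comparison of the codes.\<close>
    define k where "k = (LEAST k. k \<in> J \<and> u k = 1)"
    have k: "k \<in> J" "u k = 1"
      using LeastI_ex [OF ex] by (auto simp: k_def)
    have less: "u i \<noteq> 1" if "i \<in> J" "i < k" for i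
      using not_less_Least that unfolding k_def by blast
    obtain m where m: "k = Suc m" "m \<le> N"
      using k(1) J by (cases k) auto
    have *: "{..m} = {..<k}" using m by auto
    note p = push_set_cell_map [OF J u m(2)]
    show ?thesis
    proof (rule cell_code_less [OF J sub k(1)])
      show "k \<notin> push_set N (cell_map N J u)"
        using p(2) less k m by auto
      show "push_set N (cell_map N J u) \<inter> {..<k} = J \<inter> {..<k}"
        using p(1) less m unfolding * [symmetric] by auto
    qed
  qed
qed

text \<open>The filtration is indexed by all numbers rather than by cells: a stage whose number is
  not a code adds nothing, and by injectivity of the codes every other stage attaches exactly one
  torus.\<close>

definition words_below :: "nat \<Rightarrow> nat \<Rightarrow> (nat \<Rightarrow> complex) set" where
  "words_below N c = {x \<in> matched_words N. cell_code N (push_set N x) < c}"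

lemma words_below_Suc:
  assumes J: "J \<in> cells N" "cell_code N J = c"
  shows "words_below N (Suc c) = words_below N c \<union> cell_map N J ` topspace (torus J)"
    and "\<And>u. u \<in> topspace (torus J) \<Longrightarrow> cell_map N J u \<in> words_below N c \<longleftrightarrow> u \<in> fat_wedge J"
proof -
  have sub: "J \<subseteq> {1..N}" using J by (simp add: cells_def)
  note code = cell_code_push_set [OF sub]
  show iff: "cell_map N J u \<in> words_below N c \<longleftrightarrow> u \<in> fat_wedge J" if "u \<in> topspace (torus J)" for u
    using code [OF that] cell_map_matched [OF that J(1)] J(2)
    by (cases "u \<in> fat_wedge J") (auto simp: words_below_def)
  have "x \<in> cell_map N J ` topspace (torus J)" if x: "x \<in> matched_words N" "cell_code N (push_set N x) = c" for x
  proof -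
    obtain u where u: "push_set N x \<in> cells N" "u \<in> topspace (torus (push_set N x))" "cell_map N (push_set N x) u = x"
      using push_set_cell [OF x(1)] .
    have "push_set N x = J"
      using inj_on_cell_code u(1) sub x(2) J(2) by (auto simp: inj_on_def cells_def)
    then show ?thesis using u by (metis image_eqI)
  qed
  moreover have "cell_map N J u \<in> words_below N (Suc c)" if "u \<in> topspace (torus J)" for u
    using code [OF that] cell_map_matched [OF that J(1)] J(2)
    by (cases "u \<in> fat_wedge J") (auto simp: words_below_def)
  ultimately show "words_below N (Suc c) = words_below N c \<union> cell_map N J ` topspace (torus J)"
    by (auto simp: words_below_def less_Suc_eq)
qed

text \<open>Closedness is carried through the induction because an attachment asks for a closed
  subspace; each stage adds the compact image of a torus, or nothing.\<close>

lemma homology_words_below: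
  "closedin (torus {1..N}) (words_below N c) \<and>
   free_of_rank (homology_group p (subtopology (torus {1..N}) (words_below N c)))
     (card {J \<in> cells N. cell_code N J < c \<and> p = int (card J)})"
proof (induction c)
  case 0
  have "words_below N 0 = {}" by (simp add: words_below_def)
  then show ?case
    by (simp add: free_of_rank_trivial trivial_homology_group_empty)
next
  case (Suc c)
  let ?P = "torus {1..N}" and ?r = "card {J \<in> cells N. cell_code N J < c \<and> p = int (card J)}"
  let ?Z = "subtopology ?P (words_below N (Suc c))"
  have fin: "finite {J \<in> cells N. Q J}" for Q
    by (rule finite_subset [of _ "Pow {1..N}"]) (auto simp: cells_def)
  show ?case
  proof (cases "\<exists>J\<in>cells N. cell_code N J = c")
    case False
    then have "{J \<in> cells N. cell_code N J < Suc c \<and> p = int (card J)} = {J \<in> cells N. cell_code N J < c \<and> p = int (card J)}"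
      by (auto simp: less_Suc_eq)
    moreover have "words_below N (Suc c) = words_below N c"
    proof -
      have "cell_code N (push_set N x) \<noteq> c" if "x \<in> matched_words N" for x
        using False push_set_cell [OF that] by metis
      then show ?thesis by (auto simp: words_below_def less_Suc_eq)
    qed
    ultimately show ?thesis
      using Suc by simp
  next
    case True
    then obtain J where J: "J \<in> cells N" "cell_code N J = c" by blast
    then have sub: "J \<subseteq> {1..N}" by (simp add: cells_def)
    then have finJ: "finite J" by (rule finite_subset) simp
    have uniq: "J' = J" if "J' \<in> cells N" "cell_code N J' = c" for J'
      using inj_on_cell_code that J by (auto simp: inj_on_def cells_def)
    let ?\<phi> = "cell_map N J"
    have closed_img: "closedin ?P (?\<phi> ` topspace (torus J))"
      using continuous_imp_closed_map [OF continuous_map_cell_map compact_space_torus Hausdorff_space_torus]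
      by (auto simp: closed_map_def)
    have closed: "closedin ?P (words_below N (Suc c))"
      unfolding words_below_Suc(1) [OF J] using Suc closed_img by (intro closedin_Un) auto
    have sub_below: "words_below N c \<subseteq> words_below N (Suc c)"
      by (auto simp: words_below_def)
    have top: "topspace ?Z = words_below N (Suc c)"
      using closedin_subset [OF closed] by auto
    have sub_Z: "subtopology ?Z (words_below N c) = subtopology ?P (words_below N c)"
      using sub_below by (simp add: subtopology_subtopology inf.absorb2)
    have cont: "continuous_map (torus J) ?Z ?\<phi>"
      using continuous_map_cell_map [of J N] words_below_Suc(1) [OF J]
      by (auto simp: continuous_map_in_subtopology)
    have "free_of_rank (homology_group p ?Z)
      (if p = int (card J) then Suc ?r else ?r)"
    proof (rule torus_attachment_rank [OF finJ _ cont inj_on_cell_map [OF sub]])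
      show "Hausdorff_space ?Z"
        by (simp add: Hausdorff_space_subtopology Hausdorff_space_torus)
      show "closedin ?Z (words_below N c)"
        using Suc sub_below by (simp add: closedin_subset_topspace)
      show "topspace ?Z = words_below N c \<union> ?\<phi> ` topspace (torus J)"
        unfolding top by (rule words_below_Suc(1) [OF J])
      show "?\<phi> u \<in> words_below N c \<longleftrightarrow> u \<in> fat_wedge J" if "u \<in> topspace (torus J)" for u
        by (rule words_below_Suc(2) [OF J that])
      show "free_of_rank (homology_group p (subtopology ?Z (words_below N c))) ?r"
        unfolding sub_Z using Suc by blast
    qed
    moreover have "{J' \<in> cells N. cell_code N J' < Suc c \<and> p = int (card J')} =
      (if p = int (card J) then insert J {J \<in> cells N. cell_code N J < c \<and> p = int (card J)}
       else {J \<in> cells N. cell_code N J < c \<and> p = int (card J)})"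
    proof -
      have "cell_code N J' < Suc c \<longleftrightarrow> J' = J \<or> cell_code N J' < c" if "J' \<in> cells N" for J'
        using uniq [OF that] J(2) by (metis less_Suc_eq)
      then have "{J' \<in> cells N. cell_code N J' < Suc c \<and> p = int (card J')}
        = {J' \<in> cells N. (J' = J \<or> cell_code N J' < c) \<and> p = int (card J')}"
        by blast
      then show ?thesis using J(1) by auto
    qed
    then have "card {J' \<in> cells N. cell_code N J' < Suc c \<and> p = int (card J')} =
      (if p = int (card J) then Suc ?r else ?r)"
      using fin J by (simp add: card_insert_if)
    ultimately show ?thesis
      using closed by simp
  qed
qed

lemma homology_T_tilde:
  "free_of_rank (homology_group p (T_tilde n)) (card {J \<in> cells (2 * n). p = int (card J)})"
proof -
  let ?N = "2 * n"
  obtain c where c: "\<And>J. J \<subseteq> {1..?N} \<Longrightarrow> cell_code ?N J < c"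
  proof
    fix J assume "J \<subseteq> {1..?N}"
    then have "cell_code ?N J \<in> cell_code ?N ` Pow {1..?N}"
      by blast
    then show "cell_code ?N J < Suc (Max (cell_code ?N ` Pow {1..?N}))"
      by (auto simp: less_Suc_eq_le)
  qed
  have "words_below ?N c = matched_words ?N"
  proof -
    have "push_set ?N x \<subseteq> {1..?N}" for x by (auto simp: push_set_def)
    then show ?thesis using c by (auto simp: words_below_def)
  qed
  moreover have "{J \<in> cells ?N. cell_code ?N J < c \<and> p = int (card J)} = {J \<in> cells ?N. p = int (card J)}"
    using c by (auto simp: cells_def)
  ultimately show ?thesis
    using homology_words_below [of ?N c p] by (simp add: T_tilde_eq)
qed

section \<open>Counting the cells by reflected walks\<close>

lemma height_cong: "\<lbrakk>\<And>k. k \<in> {1..m} \<Longrightarrow> k \<in> J \<longleftrightarrow> k \<in> J'\<rbrakk> \<Longrightarrow> height J m = height J' m"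
  by (induction m) auto

definition height_count :: "nat \<Rightarrow> nat \<Rightarrow> nat" where
  "height_count m h = card {J. J \<subseteq> {1..m} \<and> height J m = h}"

text \<open>The sets are split by the last step of the walk. The middle term is the second way of
  leaving height 0, by a position outside \<open>J\<close>.\<close>

lemma height_count_Suc:
  "height_count (Suc m) h =
    (if h = 0 then 0 else height_count m (h - 1)) + (if h = 1 then height_count m 0 else 0) + height_count m (Suc h)"
proof -
  let ?A = "{J. J \<subseteq> {1..m} \<and> h \<noteq> 0 \<and> height J m = h - 1}"
  let ?B = "{J. J \<subseteq> {1..m} \<and> h = 1 \<and> height J m = 0}"
  let ?C = "{J. J \<subseteq> {1..m} \<and> height J m = Suc h}"
  have fin: "finite {J. J \<subseteq> {1..m} \<and> Q J}" for Q
    by (rule finite_subset [of _ "Pow {1..m}"]) auto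
  have "{J. J \<subseteq> {1..Suc m} \<and> height J (Suc m) = h} = insert (Suc m) ` ?A \<union> (?B \<union> ?C)" (is "?L = ?R")
  proof (rule Set.set_eqI)
    fix J
    show "J \<in> ?L \<longleftrightarrow> J \<in> ?R"
    proof (cases "Suc m \<in> J")
      case True
      have 1: "J = insert (Suc m) (J - {Suc m})" using True by blast
      have "{1..Suc m} = insert (Suc m) {1..m}"
        by auto
      then have 2: "J \<subseteq> {1..Suc m} \<longleftrightarrow> J - {Suc m} \<subseteq> {1..m}"
        by blast
      have 3: "height J m = height (J - {Suc m}) m"
        by (rule height_cong) auto
      have "J \<in> insert (Suc m) ` ?A \<longleftrightarrow> J - {Suc m} \<in> ?A"
      proof
        assume "J \<in> insert (Suc m) ` ?A"
        then obtain J' where "J = insert (Suc m) J'" "J' \<in> ?A" by blast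
        moreover from this have "J - {Suc m} = J'" by auto
        ultimately show "J - {Suc m} \<in> ?A" by simp
      qed (use 1 in blast)
      moreover have "J \<notin> ?B \<union> ?C" using True by auto
      moreover have "height J (Suc m) = Suc (height (J - {Suc m}) m)"
        using True 3 by simp
      then have "J \<in> ?L \<longleftrightarrow> J - {Suc m} \<in> ?A"
        unfolding mem_Collect_eq 2 by (cases h) simp_all
      ultimately show ?thesis
        by blast
    next
      case False
      then have "J \<subseteq> {1..Suc m} \<longleftrightarrow> J \<subseteq> {1..m}"
        by (auto simp: le_Suc_eq)
      then show ?thesis
        using False by auto
    qed
  qed
  then have "height_count (Suc m) h = card (insert (Suc m) ` ?A \<union> (?B \<union> ?C))"
    by (simp add: height_count_def)
  also have "\<dots> = card (insert (Suc m) ` ?A) + card (?B \<union> ?C)"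
    using fin by (intro card_Un_disjoint) auto
  also have "card (?B \<union> ?C) = card ?B + card ?C"
    using fin by (intro card_Un_disjoint) auto
  also have "card (insert (Suc m) ` ?A) = card ?A"
    by (intro card_image inj_on_inverseI [where g = "\<lambda>J. J - {Suc m}"]) auto
  finally show ?thesis
    by (simp add: height_count_def)
qed

text \<open>The recursion is that of the absolute value of a simple walk on the integers, which also
  leaves 0 in two ways. A value \<open>h > 0\<close> comes from the two end points \<open>h\<close>
  and \<open>- h\<close>, whence the factor 2.\<close>

lemma height_count_eq:
  "height_count m h = (if even (m + h) then (if h = 0 then 1 else 2) * (m choose ((m + h) div 2)) else 0)"
proof (induction m arbitrary: h)
  case 0
  have "{J. J \<subseteq> {1..0::nat} \<and> height J 0 = h} = (if h = 0 then {{}} else {})"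
    by auto
  then have "height_count 0 h = (if h = 0 then 1 else 0)"
    unfolding height_count_def by simp
  then show ?case
    by (auto elim: evenE)
next
  case (Suc m)
  show ?case
  proof (cases "even (Suc m + h)")
    case False
    then show ?thesis
      unfolding height_count_Suc Suc.IH by auto
  next
    case True
    then obtain j where j: "Suc m + h = 2 * j" by (elim evenE)
    then obtain i where i: "j = Suc i" by (cases j) auto
    consider "h = 0" | "h = 1" | "h \<ge> 2" by linarith
    then show ?thesis
    proof cases
      case 1
      have "m = 2 * i + 1" using 1 j i by simp
      \<comment> \<open>Height 0 is reached from height 1 only, whose count carries the factor 2; by
        symmetry of the odd row this doubled coefficient is the sum in Pascal's rule.\<close>
      then have "2 * (m choose Suc i) = Suc m choose Suc i"
        using binomial_symmetric [of i m] by simp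
      then show ?thesis
        unfolding height_count_Suc Suc.IH using 1 j i by simp
    next
      case 2
      have "m = 2 * i" using 2 j i by simp
      then show ?thesis
        unfolding height_count_Suc Suc.IH using 2 j i by simp
    next
      case 3
      then have "m + (h - 1) = 2 * i" "m + Suc h = 2 * Suc i" "Suc m + h = 2 * Suc i" "h \<noteq> 0" "h \<noteq> 1" "h - 1 \<noteq> 0"
        using j i by auto
      then show ?thesis
        unfolding height_count_Suc Suc.IH by (simp del: mult_Suc_right)
    qed
  qed
qed

lemma card_cells: "card (cells (2 * n)) = (2 * n) choose n"
  using height_count_eq [of "2 * n" 0] by (simp add: height_count_def cells_def)

section \<open>Cohomology of spaces with free homology\<close>

lemma int_subgroup_generator:
  fixes A :: "int set"
  assumes "0 \<in> A" and diff: "\<And>x y. \<lbrakk>x \<in> A; y \<in> A\<rbrakk> \<Longrightarrow> x - y \<in> A"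
  shows "\<exists>g\<in>A. \<forall>x\<in>A. g dvd x"
proof (cases "A = {0}")
  case True
  then show ?thesis by simp
next
  case False
  have neg: "- x \<in> A" if "x \<in> A" for x
    using diff [OF assms(1) that] by simp
  then have add: "x + y \<in> A" if "x \<in> A" "y \<in> A" for x y
    using diff [of x "- y"] that by simp
  have mult_nat: "int m * x \<in> A" if "x \<in> A" for m x
    using that assms(1) add by (induction m) (auto simp: algebra_simps)
  have mult: "k * x \<in> A" if "x \<in> A" for k x
    using mult_nat [OF that, of "nat k"] mult_nat [OF neg [OF that], of "nat (- k)"]
    by (cases "k \<ge> 0") auto
  obtain x where "x \<in> A" "x \<noteq> 0" using False assms(1) by auto
  then have "\<exists>n. 0 < n \<and> int n \<in> A"
    using neg by (intro exI [of _ "nat \<bar>x\<bar>"]) (auto simp: abs_if)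
  then obtain n where n: "0 < n" "int n \<in> A" and least: "\<And>k. k < n \<Longrightarrow> \<not> (0 < k \<and> int k \<in> A)"
    using exists_least_iff [of "\<lambda>n. 0 < n \<and> int n \<in> A"] by blast
  have "int n dvd y" if y: "y \<in> A" for y
  proof -
    have "y mod int n = y - (y div int n) * int n"
      by (simp add: minus_div_mult_eq_mod)
    then have "y mod int n \<in> A"
      using diff [OF y mult [OF n(2)]] by metis
    moreover have "0 \<le> y mod int n" "y mod int n < int n"
      using n by auto
    ultimately have "y mod int n = 0"
      using least [of "nat (y mod int n)"] by (cases "y mod int n = 0") (auto simp: nat_less_iff)
    then show ?thesis by auto
  qed
  with n show ?thesis by blast
qed

text \<open>A subgroup of a free abelian group is free, whence any homomorphism onto it splits: a basis is obtained by
  well-ordering the generators and choosing for each of them an element of the subgroup with that leading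
  generator and a minimal leading coefficient.\<close>

lemma free_subgroup_section:
  fixes d :: "('t \<Rightarrow>\<^sub>0 int) \<Rightarrow> ('s \<Rightarrow>\<^sub>0 int)"
  assumes C0: "0 \<in> C" and Cdiff: "\<And>x y. \<lbrakk>x \<in> C; y \<in> C\<rbrakk> \<Longrightarrow> x - y \<in> C"
    and d: "\<And>x y. \<lbrakk>x \<in> C; y \<in> C\<rbrakk> \<Longrightarrow> d (x - y) = d x - d y"
  obtains \<sigma> where "\<And>b. b \<in> d ` C \<Longrightarrow> \<sigma> b \<in> C \<and> d (\<sigma> b) = b"
    "\<And>b b'. \<lbrakk>b \<in> d ` C; b' \<in> d ` C\<rbrakk> \<Longrightarrow> \<sigma> (b + b') = \<sigma> b + \<sigma> b'"
proof -
  define B where "B = d ` C"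
  have B0: "0 \<in> B"
    using d [OF C0 C0] C0 by (force simp: B_def)
  have Bdiff: "x - y \<in> B" if xy: "x \<in> B" "y \<in> B" for x y
  proof -
    obtain u v where uv: "u \<in> C" "v \<in> C" "x = d u" "y = d v"
      using xy by (auto simp: B_def)
    then have "x - y = d (u - v)"
      by (simp add: d)
    then show ?thesis
      using Cdiff uv by (simp add: B_def)
  qed
  obtain r :: "'s rel" where r: "well_order_on UNIV r"
    using well_order_on by blast
  have r_refl: "(s, s) \<in> r" for s
    using well_order_on_domain r by (auto simp: well_order_on_def linear_order_on_def partial_order_on_def
        preorder_on_def refl_on_def)
  have r_tot: "(s, t) \<in> r \<or> (t, s) \<in> r" for s t
    using r r_refl by (cases "s = t") (auto simp: well_order_on_def linear_order_on_def total_on_def)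
  have r_anti: "s = t" if "(s, t) \<in> r" "(t, s) \<in> r" for s t
    using r that by (auto simp: well_order_on_def linear_order_on_def partial_order_on_def dest: antisymD)
  have r_trans: "(s, u) \<in> r" if "(s, t) \<in> r" "(t, u) \<in> r" for s t u
    using r that
    by (auto simp: well_order_on_def linear_order_on_def partial_order_on_def preorder_on_def dest: transD)
  have wf: "wf (r - Id)"
    using r by (simp add: well_order_on_def)
  have maximal: "\<exists>m\<in>A. \<forall>a\<in>A. (a, m) \<in> r" if "finite A" "A \<noteq> {}" for A
    using that
  proof (induction A rule: finite_ne_induct)
    case (insert x A)
    then obtain m where "m \<in> A" "\<forall>a\<in>A. (a, m) \<in> r" by blast
    then show ?case
      using r_tot [of x m] r_trans r_refl by blast
  qed (use r_refl in auto)
  \<comment> \<open>Every generator occurring in \<open>b\<close> is at most \<open>s\<close>, so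
    the coefficient at \<open>s\<close> is the leading one or 0.\<close>
  define bounded where "bounded s b \<longleftrightarrow> (\<forall>t\<in>Poly_Mapping.keys b. (t, s) \<in> r)" for s and b :: "'s \<Rightarrow>\<^sub>0 int"
  have "\<exists>h. h \<in> B \<and> bounded s h \<and> (\<forall>b\<in>B. bounded s b \<longrightarrow> Poly_Mapping.lookup h s dvd Poly_Mapping.lookup b s)" for s
  proof -
    \<comment> \<open>These coefficients form a subgroup of the integers; an element of
      \<open>B\<close> attaining a generator of it is the candidate for the basis element at
      \<open>s\<close>.\<close>
    let ?A = "(\<lambda>b. Poly_Mapping.lookup b s) ` {b \<in> B. bounded s b}"
    have bdiff: "bounded s (x - y)" if "bounded s x" "bounded s y" for x y
      using that keys_diff [of x y] by (auto simp: bounded_def)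
    then have Adiff: "x - y \<in> ?A" if xy: "x \<in> ?A" "y \<in> ?A" for x y
    proof -
      obtain b c where "b \<in> B" "bounded s b" "x = Poly_Mapping.lookup b s"
        "c \<in> B" "bounded s c" "y = Poly_Mapping.lookup c s"
        using xy by blast
      moreover from this have "b - c \<in> B" "bounded s (b - c)"
        using Bdiff bdiff by auto
      ultimately show ?thesis
        by (auto simp: lookup_minus intro!: image_eqI [of _ _ "b - c"])
    qed
    have A0: "0 \<in> ?A"
      using B0 by (intro image_eqI [of _ _ 0]) (auto simp: bounded_def)
    obtain g where g: "g \<in> ?A" "\<forall>x\<in>?A. g dvd x"
      using int_subgroup_generator [OF A0 Adiff] by blast
    then obtain b where b: "b \<in> B" "bounded s b" "g = Poly_Mapping.lookup b s"
      by blast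
    show ?thesis
    proof (intro exI [of _ b] conjI ballI impI)
      show "Poly_Mapping.lookup b s dvd Poly_Mapping.lookup c s" if "c \<in> B" "bounded s c" for c
        using bspec [OF g(2), of "Poly_Mapping.lookup c s"] that b(3) by blast
    qed (use b in auto)
  qed
  then obtain h where hB: "\<And>s. h s \<in> B" and hb: "\<And>s. bounded s (h s)"
    and hdvd: "\<And>s b. \<lbrakk>b \<in> B; bounded s b\<rbrakk> \<Longrightarrow> Poly_Mapping.lookup (h s) s dvd Poly_Mapping.lookup b s"
    by metis
  define S where "S = {s. Poly_Mapping.lookup (h s) s \<noteq> 0}"
  have Bcmul: "frag_cmul k b \<in> B" if "b \<in> B" for k b
  proof -
    show ?thesis
      by (rule frag_closure_minus_cmul [of "\<lambda>b. b \<in> B"]) (auto intro: B0 Bdiff that)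
  qed
  have span_bounded: "\<exists>k. Poly_Mapping.keys k \<subseteq> S \<and> frag_extend h k = b" if "b \<in> B" "bounded s b" for s b
    using wf that
  proof (induction s arbitrary: b)
    case (less s)
    obtain q where q: "Poly_Mapping.lookup b s = Poly_Mapping.lookup (h s) s * q"
      using hdvd [OF less.prems] by (elim dvdE)
    \<comment> \<open>Outside \<open>S\<close> the divisor is 0 and so is the coefficient of
      \<open>b\<close>, whatever the quotient; choosing 0 keeps the support inside
      \<open>S\<close>.\<close>
    define q' where "q' = (if s \<in> S then q else 0)"
    define b' where "b' = b - frag_cmul q' (h s)"
    have b'B: "b' \<in> B"
      unfolding b'_def using less.prems Bcmul hB Bdiff by blast
    have "Poly_Mapping.lookup b' s = 0"
      using q by (auto simp: b'_def q'_def S_def lookup_minus)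
    then have s: "s \<notin> Poly_Mapping.keys b'"
      by (simp add: in_keys_iff)
    have b'b: "bounded s b'"
      using keys_diff [of b "frag_cmul q' (h s)"] less.prems(2) hb [of s] keys_cmul
      by (fastforce simp: bounded_def b'_def)
    have "\<exists>k. Poly_Mapping.keys k \<subseteq> S \<and> frag_extend h k = b'"
    proof (cases "b' = 0")
      case True
      then show ?thesis by (intro exI [of _ 0]) auto
    next
      case False
      then obtain m where m: "m \<in> Poly_Mapping.keys b'" "bounded m b'"
        using maximal [of "Poly_Mapping.keys b'"] by (auto simp: bounded_def)
      then have "(m, s) \<in> r - Id"
        using b'b s by (auto simp: bounded_def)
      then show ?thesis
        using less.IH b'B m(2) by blast
    qed
    then obtain k where k: "Poly_Mapping.keys k \<subseteq> S" "frag_extend h k = b'" by blast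
    show ?case
    proof (intro exI conjI)
      show "Poly_Mapping.keys (k + frag_cmul q' (frag_of s)) \<subseteq> S"
        using k(1) keys_add [of k "frag_cmul q' (frag_of s)"] by (auto simp: q'_def split: if_splits)
      show "frag_extend h (k + frag_cmul q' (frag_of s)) = b"
        by (simp add: frag_extend_add frag_extend_cmul k(2) b'_def)
    qed
  qed
  have span: "\<exists>k. Poly_Mapping.keys k \<subseteq> S \<and> frag_extend h k = b" if "b \<in> B" for b
  proof (cases "b = 0")
    case True
    then show ?thesis by (intro exI [of _ 0]) auto
  next
    case False
    then obtain m where "bounded m b"
      using maximal [of "Poly_Mapping.keys b"] by (auto simp: bounded_def)
    then show ?thesis using span_bounded that by blast
  qed
  have indep: "k = 0" if k: "Poly_Mapping.keys k \<subseteq> S" "frag_extend h k = 0" for k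
  proof (rule ccontr)
    assume "k \<noteq> 0"
    then obtain m where m: "m \<in> Poly_Mapping.keys k" "\<forall>t\<in>Poly_Mapping.keys k. (t, m) \<in> r"
      using maximal [of "Poly_Mapping.keys k"] by auto
    \<comment> \<open>At the largest index \<open>m\<close> of \<open>k\<close> only
      \<open>h m\<close> contributes, because \<open>h i\<close> has no term above
      \<open>i\<close>.\<close>
    have "Poly_Mapping.lookup (h i) m = 0" if "i \<in> Poly_Mapping.keys k" "i \<noteq> m" for i
    proof (rule ccontr)
      assume "Poly_Mapping.lookup (h i) m \<noteq> 0"
      then have "(m, i) \<in> r"
        using hb [of i] by (auto simp: bounded_def in_keys_iff)
      then show False
        using m(2) that r_anti by blast
    qed
    then have "Poly_Mapping.lookup (frag_extend h k) m
        = (\<Sum>i\<in>{m}. Poly_Mapping.lookup k i * Poly_Mapping.lookup (h i) m)"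
      unfolding frag_extend_def lookup_sum lookup_frag_cmul
      using m(1) by (intro sum.mono_neutral_right) auto
    moreover have "Poly_Mapping.lookup k m \<noteq> 0" "Poly_Mapping.lookup (h m) m \<noteq> 0"
      using m(1) k(1) by (auto simp: in_keys_iff S_def)
    ultimately show False
      using k(2) by simp
  qed
  \<comment> \<open>Independence makes these coordinates unique and therefore additive; lifting the
    basis elements through \<open>d\<close> then gives an additive section.\<close>
  define coord where "coord b = (SOME k. Poly_Mapping.keys k \<subseteq> S \<and> frag_extend h k = b)" for b
  have coord: "Poly_Mapping.keys (coord b) \<subseteq> S" "frag_extend h (coord b) = b" if "b \<in> B" for b
    using someI_ex [OF span [OF that]] by (auto simp: coord_def)
  obtain c where c: "\<And>s. c s \<in> C" "\<And>s. d (c s) = h s"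
  proof -
    have "\<exists>x. x \<in> C \<and> d x = h s" for s
      using hB [of s] unfolding B_def by (elim imageE) auto
    then have "\<exists>c. \<forall>s. c s \<in> C \<and> d (c s) = h s"
      by (intro choice allI)
    then show thesis
      using that by blast
  qed
  have dc: "frag_extend c k \<in> C \<and> d (frag_extend c k) = frag_extend h k" for k
  proof -
    have "Poly_Mapping.keys k \<subseteq> UNIV" by simp
    then show ?thesis
    proof (induction k rule: frag_induction)
      case zero
      then show ?case using C0 d [OF C0 C0] by simp
    qed (auto simp: c frag_extend_diff Cdiff d)
  qed
  show ?thesis
  proof
    show "frag_extend c (coord b) \<in> C \<and> d (frag_extend c (coord b)) = b" if "b \<in> d ` C" for b
      using dc [of "coord b"] coord(2) [of b] that by (simp add: B_def)
    show "frag_extend c (coord (b + b')) = frag_extend c (coord b) + frag_extend c (coord b')"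
      if "b \<in> d ` C" "b' \<in> d ` C" for b b'
    proof -
      have b: "b \<in> B" "b' \<in> B" using that by (auto simp: B_def)
      then have bb: "b + b' \<in> B"
        using Bdiff [OF b(1) Bdiff [OF B0 b(2)]] by simp
      let ?k = "coord (b + b') - (coord b + coord b')"
      have "Poly_Mapping.keys ?k \<subseteq> S"
        using coord(1) [OF bb] coord(1) [OF b(1)] coord(1) [OF b(2)]
          keys_diff [of "coord (b + b')" "coord b + coord b'"] keys_add [of "coord b" "coord b'"] by blast
      moreover have "frag_extend h ?k = 0"
        using coord(2) [OF bb] coord(2) [OF b(1)] coord(2) [OF b(2)]
        by (simp add: frag_extend_diff frag_extend_add)
      ultimately have "?k = 0"
        by (rule indep)
      then have "coord (b + b') = coord b + coord b'"
        by (simp only: right_minus_eq)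
      then show ?thesis by (simp add: frag_extend_add)
    qed
  qed
qed

section \<open>Extending homomorphisms from cycles and boundaries to chains\<close>

lemma cochain_apply_add:
  "\<lbrakk>f \<in> carrier (cochain_group p X); singular_chain p X c; singular_chain p X c'\<rbrakk> \<Longrightarrow> f (c + c') = f c + f c'"
  by (auto simp: cochain_group_def hom_def)

lemma cochainI:
  assumes "\<And>c c'. \<lbrakk>singular_chain p X c; singular_chain p X c'\<rbrakk> \<Longrightarrow> f (c + c') = f c + f c'"
  shows "(\<lambda>c\<in>carrier (chain_group p X). f c) \<in> carrier (cochain_group p X)"
  using assms by (auto simp: cochain_group_def hom_def singular_chain_add)

abbreviation cycle :: "nat \<Rightarrow> 'a topology \<Rightarrow> 'a chain \<Rightarrow> bool" where
  "cycle p X c \<equiv> singular_relcycle p X {} c"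

text \<open>Chains modulo cycles are isomorphic to boundaries, a subgroup of a free abelian group.
  Hence cycles are a direct summand of the chains, and a homomorphism on them is extended by
  composing it with the projection \<open>\<pi>\<close>.\<close>

lemma extend_cycle_hom:
  assumes \<phi>: "\<And>c c'. \<lbrakk>cycle p X c; cycle p X c'\<rbrakk> \<Longrightarrow> \<phi> (c + c') = \<phi> c + \<phi> c' "
  obtains f :: "'a chain \<Rightarrow> int" where "f \<in> carrier (cochain_group p X)" "\<And>c. cycle p X c \<Longrightarrow> f c = \<phi> c"
proof (cases p)
  case 0
  \<comment> \<open>The boundary map is 0 in degree 0, so every chain is a cycle there.\<close>
  then have cyc: "cycle p X c \<longleftrightarrow> singular_chain p X c" for c
    by (simp add: singular_cycle chain_boundary_def)
  then show ?thesis
    using that [OF cochainI, of \<phi>] \<phi> by auto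
next
  case (Suc q)
  let ?C = "{c. singular_chain p X c}"
  obtain \<sigma> where \<sigma>: "\<And>b. b \<in> chain_boundary p ` ?C \<Longrightarrow> \<sigma> b \<in> ?C \<and> chain_boundary p (\<sigma> b) = b"
    "\<And>b b'. \<lbrakk>b \<in> chain_boundary p ` ?C; b' \<in> chain_boundary p ` ?C\<rbrakk> \<Longrightarrow> \<sigma> (b + b') = \<sigma> b + \<sigma> b'"
  proof (rule free_subgroup_section [of ?C "chain_boundary p"])
    show "0 \<in> ?C" by simp
    show "x - y \<in> ?C" if "x \<in> ?C" "y \<in> ?C" for x y
      using that by (simp add: singular_chain_diff)
    show "chain_boundary p (x - y) = chain_boundary p x - chain_boundary p y" for x y
      by (rule chain_boundary_diff)
  qed (rule that)
  define \<pi> where "\<pi> c = c - \<sigma> (chain_boundary p c)" for c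
  have \<pi>: "cycle p X (\<pi> c)" if "singular_chain p X c" for c
    using \<sigma>(1) [of "chain_boundary p c"] that
    by (simp add: singular_cycle \<pi>_def singular_chain_diff chain_boundary_diff)
  have \<pi>_add: "\<pi> (c + c') = \<pi> c + \<pi> c'" if "singular_chain p X c" "singular_chain p X c'" for c c'
    using that by (simp add: \<pi>_def chain_boundary_add \<sigma>(2))
  have "\<sigma> 0 = 0"
    using \<sigma>(2) [of 0 0] singular_chain_0 by (force simp: image_iff)
  then have \<pi>_id: "\<pi> c = c" if "cycle p X c" for c
    using that by (simp add: \<pi>_def singular_cycle)
  show ?thesis
  proof (rule that)
    show "(\<lambda>c\<in>carrier (chain_group p X). \<phi> (\<pi> c)) \<in> carrier (cochain_group p X)"
      by (rule cochainI) (simp add: \<pi>_add \<phi> \<pi>)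
    show "(\<lambda>c\<in>carrier (chain_group p X). \<phi> (\<pi> c)) c = \<phi> c" if "cycle p X c" for c
      using that \<pi>_id by (simp add: singular_cycle)
  qed
qed

text \<open>Homology classes are replaced by integer coordinates of cycles and a dual family of
  cycles, so that later arguments stay on the level of chains. Having a cycle \<open>z i\<close> for
  every \<open>i\<close> avoids bounds in sums.\<close>

lemma cycle_coordinates:
  assumes "free_of_rank (homology_group (int p) X) r"
  obtains \<kappa> :: "'a chain \<Rightarrow> nat \<Rightarrow> int" and z :: "nat \<Rightarrow> 'a chain" where
    "\<And>c c' i. \<lbrakk>cycle p X c; cycle p X c'\<rbrakk> \<Longrightarrow> \<kappa> (c + c') i = \<kappa> c i + \<kappa> c' i"
    "\<And>c. cycle p X c \<Longrightarrow> singular_relboundary p X {} c \<longleftrightarrow> (\<forall>i<r. \<kappa> c i = 0)"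
    "\<And>i. cycle p X (z i)"
    "\<And>i j. \<lbrakk>i < r; j < r\<rbrakk> \<Longrightarrow> \<kappa> (z i) j = (if i = j then 1 else 0)"
proof -
  obtain \<gamma> where \<gamma>: "\<gamma> \<in> iso (homology_group (int p) X) (int_functions {..<r})"
    using assms by (auto simp: free_of_rank_def)
  define \<kappa> where "\<kappa> c = \<gamma> (homologous_rel_set p X {} c)" for c
  have H: "homologous_rel_set p X {} c \<in> carrier (homology_group (int p) X)" if "cycle p X c" for c
    using that by (auto simp: carrier_relative_homology_group)
  have bij: "bij_betw \<gamma> (carrier (homology_group (int p) X)) (carrier (int_functions {..<r}))"
    and hom: "\<gamma> \<in> hom (homology_group (int p) X) (int_functions {..<r})"
    using \<gamma> by (auto simp: iso_def)
  have add: "\<kappa> (c + c') = (\<lambda>i. \<kappa> c i + \<kappa> c' i)" if c: "cycle p X c" "cycle p X c'" for c c'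
  proof -
    have "homologous_rel_set p X {} (c + c') = homologous_rel_set p X {} c \<otimes>\<^bsub>homology_group (int p) X\<^esub> homologous_rel_set p X {} c'"
      using hom_mult [OF normal.r_coset_hom_Mod [OF normal_subgroup_singular_relboundary_relcycle], of c p X "{}" c'] c
      by (simp add: nontrivial_relative_homology_group right_coset_singular_relboundary)
    then show ?thesis
      using hom_mult [OF hom H [OF c(1)] H [OF c(2)]] by (simp add: \<kappa>_def)
  qed
  have one: "\<gamma> \<one>\<^bsub>homology_group (int p) X\<^esub> = (\<lambda>_. 0)"
    using hom_one [OF hom] by simp
  have zero: "singular_relboundary p X {} c \<longleftrightarrow> \<kappa> c = (\<lambda>_. 0)" if c: "cycle p X c" for c
  proof -
    have "singular_relboundary p X {} c \<longleftrightarrow> homologous_rel_set p X {} c = \<one>\<^bsub>homology_group (int p) X\<^esub>"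
      by (simp add: homologous_rel_set_eq_relboundary)
    also have "\<dots> \<longleftrightarrow> \<gamma> (homologous_rel_set p X {} c) = \<gamma> \<one>\<^bsub>homology_group (int p) X\<^esub>"
      using bij_betw_imp_inj_on [OF bij] H [OF c]
      by (metis group.is_monoid group_relative_homology_group inj_onD monoid.one_closed)
    finally show ?thesis
      by (simp only: one \<kappa>_def)
  qed
  have out: "\<kappa> c i = 0" if "cycle p X c" "\<not> i < r" for c i
    using bij_betwE [OF bij] H [OF that(1)] that(2) by (auto simp: \<kappa>_def)
  have "\<exists>z. cycle p X z \<and> (\<forall>j<r. \<kappa> z j = (if i = j then 1 else 0))" for i
  proof -
    let ?v = "\<lambda>j. if j < r \<and> i = j then 1 else 0"
    have "?v \<in> carrier (int_functions {..<r})" by auto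
    then have "?v \<in> \<gamma> ` carrier (homology_group (int p) X)"
      using bij_betw_imp_surj_on [OF bij] by metis
    then obtain z where "cycle p X z" "\<kappa> z = ?v"
      by (auto simp: carrier_relative_homology_group \<kappa>_def)
    then show ?thesis by (intro exI [of _ z]) auto
  qed
  then obtain z where z: "\<And>i. cycle p X (z i)" "\<And>i j. j < r \<Longrightarrow> \<kappa> (z i) j = (if i = j then 1 else 0)"
    by metis
  show ?thesis
  proof (rule that [of \<kappa> z])
    show "singular_relboundary p X {} c \<longleftrightarrow> (\<forall>i<r. \<kappa> c i = 0)" if "cycle p X c" for c
      using zero [OF that] out [OF that] by (auto simp: fun_eq_iff)
  qed (use add z in auto)
qed

lemma additive_combination:
  fixes f :: "'a chain \<Rightarrow> int"
  assumes f: "\<And>c c'. \<lbrakk>cycle p X c; cycle p X c'\<rbrakk> \<Longrightarrow> f (c + c') = f c + f c'"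
    and z: "\<And>i. cycle p X (z i)" and "finite I"
  shows "cycle p X (\<Sum>i\<in>I. frag_cmul (a i) (z i)) \<and> f (\<Sum>i\<in>I. frag_cmul (a i) (z i)) = (\<Sum>i\<in>I. a i * f (z i))"
proof -
  have f0: "f 0 = 0" using f [of 0 0] by simp
  have neg: "f (- c) = - f c" "cycle p X (- c)" if "cycle p X c" for c
    using f [of c "- c"] that f0 by (auto simp: singular_relcycle_minus)
  have nat: "cycle p X (frag_cmul (int m) c) \<and> f (frag_cmul (int m) c) = int m * f c"
    if "cycle p X c" for m c
  proof (induction m)
    case (Suc m)
    then show ?case
      using that by (simp add: frag_cmul_distrib singular_relcycle_add f algebra_simps)
  qed (simp add: f0)
  have cmul: "cycle p X (frag_cmul k c) \<and> f (frag_cmul k c) = k * f c" if "cycle p X c" for k c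
  proof (cases "k \<ge> 0")
    case True
    then show ?thesis using nat [OF that, of "nat k"] by simp
  next
    case False
    have "frag_cmul (- k) (- c) = frag_cmul k c"
      by (simp flip: frag_cmul_minus_one)
    then show ?thesis
      using nat [OF neg(2) [OF that], of "nat (- k)"] neg(1) [OF that] False by simp
  qed
  show ?thesis
    using \<open>finite I\<close>
  proof (induction I rule: finite_induct)
    case (insert i I)
    then show ?case using cmul [OF z] by (auto simp: singular_relcycle_add f)
  qed (simp add: f0)
qed

text \<open>Free homology makes the boundaries split off the cycles: subtracting from
  \<open>c\<close> the combination of the \<open>z i\<close> with the coordinates of
  \<open>c\<close> leaves a cycle with zero coordinates. This expresses the vanishing of Ext of the
  homology with values in the integers.\<close>

lemma extend_boundary_hom:
  fixes X :: "'a topology"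
  assumes r: "free_of_rank (homology_group (int p) X) r"
    and \<phi>: "\<And>b b'. \<lbrakk>singular_relboundary p X {} b; singular_relboundary p X {} b'\<rbrakk> \<Longrightarrow> \<phi> (b + b') = \<phi> b + \<phi> b'"
  obtains f :: "'a chain \<Rightarrow> int" where "f \<in> carrier (cochain_group p X)" "\<And>b. singular_relboundary p X {} b \<Longrightarrow> f b = \<phi> b"
proof -
  obtain \<kappa> :: "'a chain \<Rightarrow> nat \<Rightarrow> int" and z where \<kappa>: "\<And>c c' i. \<lbrakk>cycle p X c; cycle p X c'\<rbrakk> \<Longrightarrow> \<kappa> (c + c') i = \<kappa> c i + \<kappa> c' i"
    and \<kappa>0: "\<And>c. cycle p X c \<Longrightarrow> singular_relboundary p X {} c \<longleftrightarrow> (\<forall>i<r. \<kappa> c i = 0)"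
    and z: "\<And>i. cycle p X (z i)"
    and \<kappa>z: "\<And>i j. \<lbrakk>i < r; j < r\<rbrakk> \<Longrightarrow> \<kappa> (z i) j = (if i = j then 1 else 0)"
    by (rule cycle_coordinates [OF r]) blast
  define s where "s c = (\<Sum>i<r. frag_cmul (\<kappa> c i) (z i))" for c
  have s: "cycle p X (s c)" "j < r \<Longrightarrow> \<kappa> (s c) j = \<kappa> c j" for c j
  proof -
    have *: "cycle p X (s c) \<and> \<kappa> (s c) j = (\<Sum>i<r. \<kappa> c i * \<kappa> (z i) j)" for j
      unfolding s_def by (rule additive_combination [where f = "\<lambda>c. \<kappa> c j"]) (auto simp: \<kappa> z)
    then show "cycle p X (s c)" by blast
    show "\<kappa> (s c) j = \<kappa> c j" if "j < r"
    proof -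
      have "(\<Sum>i<r. \<kappa> c i * \<kappa> (z i) j) = (\<Sum>i<r. if i = j then \<kappa> c i else 0)"
        using that by (intro sum.cong) (auto simp: \<kappa>z)
      then show ?thesis
        using * [of j] that by simp
    qed
  qed
  define \<pi> where "\<pi> c = c - s c" for c
  have \<pi>: "singular_relboundary p X {} (\<pi> c)" if c: "cycle p X c" for c
  proof -
    have cyc: "cycle p X (\<pi> c)"
      unfolding \<pi>_def using c s by (intro singular_relcycle_diff) auto
    have "\<kappa> (\<pi> c) j = 0" if "j < r" for j
      using \<kappa> [OF cyc s(1), of c j] s(2) [OF that, of c] by (simp add: \<pi>_def)
    then show ?thesis
      using \<kappa>0 [OF cyc] by simp
  qed
  have \<pi>_add: "\<pi> (c + c') = \<pi> c + \<pi> c'" if "cycle p X c" "cycle p X c'" for c c'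
    using that by (simp add: \<pi>_def s_def \<kappa> frag_cmul_distrib sum.distrib)
  obtain f where f: "f \<in> carrier (cochain_group p X)" "\<And>c. cycle p X c \<Longrightarrow> f c = \<phi> (\<pi> c)"
    using extend_cycle_hom [of p X "\<lambda>c. \<phi> (\<pi> c)"] \<pi>_add \<phi> \<pi> by (metis (no_types, lifting))
  show ?thesis
  proof (rule that [OF f(1)])
    fix b assume b: "singular_relboundary p X {} b"
    then have cyc: "cycle p X b" by (rule singular_relboundary_imp_relcycle)
    then have "s b = 0" using \<kappa>0 b by (simp add: s_def)
    then show "f b = \<phi> b" using f(2) [OF cyc] by (simp add: \<pi>_def)
  qed
qed

section \<open>Universal coefficients for free homology\<close>

lemma singular_cocycle_iff:
  "f \<in> singular_cocycles p X \<longleftrightarrow>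
     f \<in> carrier (cochain_group p X) \<and> (\<forall>b. singular_relboundary p X {} b \<longrightarrow> f b = 0)"
proof -
  have "coboundary p X f = \<one>\<^bsub>cochain_group (Suc p) X\<^esub> \<longleftrightarrow> (\<forall>b. singular_relboundary p X {} b \<longrightarrow> f b = 0)"
    unfolding coboundary_def cochain_group_def singular_boundary
    by (auto simp: fun_eq_iff restrict_def)
  then show ?thesis
    by (auto simp: singular_cocycles_def kernel_def)
qed

text \<open>Evaluation on the dual cycles is onto because cycles split off the chains. A cocycle in
  its kernel vanishes on all cycles, so its value depends on the boundary of a chain only; freeness
  one degree lower extends this function of boundaries to a cochain, whose coboundary is the given
  cocycle.\<close>

lemma free_of_rank_cohomology_group:
  fixes X :: "'a topology"
  assumes r: "free_of_rank (homology_group (int p) X) r"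
    and prev: "\<And>q. p = Suc q \<Longrightarrow> \<exists>r'. free_of_rank (homology_group (int q) X) r'"
  shows "free_of_rank (cohomology_group p X) r"
proof -
  obtain \<kappa> :: "'a chain \<Rightarrow> nat \<Rightarrow> int" and z where \<kappa>: "\<And>c c' i. \<lbrakk>cycle p X c; cycle p X c'\<rbrakk> \<Longrightarrow> \<kappa> (c + c') i = \<kappa> c i + \<kappa> c' i"
    and \<kappa>0: "\<And>c. cycle p X c \<Longrightarrow> singular_relboundary p X {} c \<longleftrightarrow> (\<forall>i<r. \<kappa> c i = 0)"
    and z: "\<And>i. cycle p X (z i)"
    and \<kappa>z: "\<And>i j. \<lbrakk>i < r; j < r\<rbrakk> \<Longrightarrow> \<kappa> (z i) j = (if i = j then 1 else 0)"
    by (rule cycle_coordinates [OF r]) blast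
  let ?Z = "(cochain_group p X)\<lparr>carrier := singular_cocycles p X\<rparr>"
  define ev where "ev f i = (if i < r then f (z i) else 0)" for f :: "'a chain \<Rightarrow> int" and i
  have zc: "singular_chain p X (z i)" for i
    using z by (simp add: singular_cycle)
  have hom: "ev \<in> hom ?Z (int_functions {..<r})"
    using zc by (auto simp: hom_def ev_def cochain_group_def fun_eq_iff)
  interpret ev: group_hom ?Z "int_functions {..<r}" ev
    using hom group.subgroup_imp_group [OF comm_group.axioms(2) [OF comm_group_cochain_group] subgroup_singular_cocycles]
    by (simp add: group_hom_def group_hom_axioms_def)
  have cyc_add: "f (c + c') = f c + f c'"
    if "f \<in> carrier (cochain_group p X)" "cycle p X c" "cycle p X c'" for f c c'
    by (rule cochain_apply_add [OF that(1)]) (use that in \<open>auto simp: singular_cycle\<close>)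
  have surj: "ev ` carrier ?Z = carrier (int_functions {..<r})"
  proof
    show "ev ` carrier ?Z \<subseteq> carrier (int_functions {..<r})"
      by (auto simp: ev_def)
    show "carrier (int_functions {..<r}) \<subseteq> ev ` carrier ?Z"
    proof
      fix v assume v: "v \<in> carrier (int_functions {..<r})"
      define \<phi> where "\<phi> c = (\<Sum>i<r. \<kappa> c i * v i)" for c
      have "\<phi> (c + c') = \<phi> c + \<phi> c'" if "cycle p X c" "cycle p X c'" for c c'
        using that by (simp add: \<phi>_def \<kappa> algebra_simps sum.distrib)
      then obtain f where f: "f \<in> carrier (cochain_group p X)" "\<And>c. cycle p X c \<Longrightarrow> f c = \<phi> c"
        using extend_cycle_hom [of p X \<phi>] by metis
      have "f b = 0" if "singular_relboundary p X {} b" for b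
        using that f(2) \<kappa>0 singular_relboundary_imp_relcycle [OF that] by (simp add: \<phi>_def)
      then have "f \<in> carrier ?Z"
        using f(1) by (simp add: singular_cocycle_iff)
      moreover have "ev f = v"
      proof
        fix j show "ev f j = v j"
        proof (cases "j < r")
          case True
          then have "ev f j = (\<Sum>i<r. \<kappa> (z j) i * v i)"
            using f(2) [OF z] by (simp add: ev_def \<phi>_def)
          also have "\<dots> = (\<Sum>i<r. if i = j then v i else 0)"
            using True by (intro sum.cong) (auto simp: \<kappa>z)
          finally show ?thesis using True by simp
        qed (use v in \<open>auto simp: ev_def\<close>)
      qed
      ultimately show "v \<in> ev ` carrier ?Z" by blast
    qed
  qed
  have ker: "kernel ?Z (int_functions {..<r}) ev = singular_coboundaries p X"
  proof (intro equalityI subsetI)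
    fix f assume f: "f \<in> singular_coboundaries p X"
    then have fz: "f \<in> singular_cocycles p X"
      using singular_coboundaries_subset_cocycles by blast
    have "f (z i) = 0" for i
    proof (cases p)
      case 0
      then show ?thesis using f zc [of i] by (auto simp: singular_coboundaries_def cochain_group_def)
    next
      case (Suc q)
      then obtain g where g: "g \<in> carrier (cochain_group q X)" "f = coboundary q X g"
        using f by (auto simp: singular_coboundaries_def)
      have "g 0 = 0"
        using cochain_apply_add [OF g(1), of 0 0] by simp
      then show ?thesis
        using z [of i] Suc g(2) by (simp add: coboundary_def singular_cycle)
    qed
    then show "f \<in> kernel ?Z (int_functions {..<r}) ev"
      using fz by (auto simp: kernel_def ev_def)
  next
    fix f assume "f \<in> kernel ?Z (int_functions {..<r}) ev"
    then have f: "f \<in> carrier (cochain_group p X)" "\<And>b. singular_relboundary p X {} b \<Longrightarrow> f b = 0"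
      and fz: "\<And>i. i < r \<Longrightarrow> f (z i) = 0"
      by (auto simp: kernel_def singular_cocycle_iff ev_def fun_eq_iff split: if_splits)
    have f_cyc: "f c = 0" if c: "cycle p X c" for c
    proof -
      \<comment> \<open>A cycle homologous to \<open>c\<close>: the difference has zero coordinates,
        is thus a boundary, and is killed by \<open>f\<close>.\<close>
      let ?s = "\<Sum>i<r. frag_cmul (\<kappa> c i) (z i)"
      have s: "cycle p X ?s" "f ?s = 0"
        using additive_combination [of p X f z "{..<r}" "\<kappa> c"] cyc_add [OF f(1)] z fz by auto
      have \<kappa>s: "\<kappa> ?s j = \<kappa> c j" if "j < r" for j
      proof -
        have "\<kappa> ?s j = (\<Sum>i<r. \<kappa> c i * \<kappa> (z i) j)"
          using additive_combination [of p X "\<lambda>c. \<kappa> c j" z "{..<r}" "\<kappa> c"] \<kappa> z by auto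
        also have "\<dots> = (\<Sum>i<r. if i = j then \<kappa> c i else 0)"
          using that by (intro sum.cong) (auto simp: \<kappa>z)
        finally show ?thesis
          using that by simp
      qed
      have d: "cycle p X (c - ?s)"
        using c s by (intro singular_relcycle_diff)
      have "\<kappa> (c - ?s) j = 0" if "j < r" for j
        using \<kappa> [OF d s(1), of j] \<kappa>s [OF that] by simp
      then have "singular_relboundary p X {} (c - ?s)"
        using \<kappa>0 [OF d] by simp
      then show ?thesis
        using cyc_add [OF f(1) d s(1)] s(2) f(2) by simp
    qed
    show "f \<in> singular_coboundaries p X"
    proof (cases p)
      case 0
      then have "f c = 0" if "singular_chain p X c" for c
        using f_cyc that by (simp add: singular_cycle chain_boundary_def)
      then have "f = \<one>\<^bsub>cochain_group p X\<^esub>"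
        using f(1) by (auto simp: cochain_group_def extensional_def fun_eq_iff)
      then show ?thesis using 0 by (simp add: singular_coboundaries_def)
    next
      case (Suc q)
      obtain r' where r': "free_of_rank (homology_group (int q) X) r'"
        using prev [OF Suc] by blast
      \<comment> \<open>Any chain with boundary \<open>b\<close> serves, since two of them differ by
        a cycle, on which \<open>f\<close> is 0.\<close>
      define lift where "lift b = (SOME c. singular_chain p X c \<and> chain_boundary p c = b)" for b
      have lift: "singular_chain p X (lift b)" "chain_boundary p (lift b) = b" if "singular_relboundary q X {} b" for b
        using someI_ex [of "\<lambda>c. singular_chain p X c \<and> chain_boundary p c = b"] that
        by (auto simp: lift_def singular_boundary Suc)
      have f_lift: "f c = f (lift b)" if "singular_chain p X c" "chain_boundary p c = b" "singular_relboundary q X {} b" for b c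
      proof -
        have "cycle p X (c - lift b)"
          using that lift [OF that(3)] by (simp add: singular_cycle singular_chain_diff chain_boundary_diff)
        then have "f (c - lift b) = 0" "singular_chain p X (c - lift b)"
          using f_cyc by (auto simp: singular_cycle)
        then show ?thesis
          using cochain_apply_add [OF f(1), of "c - lift b" "lift b"] lift(1) [OF that(3)] by simp
      qed
      have "f (lift (b + b')) = f (lift b) + f (lift b')"
        if b: "singular_relboundary q X {} b" "singular_relboundary q X {} b'" for b b'
      proof -
        have "f (lift b + lift b') = f (lift (b + b'))"
          using lift [OF b(1)] lift [OF b(2)] b
          by (intro f_lift) (auto simp: singular_chain_add chain_boundary_add singular_relboundary_add)
        then show ?thesis
          using cochain_apply_add [OF f(1) lift(1) [OF b(1)] lift(1) [OF b(2)]] by simp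
      qed
      then obtain g where g: "g \<in> carrier (cochain_group q X)" "\<And>b. singular_relboundary q X {} b \<Longrightarrow> g b = f (lift b)"
        using extend_boundary_hom [OF r', of "\<lambda>b. f (lift b)"] by metis
      have "f = coboundary q X g"
      proof
        fix c show "f c = coboundary q X g c"
        proof (cases "singular_chain p X c")
          case True
          then have "singular_relboundary q X {} (chain_boundary p c)"
            using Suc by (auto simp: singular_boundary)
          then show ?thesis
            using g(2) f_lift [OF True refl] True Suc by (simp add: coboundary_def)
        next
          case False
          then show ?thesis
            using f(1) Suc by (auto simp: coboundary_def cochain_group_def extensional_def)
        qed
      qed
      then show ?thesis
        using g(1) Suc by (auto simp: singular_coboundaries_def)
    qed
  qed
  show ?thesis
    using ev.FactGroup_iso_set [OF surj] unfolding ker cohomology_group_def free_of_rank_def by blast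
qed

text \<open>Almost all summands are trivial, so the finite support demanded by the direct sum is
  automatic and the coordinates can be collected over the disjoint union of the index sets.\<close>

lemma iso_sum_group_int_functions:
  fixes G :: "nat \<Rightarrow> ('a, 'b) monoid_scheme"
  assumes G: "\<And>p. group (G p)" and free: "\<And>p. free_of_rank (G p) (b p)"
    and fin: "finite {p. b p \<noteq> 0}"
  shows "\<exists>\<kappa>. \<kappa> \<in> iso (sum_group UNIV G) (int_functions (SIGMA p:UNIV. {..<b p}))"
proof -
  let ?I = "SIGMA p:UNIV. {..<b p}"
  obtain \<gamma> where \<gamma>: "\<And>p. \<gamma> p \<in> iso (G p) (int_functions {..<b p})"
    using free unfolding free_of_rank_def by metis
  have hom: "\<gamma> p \<in> hom (G p) (int_functions {..<b p})"
    and inj: "inj_on (\<gamma> p) (carrier (G p))"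
    and surj: "\<gamma> p ` carrier (G p) = carrier (int_functions {..<b p})" for p
    using \<gamma> [of p] by (auto simp: iso_def bij_betw_def)
  have one: "\<gamma> p \<one>\<^bsub>G p\<^esub> = (\<lambda>_. 0)" for p
    using hom_one [OF hom G group_int_functions] by simp
  have out: "\<gamma> p x i = 0" if "x \<in> carrier (G p)" "\<not> i < b p" for p x i
    using hom_in_carrier [OF hom that(1)] that(2) by simp
  have carrier: "x \<in> carrier (sum_group UNIV G) \<longleftrightarrow> (\<forall>p. x p \<in> carrier (G p))" for x
  proof -
    have "finite {p. x p \<noteq> \<one>\<^bsub>G p\<^esub>}" if x: "\<forall>p. x p \<in> carrier (G p)"
    proof (rule finite_subset [OF _ fin], rule subsetI)
      fix p assume p: "p \<in> {p. x p \<noteq> \<one>\<^bsub>G p\<^esub>}"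
      have "b p \<noteq> 0"
      proof
        assume "b p = 0"
        then have "\<gamma> p (x p) = \<gamma> p \<one>\<^bsub>G p\<^esub>"
          using out x one by auto
        then show False
          using p x inj_onD [OF inj] group.is_monoid [OF G] by (fastforce intro: monoid.one_closed)
      qed
      then show "p \<in> {p. b p \<noteq> 0}" by simp
    qed
    then show ?thesis
      using G by (auto simp: carrier_sum_group)
  qed
  define \<kappa> where "\<kappa> x = (\<lambda>(p, i). \<gamma> p (x p) i)" for x
  have "\<kappa> \<in> iso (sum_group UNIV G) (int_functions ?I)"
  proof (rule isoI, rule homI)
    fix x y assume x: "x \<in> carrier (sum_group UNIV G)" and y: "y \<in> carrier (sum_group UNIV G)"
    show "\<kappa> x \<in> carrier (int_functions ?I)"
      using x out by (auto simp: carrier \<kappa>_def)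
    have "\<gamma> p (x p \<otimes>\<^bsub>G p\<^esub> y p) = (\<lambda>i. \<gamma> p (x p) i + \<gamma> p (y p) i)" for p
      using hom_mult [OF hom, of "x p" p "y p"] x y carrier by simp
    then show "\<kappa> (x \<otimes>\<^bsub>sum_group UNIV G\<^esub> y) = \<kappa> x \<otimes>\<^bsub>int_functions ?I\<^esub> \<kappa> y"
      by (auto simp: \<kappa>_def fun_eq_iff)
  next
    show "bij_betw \<kappa> (carrier (sum_group UNIV G)) (carrier (int_functions ?I))"
      unfolding bij_betw_def
    proof (intro conjI equalityI subsetI)
      show "inj_on \<kappa> (carrier (sum_group UNIV G))"
      proof (rule inj_onI)
        fix x y assume x: "x \<in> carrier (sum_group UNIV G)" and y: "y \<in> carrier (sum_group UNIV G)" and eq: "\<kappa> x = \<kappa> y"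
        have "\<gamma> p (x p) i = \<gamma> p (y p) i" for p i
          using fun_cong [OF eq, of "(p, i)"] by (simp add: \<kappa>_def)
        then have "\<gamma> p (x p) = \<gamma> p (y p)" for p
          by (rule ext)
        then show "x = y"
          using x y carrier inj_onD [OF inj] by blast
      qed
      show "v \<in> carrier (int_functions ?I)" if "v \<in> \<kappa> ` carrier (sum_group UNIV G)" for v
        using that out by (auto simp: carrier \<kappa>_def)
      fix v assume v: "v \<in> carrier (int_functions ?I)"
      have "\<exists>x. x \<in> carrier (G p) \<and> \<gamma> p x = (\<lambda>i. v (p, i))" for p
      proof -
        have "(\<lambda>i. v (p, i)) \<in> \<gamma> p ` carrier (G p)"
          unfolding surj using v by simp
        then show ?thesis by auto
      qed
      then have "\<exists>x. \<forall>p. x p \<in> carrier (G p) \<and> \<gamma> p (x p) = (\<lambda>i. v (p, i))"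
        by (intro choice allI)
      then obtain x where x: "\<And>p. x p \<in> carrier (G p)" "\<And>p. \<gamma> p (x p) = (\<lambda>i. v (p, i))"
        by blast
      have "\<kappa> x = v"
        by (auto simp: \<kappa>_def x(2))
      then show "v \<in> \<kappa> ` carrier (sum_group UNIV G)"
        using x(1) carrier by blast
    qed
  qed
  then show ?thesis by blast
qed

section \<open>Rank\<close>

text \<open>Gaussian elimination without division, by induction on the number of
  coordinates.\<close>

lemma integer_linear_dependence:
  fixes f :: "'b \<Rightarrow> 'i \<Rightarrow> int"
  assumes "finite I" "finite B" "card I < card B"
  shows "\<exists>c. (\<exists>b\<in>B. c b \<noteq> 0) \<and> (\<forall>i\<in>I. (\<Sum>b\<in>B. c b * f b i) = 0)"
  using assms
proof (induction I arbitrary: B f rule: finite_induct)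
  case empty
  then obtain b where "b \<in> B" by fastforce
  then show ?case by (intro exI [of _ "\<lambda>_. 1"]) auto
next
  case (insert j I)
  show ?case
  proof (cases "\<forall>b\<in>B. f b j = 0")
    case True
    have "card I < card B" using insert by simp
    then obtain c where "\<exists>b\<in>B. c b \<noteq> 0" "\<forall>i\<in>I. (\<Sum>b\<in>B. c b * f b i) = 0"
      using insert.IH [OF insert.prems(1), of f] by blast
    then show ?thesis
      using True by (intro exI [of _ c]) auto
  next
    case False
    then obtain a where a: "a \<in> B" "f a j \<noteq> 0" by blast
    let ?B = "B - {a}"
    \<comment> \<open>Cross multiplication with the pivot \<open>a\<close> clears the coordinate
      \<open>j\<close> and stays within the integers.\<close>
    define g where "g b i = f a j * f b i - f b j * f a i" for b i
    have "card I < card ?B" "finite ?B"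
      using insert a by auto
    then obtain c where c: "\<exists>b\<in>?B. c b \<noteq> 0" "\<forall>i\<in>I. (\<Sum>b\<in>?B. c b * g b i) = 0"
      using insert.IH [of ?B g] by blast
    \<comment> \<open>Back substitution: the coefficient at \<open>a\<close> makes the combination
      of the \<open>f b\<close> equal to that of the \<open>g b\<close>, and the nonzero pivot
      preserves a nonzero coefficient.\<close>
    define c' where "c' b = (if b = a then - (\<Sum>b\<in>?B. c b * f b j) else c b * f a j)" for b
    have sum: "(\<Sum>b\<in>B. c' b * f b i) = (\<Sum>b\<in>?B. c b * g b i)" for i
    proof -
      have "(\<Sum>b\<in>B. c' b * f b i) = c' a * f a i + (\<Sum>b\<in>?B. c' b * f b i)"
        using insert.prems(1) a(1) by (simp add: sum.remove)
      also have "(\<Sum>b\<in>?B. c' b * f b i) = (\<Sum>b\<in>?B. c b * f a j * f b i)"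
        by (intro sum.cong) (auto simp: c'_def)
      also have "c' a * f a i = (\<Sum>b\<in>?B. - (c b * f b j * f a i))"
        by (simp add: c'_def sum_distrib_right sum_negf)
      also have "(\<Sum>b\<in>?B. - (c b * f b j * f a i)) + (\<Sum>b\<in>?B. c b * f a j * f b i) = (\<Sum>b\<in>?B. c b * g b i)"
        by (simp add: g_def algebra_simps flip: sum.distrib)
      finally show ?thesis .
    qed
    have "g b j = 0" for b by (simp add: g_def)
    then have "\<forall>i\<in>insert j I. (\<Sum>b\<in>B. c' b * f b i) = 0"
      using c(2) sum by simp
    moreover have "\<exists>b\<in>B. c' b \<noteq> 0"
      using c(1) a(2) by (auto simp: c'_def)
    ultimately show ?thesis by blast
  qed
qed

section \<open>Rank and basis read off from integer coordinates\<close>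

context
  fixes G :: "'a monoid" and I :: "'i set" and \<kappa> :: "'a \<Rightarrow> 'i \<Rightarrow> int"
  assumes G: "comm_group G" and I: "finite I" and \<kappa>: "\<kappa> \<in> iso G (int_functions I)"
begin

lemma coordinate_finprod:
  assumes "finite B" "B \<subseteq> carrier G"
  shows "\<kappa> (finprod G (\<lambda>b. b [^]\<^bsub>G\<^esub> c b) B) i = (\<Sum>b\<in>B. (c b :: int) * \<kappa> b i)"
proof -
  interpret G: comm_group G by (rule G)
  have "(\<lambda>x. \<kappa> x i) \<in> hom G integer_group"
    using \<kappa> by (auto simp: iso_def hom_def)
  then interpret e: group_hom G integer_group "\<lambda>x. \<kappa> x i"
    by (simp add: group_hom_def group_hom_axioms_def)
  show ?thesis
    using assms
  proof (induction B rule: finite_induct)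
    case empty
    then show ?case using e.hom_one by simp
  next
    case (insert b B)
    then have "(\<lambda>b. b [^]\<^bsub>G\<^esub> c b) \<in> B \<rightarrow> carrier G" "b \<in> carrier G"
      by auto
    then show ?case
      using insert by (simp add: e.hom_int_pow)
  qed
qed

text \<open>More than \<open>card I\<close> elements are dependent by elimination, and preimages of
  the unit vectors attain the bound.\<close>

lemma abelian_rank_int_functions: "abelian_rank G = enat (card I)"
proof (rule antisym)
  interpret G: comm_group G by (rule G)
  have inj: "inj_on \<kappa> (carrier G)" and surj: "\<kappa> ` carrier G = carrier (int_functions I)"
    using \<kappa> by (auto simp: iso_def bij_betw_def)
  have one: "\<kappa> \<one>\<^bsub>G\<^esub> = (\<lambda>_. 0)"
    using \<kappa> hom_one [of \<kappa> G "int_functions I"] by (simp add: iso_def)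
  have out: "\<kappa> x i = 0" if "x \<in> carrier G" "i \<notin> I" for x i
    using surj that by (metis carrier_int_functions imageI)
  show "abelian_rank G \<le> enat (card I)"
    unfolding abelian_rank_def
  proof (rule SUP_least)
    fix B assume "B \<in> {B. int_independent G B}"
    then have B: "finite B" "B \<subseteq> carrier G"
      and indep: "\<And>c. finprod G (\<lambda>b. b [^]\<^bsub>G\<^esub> (c b :: int)) B = \<one>\<^bsub>G\<^esub> \<Longrightarrow> \<forall>b\<in>B. c b = 0"
      by (auto simp: int_independent_def)
    have "card B \<le> card I"
    proof (rule ccontr)
      assume "\<not> card B \<le> card I"
      then obtain c where c: "\<exists>b\<in>B. c b \<noteq> 0" "\<forall>i\<in>I. (\<Sum>b\<in>B. c b * \<kappa> b i) = 0"
        using integer_linear_dependence [OF I B(1), of \<kappa>] by (auto simp: not_le)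
      let ?x = "finprod G (\<lambda>b. b [^]\<^bsub>G\<^esub> c b) B"
      have x: "?x \<in> carrier G"
        using B by (intro G.finprod_closed) auto
      have "\<kappa> ?x i = 0" for i
        using c(2) out [OF x, of i] coordinate_finprod [OF B, of c i] by (cases "i \<in> I") auto
      then have "\<kappa> ?x = \<kappa> \<one>\<^bsub>G\<^esub>"
        unfolding one by (rule ext)
      then have "?x = \<one>\<^bsub>G\<^esub>"
        using inj_onD [OF inj] x by blast
      then show False
        using indep c(1) by blast
    qed
    then show "enat (card B) \<le> enat (card I)" by simp
  qed
  define u where "u i = (\<lambda>j. if j = i then 1 else 0 :: int)" for i :: 'i
  have "\<exists>z. \<forall>i. i \<in> I \<longrightarrow> z i \<in> carrier G \<and> \<kappa> (z i) = u i"
  proof (intro choice allI)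
    show "\<exists>z. i \<in> I \<longrightarrow> z \<in> carrier G \<and> \<kappa> z = u i" for i
    proof (cases "i \<in> I")
      case True
      then have "u i \<in> \<kappa> ` carrier G"
        unfolding surj by (auto simp: u_def)
      then show ?thesis by auto
    qed simp
  qed
  then obtain z where z: "\<And>i. i \<in> I \<Longrightarrow> z i \<in> carrier G" "\<And>i. i \<in> I \<Longrightarrow> \<kappa> (z i) = u i"
    by blast
  have inj_z: "inj_on z I"
  proof (rule inj_onI)
    fix i j assume "i \<in> I" "j \<in> I" "z i = z j"
    then have "u i i = u j i" using z(2) by metis
    then show "i = j" by (simp add: u_def split: if_splits)
  qed
  have "int_independent G (z ` I)"
    unfolding int_independent_def
  proof (intro conjI allI impI)
    fix c :: "'a \<Rightarrow> int" assume eq: "finprod G (\<lambda>b. b [^]\<^bsub>G\<^esub> c b) (z ` I) = \<one>\<^bsub>G\<^esub>"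
    have "c (z i) = 0" if i: "i \<in> I" for i
    proof -
      have "0 = (\<Sum>b\<in>z ` I. c b * \<kappa> b i)"
        using coordinate_finprod [of "z ` I" c i] I z(1) eq one by auto
      also have "\<dots> = (\<Sum>j\<in>I. c (z j) * \<kappa> (z j) i)"
        by (simp add: sum.reindex [OF inj_z])
      also have "\<dots> = (\<Sum>j\<in>I. if j = i then c (z j) else 0)"
        by (intro sum.cong) (auto simp: z(2) u_def)
      finally show ?thesis
        using I i by simp
    qed
    then show "\<forall>b\<in>z ` I. c b = 0" by blast
  qed (use I z(1) in auto)
  then have "enat (card (z ` I)) \<le> abelian_rank G"
    unfolding abelian_rank_def by (intro SUP_upper) simp
  then show "enat (card I) \<le> abelian_rank G"
    by (simp add: card_image [OF inj_z])
qed

text \<open>The definition of \<open>is_free_abelian\<close> asks for a basis inside the element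
  type; an infinite type contains a set of \<open>card I\<close> elements, which serve as mere
  labels.\<close>

lemma is_free_abelian_int_functions:
  assumes "infinite (UNIV :: 'a set)"
  shows "is_free_abelian G"
proof -
  obtain S :: "'a set" where S: "finite S" "card S = card I"
    using infinite_arbitrarily_large [OF assms, of "card I"] by blast
  obtain g where g: "bij_betw g I S"
    using finite_same_card_bij [OF I S(1)] S(2) by metis
  define h where "h x = (\<lambda>i. if i \<in> I then Poly_Mapping.lookup x (g i) else 0)" for x :: "'a \<Rightarrow>\<^sub>0 int"
  have "h \<in> iso (free_Abelian_group S) (int_functions I)"
  proof (rule isoI)
    show "h \<in> hom (free_Abelian_group S) (int_functions I)"
      by (auto simp: hom_def h_def lookup_add)
    show "bij_betw h (carrier (free_Abelian_group S)) (carrier (int_functions I))"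
      unfolding bij_betw_def
    proof (intro conjI equalityI subsetI)
      show "inj_on h (carrier (free_Abelian_group S))"
      proof (rule inj_onI, rule poly_mapping_eqI)
        fix x y s assume x: "x \<in> carrier (free_Abelian_group S)" and y: "y \<in> carrier (free_Abelian_group S)" and eq: "h x = h y"
        show "Poly_Mapping.lookup x s = Poly_Mapping.lookup y s"
        proof (cases "s \<in> S")
          case True
          then obtain i where "i \<in> I" "s = g i"
            using g by (auto simp: bij_betw_def)
          then show ?thesis using fun_cong [OF eq, of i] by (simp add: h_def)
        next
          case False
          then have "s \<notin> Poly_Mapping.keys x" "s \<notin> Poly_Mapping.keys y"
            using x y by auto
          then show ?thesis by (simp add: in_keys_iff)
        qed
      qed
      show "v \<in> carrier (int_functions I)" if "v \<in> h ` carrier (free_Abelian_group S)" for v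
        using that by (auto simp: h_def)
      fix v assume v: "v \<in> carrier (int_functions I)"
      define x where "x = (\<Sum>i\<in>I. frag_cmul (v i) (frag_of (g i)))"
      have lookup: "Poly_Mapping.lookup x s = (\<Sum>i\<in>I. if g i = s then v i else 0)" for s
        by (simp add: x_def lookup_sum lookup_single when_def if_distrib eq_commute [of s] cong: if_cong)
      have "Poly_Mapping.lookup x s = 0" if "s \<notin> S" for s
        unfolding lookup using that g by (intro sum.neutral) (auto simp: bij_betw_def)
      then have "x \<in> carrier (free_Abelian_group S)"
        by (auto simp: in_keys_iff)
      moreover have "h x = v"
      proof
        fix i show "h x i = v i"
        proof (cases "i \<in> I")
          case True
          then have "Poly_Mapping.lookup x (g i) = (\<Sum>j\<in>I. if j = i then v j else 0)"
            unfolding lookup using g by (intro sum.cong) (auto simp: bij_betw_def inj_on_def)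
          then show ?thesis using True I by (simp add: h_def)
        qed (use v in \<open>auto simp: h_def\<close>)
      qed
      ultimately show "v \<in> h ` carrier (free_Abelian_group S)" by blast
    qed
  qed
  then have "inv_into (carrier (free_Abelian_group S)) h \<in> iso (int_functions I) (free_Abelian_group S)"
    by (intro group.iso_set_sym) auto
  then have "G \<cong> free_Abelian_group S"
    using Group.iso_set_trans [OF \<kappa>] by (auto simp: is_iso_def)
  then show ?thesis
    using G by (auto simp: is_free_abelian_def)
qed

end

theorem proposition3p65:
  fixes n :: nat
  shows "abelian_rank (total_cohomology (T_tilde n)) = enat ((2 * n) choose n)
    \<and> is_free_abelian (total_cohomology (T_tilde n))"
proof -
  \<comment> \<open>The number of cells of dimension \<open>p\<close>, which is the Betti number in
    that degree.\<close>
  define b where "b p = card {J \<in> cells (2 * n). p = card J}" for p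
  have fin: "finite (cells (2 * n))"
    by (rule finite_subset [of _ "Pow {1..2 * n}"]) (auto simp: cells_def)
  have hom: "free_of_rank (homology_group (int p) (T_tilde n)) (b p)" for p
    using homology_T_tilde [of "int p" n] by (simp add: b_def)
  have coh: "free_of_rank (cohomology_group p (T_tilde n)) (b p)" for p
    using hom by (intro free_of_rank_cohomology_group) auto
  have b0: "{p. b p \<noteq> 0} \<subseteq> card ` cells (2 * n)"
    using fin by (auto simp: b_def card_eq_0_iff)
  then have fin_b: "finite {p. b p \<noteq> 0}"
    using fin finite_surj by blast
  let ?I = "SIGMA p:UNIV. {..<b p}"
  obtain \<kappa> where \<kappa>: "\<kappa> \<in> iso (total_cohomology (T_tilde n)) (int_functions ?I)"
    using iso_sum_group_int_functions [OF comm_group.axioms(2) [OF comm_group_cohomology_group] coh fin_b]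
    unfolding total_cohomology_def by blast
  have I: "?I = (SIGMA p:card ` cells (2 * n). {..<b p})"
    using b0 by fastforce
  have finI: "finite ?I"
    unfolding I using fin by (intro finite_SigmaI) auto
  have "card ?I = (\<Sum>p\<in>card ` cells (2 * n). b p)"
    unfolding I using fin by simp
  \<comment> \<open>Every cell is counted exactly once, at its own dimension.\<close>
  also have "\<dots> = card (cells (2 * n))"
    using sum.group [of "cells (2 * n)" "card ` cells (2 * n)" card "\<lambda>_. 1 :: nat"] fin
    by (simp add: b_def eq_commute)
  also have "\<dots> = (2 * n) choose n"
    by (rule card_cells)
  finally have card: "card ?I = (2 * n) choose n" .
  have "infinite (UNIV :: (nat \<Rightarrow> ((nat \<Rightarrow> complex) chain \<Rightarrow> int) set) set)"
  proof -
    \<comment> \<open>Functions that are empty at a single degree \<open>k\<close> are distinct for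
      distinct \<open>k\<close>, which makes the element type infinite.\<close>
    have "inj (\<lambda>(k :: nat) (p :: nat). if p = k then {} else UNIV :: ((nat \<Rightarrow> complex) chain \<Rightarrow> int) set)" (is "inj ?f")
    proof (rule injI)
      fix k l :: nat assume "?f k = ?f l"
      then have "?f k k = ?f l k" by (rule fun_cong)
      then show "k = l" by (simp split: if_splits)
    qed
    then have "infinite (range ?f)"
      by (rule range_inj_infinite)
    then show ?thesis
      by (rule infinite_super [OF subset_UNIV])
  qed
  then show ?thesis
    using abelian_rank_int_functions [OF comm_group_total_cohomology finI \<kappa>]
      is_free_abelian_int_functions [OF comm_group_total_cohomology finI \<kappa>] card by simp
qed

end
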